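(* Let $0<p<1$, $q=1-p$, $h=-p\log p-q\log q$. Let $(X_n)_{n\ge0}$ be random variables with $X_0=X_1=0$ and, for $n\ge2$, \[ X_n\stackrel{d}{=}X_{I_n}+X^*_{n-I_n}+T_n, \] where $I_n\sim\mathrm{Binom}(n,p)$, $(X^*_k)$ is an independent copy of $(X_k)$, and $X,X^*,I_n,T_n$ are independent. Let $\tilde g_1(z)=e^{-z}\sum_{n\ge2}\mathbb{E}(T_n)z^n/n!$ (i.e. $\mathbb{E}(T_0)=\mathbb{E}(T_1)$ are taken to be $0$) and $G_1(s)$ the meromorphic continuation of $\mathscr{M}[\tilde g_1;s]$. Let $0<\theta<\pi/2$, $\alpha<1$, $\beta\in\mathbb{R}$. Suppose either (i) $\tilde g_1\in\mathscr{J\!\!S}_{\alpha,\beta}$ (in which case set $c=0$), or (ii) $\tilde g_1\in\mathscr{J\!\!S}$ and $\tilde g_1(z)=cz+O\big(|z|^\alpha(\log_+|z|)^\beta\big)$ for some $c\in\mathbb{R}$, uniformly as $|z|\to\infty$ with $|\arg z|\le\theta$. Then \[ \frac{\mathbb{E}(X_n)}{n}=\frac{c}{h}\log n+d+\mathscr{F}[G_1](r\log_{1/p}n)+o(1), \] where $d=G_1(-1)/h$ if $c=0$, and $d=\frac{c_0}{h}+\frac{c(p\log^2p+q\log^2q)}{2h^2}$ with $c_0=\lim_{s\to-1}\big(G_1(s)+\frac{c}{s+1}\big)$ if $c\neq0$.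
   Context: $\log_+x=\log(1+x)$. $\mathscr{M}[\tilde g;s]=\int_0^\infty\tilde g(z)z^{s-1}dz$. An entire $\tilde f$ is in $\mathscr{J\!\!S}_{\alpha,\beta}$ if for some $0<\theta'<\pi/2$ and $|z|\ge1$: (I) $\tilde f(z)=O(|z|^\alpha(\log_+|z|)^\beta)$ uniformly for $|\arg z|\le\theta'$; (O) $e^z\tilde f(z)=O(e^{(1-\varepsilon)|z|})$ uniformly for $\theta'\le|\arg z|\le\pi$, some $\varepsilon>0$; $\mathscr{J\!\!S}=\bigcup_{\alpha,\beta}\mathscr{J\!\!S}_{\alpha,\beta}$. $\mathscr{F}[G](x)$: if $\frac{\log p}{\log q}=\frac r\ell$ with coprime positive integers $r,\ell$, $\mathscr{F}[G](x)=h^{-1}\sum_{k\ne0}G(-1+\chi_k)e^{2k\pi ix}$ with $\chi_k=\frac{2rk\pi i}{\log p}$; if $\frac{\log p}{\log q}\notin\mathbb{Q}$, $\mathscr{F}[G]\equiv0$. *)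

theory Defs
  imports "HOL-Probability.Probability" "HOL-Complex_Analysis.Complex_Analysis"
    "HOL-Library.Landau_Symbols"
begin

definition log_plus :: "real \<Rightarrow> real" where
  "log_plus x = ln (1 + x)"

definition JS :: "real \<Rightarrow> real \<Rightarrow> (complex \<Rightarrow> complex) set" where
  "JS \<alpha> \<beta> = {f. f holomorphic_on UNIV \<and>
     (\<exists>\<theta>'. 0 < \<theta>' \<and> \<theta>' < pi / 2 \<and>
       (\<exists>C. \<forall>z. 1 \<le> norm z \<longrightarrow> \<bar>Arg z\<bar> \<le> \<theta>' \<longrightarrow>
          norm (f z) \<le> C * (norm z powr \<alpha> * log_plus (norm z) powr \<beta>)) \<and>
       (\<exists>\<epsilon>>0. \<exists>C. \<forall>z. 1 \<le> norm z \<longrightarrow> \<theta>' \<le> \<bar>Arg z\<bar> \<longrightarrow>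
          norm (exp z * f z) \<le> C * exp ((1 - \<epsilon>) * norm z)))}"

definition JS_all :: "(complex \<Rightarrow> complex) set" where
  "JS_all = (\<Union>\<alpha> \<beta>. JS \<alpha> \<beta>)"

text \<open>Entire only if the series converges for every \<open>z\<close>; this has to be assumed separately,
  since the value of a divergent \<open>suminf\<close> is unspecified.\<close>

definition poisson_gf :: "(nat \<Rightarrow> real) \<Rightarrow> complex \<Rightarrow> complex" where
  "poisson_gf a z = exp (- z) * (\<Sum>n. of_real (a n) * z ^ n / fact n)"

definition mellin_integrand :: "(complex \<Rightarrow> complex) \<Rightarrow> complex \<Rightarrow> real \<Rightarrow> complex" where
  "mellin_integrand g s x = g (of_real x) * of_real x powr (s - 1)"

definition mellin :: "(complex \<Rightarrow> complex) \<Rightarrow> complex \<Rightarrow> complex" where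
  "mellin g s = (LINT x:{0<..}|lborel. mellin_integrand g s x)"

definition vstrip :: "real \<Rightarrow> real \<Rightarrow> complex set" where
  "vstrip a b = {s. a < Re s \<and> Re s < b}"

definition is_mellin_continuation ::
  "(complex \<Rightarrow> complex) \<Rightarrow> complex set \<Rightarrow> (complex \<Rightarrow> complex) \<Rightarrow> bool" where
  "is_mellin_continuation g D G \<longleftrightarrow> G nicely_meromorphic_on D \<and>
     (\<exists>a b. a < b \<and> vstrip a b \<subseteq> D \<and>
       (\<forall>s\<in>vstrip a b. set_integrable lborel {0<..} (mellin_integrand g s) \<and> G s = mellin g s))"

text \<open>For open connected \<open>D\<close>, the values on \<open>D\<close> do not depend on the choice (identity theorem;
  a nicely meromorphic function has no spurious values at removable singularities).\<close>

definition mellin_continuation ::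
  "(complex \<Rightarrow> complex) \<Rightarrow> complex set \<Rightarrow> complex \<Rightarrow> complex" where
  "mellin_continuation g D = (SOME G. is_mellin_continuation g D G)"

definition entropy_pq :: "real \<Rightarrow> real" where
  "entropy_pq p = - p * ln p - (1 - p) * ln (1 - p)"

text \<open>The numerator \<open>r\<close> of \<open>ln p / ln q = r / l\<close> in lowest terms; meaningful only if this
  quotient is rational.\<close>

definition log_ratio_num :: "real \<Rightarrow> nat" where
  "log_ratio_num p = (THE r. \<exists>l::nat. 0 < r \<and> 0 < l \<and> coprime r l \<and>
     ln p / ln (1 - p) = real r / real l)"

definition chi :: "real \<Rightarrow> int \<Rightarrow> complex" where
  "chi p k = 2 * of_nat (log_ratio_num p) * of_int k * of_real pi * \<i> / of_real (ln p)"

definition fluctuation :: "real \<Rightarrow> (complex \<Rightarrow> complex) \<Rightarrow> real \<Rightarrow> complex" where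
  "fluctuation p G x =
     (if ln p / ln (1 - p) \<in> \<rat>
      then (\<Sum>\<^sub>\<infinity>k\<in>{k::int. k \<noteq> 0}.
              G (- 1 + chi p k) * exp (2 * of_int k * of_real pi * \<i> * of_real x)) /
           of_real (entropy_pq p)
      else 0)"

abbreviation seq_algebra :: "(nat \<Rightarrow> real) measure" where
  "seq_algebra \<equiv> (\<Pi>\<^sub>M k\<in>UNIV. borel)"

text \<open>Mutual independence of two real processes (as random sequences), an integer-valued and a
  real-valued random variable, via the four generated \<open>\<sigma>\<close>-algebras, as \<open>indep_vars\<close> requires
  a common codomain type.\<close>

definition indep_quadruple ::
  "'a measure \<Rightarrow> (nat \<Rightarrow> 'a \<Rightarrow> real) \<Rightarrow> (nat \<Rightarrow> 'a \<Rightarrow> real) \<Rightarrow> ('a \<Rightarrow> nat) \<Rightarrow> ('a \<Rightarrow> real) \<Rightarrow> bool"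
  where
  "indep_quadruple M X X' J S \<longleftrightarrow> prob_space.indep_sets M
     (\<lambda>j. [sets (vimage_algebra (space M) (\<lambda>\<omega> k. X k \<omega>) seq_algebra),
            sets (vimage_algebra (space M) (\<lambda>\<omega> k. X' k \<omega>) seq_algebra),
            sets (vimage_algebra (space M) J (count_space UNIV)),
            sets (vimage_algebra (space M) S borel)] ! j) {..<4::nat}"

end

theory Submission
  imports Defs "HOL-Real_Asymp.Real_Asymp"
begin

text \<open>
  Write \<open>f\<close> for the Poisson generating function of \<open>E X\<^sub>n\<close>, so that \<open>f z = f (p z) + f (q z) + g z\<close>.
  In the variable \<open>w = ln z\<close> the quotient \<open>F w = f z / z\<close> solves the renewal equation
  \<open>F w = p F (w - l) + q F (w - m) + g (exp w) / exp w\<close> with \<open>l = - ln p\<close>, \<open>m = - ln q\<close>. After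
  subtracting \<open>(c / h) w\<close> the solution is bounded in a horizontal strip, and a bounded solution
  with vanishing inhomogeneity has increments over \<open>l\<close> and \<open>m\<close> that tend to \<open>0\<close>: an increment
  close to its supremum would have to persist along \<open>w, w - l, w - 2 l, ...\<close>. Hence the solution
  is asymptotically constant if \<open>l / m\<close> is irrational and asymptotically periodic otherwise.
  For every \<open>k\<close> with \<open>exp (k l) = exp (k m) = 1\<close> the window integrals of \<open>F w exp (k w)\<close> over
  lengths \<open>l\<close> and \<open>m\<close>, weighted by \<open>p\<close> and \<open>q\<close>, have derivative \<open>g (exp w) exp (k w) / exp w\<close>, so
  their limits are values of the Mellin transform of \<open>g\<close> at \<open>- 1 + k\<close>: these are the Fourier
  coefficients of the limit.

  De-Poissonization uses only that the differences of \<open>E X\<^sub>n\<close> are \<open>O(n powr \<gamma>)\<close> for some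
  \<open>\<gamma> < 1/2\<close>, while a Poisson variable of mean \<open>n\<close> deviates from \<open>n\<close> by the order of \<open>sqrt n\<close>.
  The bound is inherited from the differences of \<open>E T\<^sub>n\<close>, for which it follows from Cauchy's
  formula on the circle of radius \<open>n\<close>.
\<close>

section \<open>Renewal equations with two step sizes\<close>

text \<open>In Mellin space the equation for \<open>f\<close> has the denominator 1 - p^(-s) -
  q^(-s), which vanishes at s = -1. If l / m is irrational, other zeros come arbitrarily close to
  the line Re s = -1, so no contour can be moved past it by a fixed margin. The renewal form stays
  on the real axis and pays with a mere o(1). Its operator averages over two shifts with weights p +
  q = 1: constants are fixed, and the identity function is lowered by the mean step h = p l + q m,
  whence the slope c / h. The second moment p l^2 + q m^2 in the constant term is the window value
  of the quadratic primitive of this drift; for k \<noteq> 0 the same computation yields - c / k,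
  the polar part of the Mellin transform at - 1 + k. The growth of the differences is inherited
  because n and n + 1 items can be coupled through one extra trial: the differences then satisfy a
  recurrence with weights p and q of total 1, whereas the weights for E X_n itself have total
  2.\<close>

lemma renewal_increment_eventually_le:
  fixes f :: "real \<Rightarrow> real"
  assumes pq: "0 < p" "0 < q" "p + q = 1" and l: "0 < l" and m: "0 < m"
    and bdd: "\<And>u. u \<ge> u0 \<Longrightarrow> \<bar>f u\<bar> \<le> A"
    and err: "((\<lambda>u. f u - p * f (u - l) - q * f (u - m)) \<longlongrightarrow> 0) at_top"
    and e: "0 < e"
  shows "eventually (\<lambda>u. f u - f (u - l) \<le> e) at_top"
proof (rule ccontr)
  assume not: "\<not> ?thesis"
  define \<eta> where "\<eta> = (\<lambda>u. f u - f (u - l))"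
  define r where "r = (\<lambda>u. f u - p * f (u - l) - q * f (u - m))"
  define S where "S = {x. eventually (\<lambda>u. \<eta> u \<le> x) at_top}"
  \<comment> \<open>\<open>M\<close> is the limit superior of \<open>\<eta>\<close>; the negated
    claim forces M \<ge> e > 0.\<close>
  define M where "M = Inf S"
  have lower: "x \<ge> e" if "x \<in> S" for x
  proof (rule ccontr)
    assume "\<not> x \<ge> e"
    hence "eventually (\<lambda>u. \<eta> u \<le> e) at_top"
      using that unfolding S_def by (auto elim!: eventually_mono)
    with not show False by (simp add: \<eta>_def)
  qed
  have "2 * A \<in> S"
    unfolding S_def mem_Collect_eq \<eta>_def
  proof (rule eventually_mono[OF eventually_ge_at_top[of "u0 + l"]])
    fix u assume "u0 + l \<le> u"
    with bdd[of u] bdd[of "u - l"] l show "f u - f (u - l) \<le> 2 * A" by simp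
  qed
  hence "M \<ge> e" unfolding M_def using lower by (intro cInf_greatest) auto
  hence M: "M > 0" using e by simp
  have bb: "bdd_below S" using lower by (auto simp: bdd_below_def)
  \<comment> \<open>K consecutive increments of size at least M / 2 would change \<open>f\<close> by
    more than 2 A, which its bound excludes.\<close>
  obtain K :: nat where K: "real K * M > 4 * A"
    using reals_Archimedean3[OF M] by blast
  \<comment> \<open>\<open>a k * \<epsilon>\<close> bounds how far the increment may have dropped
    below \<open>M\<close> after k steps back. One step adds at most \<epsilon> for the overshoot at
    v - m and \<epsilon> for the two error terms, and solving for the term at v - l divides by
    p.\<close>
  define a where "a = rec_nat 1 (\<lambda>_ x. (x + 2) / p)"
  have a0: "a 0 = 1" and aS: "a (Suc k) = (a k + 2) / p" for k by (simp_all add: a_def)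
  have a_pos: "a k > 0" for k by (induction k) (use pq in \<open>auto simp: a0 aS\<close>)
  have a_step: "a k \<le> a (Suc k)" for k
  proof -
    have "a k * p \<le> a k * 1" using a_pos[of k] pq by (intro mult_left_mono) auto
    thus ?thesis using pq by (simp add: aS field_simps)
  qed
  have a_mono: "a k \<le> a K" if "k \<le> K" for k
    using that a_step by (simp add: lift_Suc_mono_le)
  define \<epsilon> where "\<epsilon> = M / (2 * a K)"
  have eps: "\<epsilon> > 0" using M a_pos by (simp add: \<epsilon>_def)
  have small: "a k * \<epsilon> \<le> M / 2" if "k \<le> K" for k
  proof -
    have "a k * \<epsilon> \<le> a K * \<epsilon>" using a_mono[OF that] eps by (intro mult_right_mono) auto
    also have "\<dots> = M / 2" using a_pos[of K] by (simp add: \<epsilon>_def)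
    finally show ?thesis .
  qed
  have "eventually (\<lambda>u. \<eta> u \<le> M + \<epsilon>) at_top"
  proof -
    obtain x where "x \<in> S" "x < M + \<epsilon>"
      using eps \<open>2 * A \<in> S\<close> bb unfolding M_def
      by (metis cInf_lessD empty_iff less_add_same_cancel1)
    thus ?thesis unfolding S_def by (auto elim!: eventually_mono)
  qed
  moreover have "eventually (\<lambda>u. \<bar>r u\<bar> < \<epsilon> / 2) at_top"
    using tendstoD[OF err, of "\<epsilon>/2"] eps by (simp add: r_def)
  ultimately obtain V where V: "\<And>v. v \<ge> V \<Longrightarrow> \<eta> v \<le> M + \<epsilon>" "\<And>v. v \<ge> V \<Longrightarrow> \<bar>r v\<bar> < \<epsilon> / 2"
    unfolding eventually_at_top_linorder by (metis linorder_le_cases order_trans)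
  have "M - \<epsilon> \<notin> S"
    using cInf_lower[OF _ bb, of "M - \<epsilon>"] eps by (auto simp: M_def)
  hence "\<exists>u \<ge> max V u0 + real K * l + l + m. \<not> \<eta> u \<le> M - \<epsilon>"
    unfolding S_def eventually_at_top_linorder by blast
  then obtain u where u: "u \<ge> max V u0 + real K * l + l + m" "\<eta> u > M - \<epsilon>" by fastforce
  have eta_rec: "\<eta> v = p * \<eta> (v - l) + q * \<eta> (v - m) + (r v - r (v - l))" for v
  proof -
    have "v - m - l = v - l - m" by simp
    thus ?thesis by (simp add: \<eta>_def r_def algebra_simps)
  qed
  have ge: "\<eta> (u - real k * l) \<ge> M - a k * \<epsilon>" if "k \<le> K" for k
    using that
  proof (induction k)
    case 0
    then show ?case using u by (simp add: a0)
  next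
    case (Suc k)
    define v where "v = u - real k * l"
    have "real k * l \<le> real K * l" using Suc.prems l by (intro mult_right_mono) auto
    hence v: "v \<ge> V + l + m" using u unfolding v_def by (simp add: max_def split: if_splits)
    have IH: "\<eta> v \<ge> M - a k * \<epsilon>" using Suc by (simp add: v_def)
    have "q * \<eta> (v - m) \<le> q * (M + \<epsilon>)" using V(1)[of "v - m"] v l pq by (intro mult_left_mono) auto
    also have "\<dots> \<le> q * M + \<epsilon>" using pq eps by (simp add: algebra_simps)
    finally have "q * \<eta> (v - m) \<le> q * M + \<epsilon>" .
    hence "p * \<eta> (v - l) \<ge> M - a k * \<epsilon> - q * M - \<epsilon> - \<epsilon>"
      using IH eta_rec[of v] V(2)[of v] V(2)[of "v - l"] v l m by linarith
    also have "M - a k * \<epsilon> - q * M - \<epsilon> - \<epsilon> = p * (M - a (Suc k) * \<epsilon>)"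
    proof -
      have "M * p + M * q = M" by (metis distrib_left mult_1_right pq(3))
      thus ?thesis using pq(1) by (simp add: aS field_simps)
    qed
    finally have "\<eta> (v - l) \<ge> M - a (Suc k) * \<epsilon>" using pq by simp
    moreover have "v - l = u - real (Suc k) * l" by (simp add: v_def algebra_simps)
    ultimately show ?case by simp
  qed
  have tel: "(\<Sum>k<n. \<eta> (u - real k * l)) = f u - f (u - real n * l)" for n
    by (induction n) (simp_all add: \<eta>_def algebra_simps)
  have "real K * (M / 2) = (\<Sum>k<K. M / 2)" by simp
  also have "\<dots> \<le> (\<Sum>k<K. \<eta> (u - real k * l))"
  proof (rule sum_mono)
    fix k assume "k \<in> {..<K}"
    thus "M / 2 \<le> \<eta> (u - real k * l)" using ge[of k] small[of k] by simp
  qed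
  also have "\<dots> = f u - f (u - real K * l)" by (rule tel)
  also have "\<dots> \<le> 2 * A"
  proof -
    have "real K * l \<ge> 0" using l by simp
    moreover have "u \<ge> u0 + real K * l" using u l m by (simp add: max_def split: if_splits)
    ultimately have "\<bar>f u\<bar> \<le> A" "\<bar>f (u - real K * l)\<bar> \<le> A" by (auto intro!: bdd)
    thus ?thesis by linarith
  qed
  finally show False using K by simp
qed

lemma renewal_increment_tendsto_real:
  fixes f :: "real \<Rightarrow> real"
  assumes pq: "0 < p" "0 < q" "p + q = 1" and l: "0 < l" and m: "0 < m"
    and bdd: "\<And>u. u \<ge> u0 \<Longrightarrow> \<bar>f u\<bar> \<le> A"
    and err: "((\<lambda>u. f u - p * f (u - l) - q * f (u - m)) \<longlongrightarrow> 0) at_top"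
  shows "((\<lambda>u. f u - f (u - l)) \<longlongrightarrow> 0) at_top"
proof (rule tendstoI)
  fix e :: real assume e: "0 < e"
  have "((\<lambda>u. - f u - p * (- f (u - l)) - q * (- f (u - m))) \<longlongrightarrow> 0) at_top"
    using tendsto_minus[OF err] by (simp add: algebra_simps)
  from this have "eventually (\<lambda>u. - f u - (- f (u - l)) \<le> e / 2) at_top"
    by (rule renewal_increment_eventually_le[OF pq l m, rotated]) (use e bdd in auto)
  moreover have "eventually (\<lambda>u. f u - f (u - l) \<le> e / 2) at_top"
    by (rule renewal_increment_eventually_le[OF pq l m bdd err]) (use e in auto)
  ultimately show "\<forall>\<^sub>F u in at_top. dist (f u - f (u - l)) 0 < e"
    by eventually_elim (use e in \<open>auto simp: abs_if\<close>)
qed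

lemma renewal_increment_tendsto:
  fixes f :: "real \<Rightarrow> complex"
  assumes pq: "0 < p" "0 < q" "p + q = 1" and l: "0 < l" and m: "0 < m"
    and bdd: "\<And>u. u \<ge> u0 \<Longrightarrow> norm (f u) \<le> A"
    and err: "((\<lambda>u. f u - of_real p * f (u - l) - of_real q * f (u - m)) \<longlongrightarrow> 0) at_top"
  shows "((\<lambda>u. f u - f (u - l)) \<longlongrightarrow> 0) at_top"
proof -
  have "((\<lambda>u. Re (f u) - Re (f (u - l))) \<longlongrightarrow> 0) at_top"
    by (rule renewal_increment_tendsto_real[OF pq l m, of u0 _ A])
       (use tendsto_Re[OF err] bdd abs_Re_le_cmod order_trans in \<open>auto\<close>, blast)
  moreover have "((\<lambda>u. Im (f u) - Im (f (u - l))) \<longlongrightarrow> 0) at_top"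
    by (rule renewal_increment_tendsto_real[OF pq l m, of u0 _ A])
       (use tendsto_Im[OF err] bdd abs_Im_le_cmod order_trans in \<open>auto\<close>, blast)
  ultimately show ?thesis by (simp add: tendsto_complex_iff)
qed

text \<open>The induction carries the sharper majorant A - B exp (- \<delta> Re w). Averaging over
  the two shifts multiplies the subtracted term by p exp (\<delta> l) + q exp (\<delta> m) = 1 + k >
  1, and the surplus B k exp (- \<delta> Re w) pays for the inhomogeneity. A plain constant bound
  would grow with the number of steps.\<close>

lemma renewal_solution_bounded:
  fixes F E :: "complex \<Rightarrow> complex"
  assumes pq: "0 < p" "0 < q" "p + q = 1" and l: "0 < l" and m: "0 < m" and \<delta>: "0 < \<delta>"
    and eq: "\<And>w. F w = of_real p * F (w - of_real l) + of_real q * F (w - of_real m) + E w"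
    and E: "\<And>w. Re w \<ge> 0 \<Longrightarrow> \<bar>Im w\<bar> \<le> \<phi> \<Longrightarrow> norm (E w) \<le> C * exp (- \<delta> * Re w)"
    and cont: "continuous_on UNIV F"
  shows "\<exists>A. \<forall>w. Re w \<ge> - max l m \<longrightarrow> \<bar>Im w\<bar> \<le> \<phi> \<longrightarrow> norm (F w) \<le> A"
proof -
  define R where "R = cbox (Complex (- max l m) (-\<phi>)) (Complex 0 \<phi>)"
  have "compact (F ` R)"
    unfolding R_def by (intro compact_continuous_image continuous_on_subset[OF cont] compact_cbox) auto
  hence "bounded (F ` R)" by (rule compact_imp_bounded)
  then obtain B0 where B0: "\<And>w. w \<in> R \<Longrightarrow> norm (F w) \<le> B0" unfolding bounded_iff by blast
  have R: "w \<in> R \<longleftrightarrow> - max l m \<le> Re w \<and> Re w \<le> 0 \<and> \<bar>Im w\<bar> \<le> \<phi>" for w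
    by (auto simp: R_def in_cbox_complex_iff)
  define k where "k = p * exp (\<delta> * l) + q * exp (\<delta> * m) - 1"
  have "p * exp (\<delta> * l) > p * 1" "q * exp (\<delta> * m) > q * 1"
    using pq l m \<delta> by (intro mult_strict_left_mono; simp)+
  hence k: "k > 0" unfolding k_def using pq(3) by linarith
  define B where "B = \<bar>C\<bar> / k"
  \<comment> \<open>On the initial rectangle the subtracted term is at most B exp (\<delta> max l
    m), so the majorant starts above the compactness bound \<open>B0\<close>.\<close>
  define A where "A = \<bar>B0\<bar> + B * exp (\<delta> * max l m)"
  have B: "B \<ge> 0" "B * k = \<bar>C\<bar>" using k by (auto simp: B_def)
  have main: "norm (F w) \<le> A - B * exp (- \<delta> * Re w)"
    if "Re w \<ge> - max l m" "\<bar>Im w\<bar> \<le> \<phi>" "Re w \<le> real n * min l m" for n w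
    using that
  proof (induction n arbitrary: w)
    case 0
    hence "norm (F w) \<le> \<bar>B0\<bar>" using B0[of w] R[of w] by force
    moreover have "- \<delta> * Re w \<le> \<delta> * max l m"
      using mult_left_mono[OF 0(1), of \<delta>] \<delta> by simp
    hence "B * exp (- \<delta> * Re w) \<le> B * exp (\<delta> * max l m)"
      using B by (intro mult_left_mono) (auto simp: exp_le_cancel_iff)
    ultimately show ?case by (simp add: A_def)
  next
    case (Suc n)
    show ?case
    proof (cases "Re w \<le> 0")
      case True
      with Suc.IH[of w] Suc.prems l m show ?thesis
        by (metis (no_types, opaque_lifting) less_eq_real_def min_less_iff_conj mult_nonneg_nonneg of_nat_0_le_iff order_trans)
    next
      case False
      define x where "x = Re w"
      have x: "x > 0" "x \<le> real n * min l m + min l m" using False Suc.prems by (auto simp: x_def algebra_simps)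
      have 1: "norm (F (w - of_real l)) \<le> A - B * exp (- \<delta> * Re (w - of_real l))"
        by (rule Suc.IH) (use x Suc.prems l m in \<open>auto simp: x_def[symmetric]\<close>)
      have 2: "norm (F (w - of_real m)) \<le> A - B * exp (- \<delta> * Re (w - of_real m))"
        by (rule Suc.IH) (use x Suc.prems l m in \<open>auto simp: x_def[symmetric]\<close>)
      have E': "norm (E w) \<le> \<bar>C\<bar> * exp (- \<delta> * x)"
      proof -
        have "norm (E w) \<le> C * exp (- \<delta> * x)" using E[of w] Suc.prems x by (auto simp: x_def)
        also have "\<dots> \<le> \<bar>C\<bar> * exp (- \<delta> * x)" by (intro mult_right_mono) auto
        finally show ?thesis .
      qed
      have "norm (F w) \<le> norm (of_real p * F (w - of_real l)) + norm (of_real q * F (w - of_real m)) + norm (E w)"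
        by (subst eq) (intro norm_triangle_le add_mono norm_triangle_ineq order_refl)
      also have "\<dots> = p * norm (F (w - of_real l)) + q * norm (F (w - of_real m)) + norm (E w)"
        using pq by (simp add: norm_mult)
      also have "\<dots> \<le> p * (A - B * exp (- \<delta> * (x - l))) + q * (A - B * exp (- \<delta> * (x - m)))
            + B * k * exp (- \<delta> * x)"
        using 1 2 E' pq B by (intro add_mono mult_left_mono) (auto simp: x_def)
      also have "\<dots> = A * (p + q) - B * exp (- \<delta> * x) * (p * exp (\<delta> * l) + q * exp (\<delta> * m) - k)"
        by (simp add: algebra_simps exp_add exp_diff exp_minus divide_inverse)
      also have "\<dots> = A - B * exp (- \<delta> * x)" by (simp add: k_def pq)
      finally show ?thesis by (simp add: x_def)
    qed
  qed
  have "norm (F w) \<le> A" if "Re w \<ge> - max l m" "\<bar>Im w\<bar> \<le> \<phi>" for w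
  proof -
    have "min l m > 0" using l m by simp
    then obtain n where "Re w < real n * min l m" using reals_Archimedean3 by blast
    hence "norm (F w) \<le> A - B * exp (- \<delta> * Re w)" using that by (intro main[of w n]) auto
    thus ?thesis using B by (smt (verit) exp_ge_zero mult_nonneg_nonneg)
  qed
  thus ?thesis by blast
qed

lemma tendsto_increment_add:
  fixes f :: "real \<Rightarrow> 'a::real_normed_vector"
  assumes "((\<lambda>u. f (u + a) - f u) \<longlongrightarrow> 0) at_top" "((\<lambda>u. f (u + b) - f u) \<longlongrightarrow> 0) at_top"
  shows "((\<lambda>u. f (u + (a + b)) - f u) \<longlongrightarrow> 0) at_top"
proof -
  have "filterlim (\<lambda>u::real. u + b) at_top at_top"
    by (subst add.commute, rule filterlim_tendsto_add_at_top[OF tendsto_const filterlim_ident])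
  from filterlim_compose[OF assms(1) this] assms(2)
  have "((\<lambda>u. (f (u + b + a) - f (u + b)) + (f (u + b) - f u)) \<longlongrightarrow> 0 + 0) at_top"
    by (intro tendsto_add)
  thus ?thesis by (simp add: algebra_simps)
qed

section \<open>Approximate Fourier coefficients over sliding windows\<close>

text \<open>The kernel is a trigonometric polynomial: (1 + cos x) / 2 = (2 + cis x + cis (- x)) / 4,
  so each further power mixes the frequencies k, k + 1 and k - 1. Hence the induction runs over all
  k at once. Centring the exponentials at u only multiplies the coefficient by a number of modulus
  1.\<close>

lemma integral_window_kernel_tendsto_0:
  fixes E :: "real \<Rightarrow> complex" and L :: real
  assumes L: "0 < L" and cont: "continuous_on UNIV E"
    and coeff: "\<And>k::int. ((\<lambda>u. integral {u - L/2..u + L/2} (\<lambda>v. E v * cis (2 * pi * k * v / L))) \<longlongrightarrow> 0) at_top"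
  shows "((\<lambda>u. integral {u - L/2..u + L/2}
      (\<lambda>v. E v * cis (2 * pi * of_int k * (v - u) / L) * of_real (((1 + cos (2 * pi * (v - u) / L)) / 2) ^ N))) \<longlongrightarrow> 0) at_top"
proof (induction N arbitrary: k)
  case 0
  have eq: "integral {u - L/2..u + L/2} (\<lambda>v. E v * cis (2 * pi * of_int k * (v - u) / L)) =
        integral {u - L/2..u + L/2} (\<lambda>v. E v * cis (2 * pi * k * v / L)) * cis (- 2 * pi * k * u / L)" for u
  proof -
    have "E v * cis (2 * pi * of_int k * (v - u) / L) = E v * cis (2 * pi * k * v / L) * cis (- 2 * pi * k * u / L)" for v
      by (simp add: cis_mult mult.assoc diff_divide_distrib right_diff_distrib)
    thus ?thesis by (simp only: integral_mult_left)
  qed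
  show ?case
  proof (rule Lim_null_comparison[OF always_eventually])
    show "\<forall>u. norm (integral {u - L/2..u + L/2} (\<lambda>v. E v * cis (2 * pi * of_int k * (v - u) / L) * of_real (((1 + cos (2 * pi * (v - u) / L)) / 2) ^ 0)))
       \<le> norm (integral {u - L/2..u + L/2} (\<lambda>v. E v * cis (2 * pi * k * v / L)))"
      by (simp add: eq norm_mult)
  qed (use coeff[of k] in \<open>simp add: tendsto_norm_zero_iff\<close>)
next
  case (Suc N)
  define J where "J = (\<lambda>k::int. \<lambda>u v. E v * cis (2 * pi * of_int k * (v - u) / L) * of_real (((1 + cos (2 * pi * (v - u) / L)) / 2) ^ N))"
  have IH: "((\<lambda>u. integral {u - L/2..u + L/2} (J k u)) \<longlongrightarrow> 0) at_top" for k
    using Suc.IH[of k] by (simp only: J_def)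
  have int: "J k u integrable_on {u - L/2..u + L/2}" for k u
    unfolding J_def by (intro integrable_continuous_real continuous_intros continuous_on_subset[OF cont]) (use L in auto)
  have split: "E v * cis (2 * pi * of_int k * (v - u) / L) * of_real (((1 + cos (2 * pi * (v - u) / L)) / 2) ^ Suc N)
      = (J k u v * 2 + J (k + 1) u v + J (k - 1) u v) / 4" for v u
  proof -
    define x where "x = 2 * pi * (v - u) / L"
    have c: "complex_of_real ((1 + cos x) / 2) = (2 + cis x + cis (- x)) / 4"
      by (auto simp: complex_eq_iff)
    have e: "cis (2 * pi * of_int k * (v - u) / L) * cis x = cis (2 * pi * of_int (k + 1) * (v - u) / L)"
         "cis (2 * pi * of_int k * (v - u) / L) * cis (- x) = cis (2 * pi * of_int (k - 1) * (v - u) / L)"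
      by (simp_all add: cis_mult x_def add_divide_distrib diff_divide_distrib algebra_simps)
    hence "J k u v * cis x = J (k + 1) u v" "J k u v * cis (- x) = J (k - 1) u v"
      unfolding J_def e[symmetric] by (simp_all only: mult_ac)
    moreover have "E v * cis (2 * pi * of_int k * (v - u) / L) * of_real (((1 + cos (2 * pi * (v - u) / L)) / 2) ^ Suc N)
        = J k u v * ((2 + cis x + cis (- x)) / 4)"
      unfolding c[symmetric] unfolding J_def x_def power_Suc of_real_mult by (simp only: mult_ac)
    ultimately show ?thesis by (simp only: distrib_left times_divide_eq_right)
  qed
  have "integral {u - L/2..u + L/2} (\<lambda>v. E v * cis (2 * pi * of_int k * (v - u) / L) * of_real (((1 + cos (2 * pi * (v - u) / L)) / 2) ^ Suc N))
     = (integral {u - L/2..u + L/2} (J k u) * 2 + integral {u - L/2..u + L/2} (J (k+1) u) + integral {u - L/2..u + L/2} (J (k-1) u)) / 4" for u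
    unfolding split using int
    by (simp add: integral_add integrable_add integrable_on_mult_left)
  moreover have "((\<lambda>u. (integral {u - L/2..u + L/2} (J k u) * 2 + integral {u - L/2..u + L/2} (J (k+1) u) + integral {u - L/2..u + L/2} (J (k-1) u)) / 4) \<longlongrightarrow> (0 * 2 + 0 + 0) / 4) at_top"
    by (intro tendsto_intros IH) simp_all
  ultimately show ?case by (simp only: mult_zero_left add_0 div_0)
qed

text \<open>Powers of (1 + cos (2 pi t / L)) / 2 form an approximate identity on one period. Uniform
  continuity makes \<open>E\<close> nearly constant where the kernel concentrates. The power N is
  fixed before u tends to infinity, so only finitely many coefficients have to be small at a
  time.\<close>

lemma tendsto_0_of_window_coefficients:
  fixes E :: "real \<Rightarrow> complex" and L :: real
  assumes L: "0 < L" and cont: "continuous_on UNIV E"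
    and unif: "uniformly_continuous_on {u0..} E"
    and bdd: "\<And>u. u \<ge> u0 \<Longrightarrow> norm (E u) \<le> A"
    and coeff: "\<And>k::int. ((\<lambda>u. integral {u - L/2..u + L/2} (\<lambda>v. E v * cis (2 * pi * k * v / L))) \<longlongrightarrow> 0) at_top"
  shows "(E \<longlongrightarrow> 0) at_top"
proof (rule tendstoI)
  fix \<epsilon> :: real assume eps: "\<epsilon> > 0"
  obtain \<eta>' where \<eta>': "\<eta>' > 0" "\<And>u v. u \<ge> u0 \<Longrightarrow> v \<ge> u0 \<Longrightarrow> \<bar>v - u\<bar> < \<eta>' \<Longrightarrow> norm (E v - E u) < \<epsilon> / 3"
    using unif eps unfolding uniformly_continuous_on_def dist_norm
    by (metis atLeast_iff real_norm_def divide_pos_pos zero_less_numeral)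
  \<comment> \<open>Staying within half a period keeps the kernel decreasing in |t|. So
    \<open>\<rho>1\<close> bounds it from above outside distance \<eta>, and \<open>\<rho>2\<close>
    from below inside distance \<eta> / 2.\<close>
  define \<eta> where "\<eta> = min (\<eta>' / 2) (L / 2)"
  have \<eta>: "0 < \<eta>" "\<eta> \<le> L / 2" "\<eta> < \<eta>'" using \<eta>' L by (auto simp: \<eta>_def min_def)
  define k where "k = (\<lambda>t. (1 + cos (2 * pi * t / L)) / 2)"
  define \<rho>1 where "\<rho>1 = k \<eta>"
  define \<rho>2 where "\<rho>2 = k (\<eta> / 2)"
  have k_abs: "k t = k \<bar>t\<bar>" for t by (simp add: k_def abs_if)
  have k_mono: "k t \<le> k s" if "0 \<le> s" "s \<le> t" "t \<le> L / 2" for s t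
    unfolding k_def using that L
    by (simp add: field_simps) (intro cos_monotone_0_pi_le; simp add: field_simps)
  have "0 \<le> 1 + cos x" for x :: real using cos_ge_minus_one[of x] by linarith
  hence k_nonneg: "k t \<ge> 0" for t unfolding k_def by simp
  have "cos (2 * pi * \<eta> / L) < cos (2 * pi * (\<eta> / 2) / L)"
    using \<eta> L by (intro cos_monotone_0_pi) (auto simp: field_simps)
  hence \<rho>: "0 \<le> \<rho>1" "\<rho>1 < \<rho>2" unfolding \<rho>1_def \<rho>2_def using k_nonneg[of \<eta>] by (auto simp: k_def)
  have A: "A \<ge> 0" using bdd[of u0] norm_ge_zero[of "E u0"] by linarith
  \<comment> \<open>The tail contributes at most 2 A L \<rho>1^N, the kernel has mass at least
    \<eta> \<rho>2^N, and their quotient is B (\<rho>1 / \<rho>2)^N.\<close>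
  define B where "B = 2 * A * L / \<eta>"
  have "(\<lambda>N. B * (\<rho>1 / \<rho>2) ^ N) \<longlonglongrightarrow> B * 0"
    using \<rho> by (intro tendsto_intros LIMSEQ_realpow_zero) auto
  hence "eventually (\<lambda>N. B * (\<rho>1 / \<rho>2) ^ N < \<epsilon> / 3) sequentially"
    using eps by (intro order_tendstoD) auto
  then obtain N where N: "B * (\<rho>1 / \<rho>2) ^ N < \<epsilon> / 3" by (auto simp: eventually_sequentially)
  define W where "W = (\<lambda>u. {u - L/2..u + L/2})"
  define I where "I = (\<lambda>u. integral (W u) (\<lambda>v. E v * of_real (k (v - u) ^ N)))"
  have "(I \<longlongrightarrow> 0) at_top"
    using integral_window_kernel_tendsto_0[OF L cont coeff, of 0 N]
    by (simp add: I_def W_def k_def)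
  hence "eventually (\<lambda>u. norm (I u) < \<epsilon> / 3 * (\<eta> * \<rho>2 ^ N)) at_top"
    using eps \<eta> \<rho> by (subst (asm) tendsto_norm_zero_iff[symmetric], intro order_tendstoD) auto
  with eventually_ge_at_top[of "u0 + L"]
  show "eventually (\<lambda>u. dist (E u) 0 < \<epsilon>) at_top"
  proof eventually_elim
    case (elim u)
    have ge: "v \<ge> u0" if "v \<in> W u" for v using that elim(1) L by (auto simp: W_def)
    have kc: "continuous_on S (\<lambda>v. k (v - u) ^ N)" for S
      unfolding k_def by (intro continuous_intros) (use L in auto)
    have int_k: "(\<lambda>v. k (v - u) ^ N) integrable_on {a..b}" for a b
      by (intro integrable_continuous_real kc)
    define \<kappa> where "\<kappa> = integral (W u) (\<lambda>v. k (v - u) ^ N)"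
    have "\<eta> * \<rho>2 ^ N = integral {u - \<eta>/2..u + \<eta>/2} (\<lambda>v. \<rho>2 ^ N)" using \<eta> by simp
    also have "\<dots> \<le> integral {u - \<eta>/2..u + \<eta>/2} (\<lambda>v. k (v - u) ^ N)"
    proof (rule integral_le)
      fix v assume "v \<in> {u - \<eta>/2..u + \<eta>/2}"
      hence "\<bar>v - u\<bar> \<le> \<eta> / 2" by (simp only: atLeastAtMost_iff) linarith
      hence "\<rho>2 \<le> k (v - u)" unfolding \<rho>2_def using \<eta> by (subst k_abs) (intro k_mono; simp)
      thus "\<rho>2 ^ N \<le> k (v - u) ^ N" using \<rho> by (intro power_mono) auto
    qed (use int_k in auto)
    also have "\<dots> \<le> \<kappa>" unfolding \<kappa>_def W_def
      by (rule integral_subset_le) (use \<eta> int_k k_nonneg in auto)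
    finally have \<kappa>: "\<eta> * \<rho>2 ^ N \<le> \<kappa>" .
    have pos: "\<eta> * \<rho>2 ^ N > 0" using \<eta> \<rho> by simp
    have int1: "(\<lambda>v. E v * of_real (k (v - u) ^ N)) integrable_on W u"
      unfolding W_def k_def by (intro integrable_continuous_real continuous_intros continuous_on_subset[OF cont]) (use L in auto)
    have int2: "(\<lambda>v. E u * of_real (k (v - u) ^ N)) integrable_on W u"
      unfolding W_def k_def by (intro integrable_continuous_real continuous_intros) (use L in auto)
    have eq: "I u - E u * of_real \<kappa> = integral (W u) (\<lambda>v. (E v - E u) * of_real (k (v - u) ^ N))"
    proof -
      have "integral (W u) (\<lambda>v. E u * complex_of_real (k (v - u) ^ N)) = E u * of_real \<kappa>"
        unfolding \<kappa>_def W_def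
        by (intro integral_unique has_integral_mult_right has_integral_of_real integrable_integral int_k)
      thus ?thesis unfolding I_def left_diff_distrib by (subst integral_diff[OF int1 int2]) (simp only:)
    qed
    have "norm (I u - E u * of_real \<kappa>) \<le> integral (W u) (\<lambda>v. \<epsilon> / 3 * k (v - u) ^ N + 2 * A * \<rho>1 ^ N)"
      unfolding eq
    proof (rule integral_norm_bound_integral)
      show "(\<lambda>v. (E v - E u) * of_real (k (v - u) ^ N)) integrable_on W u"
        unfolding left_diff_distrib using int1 int2 by (rule integrable_diff)
      show "(\<lambda>v. \<epsilon> / 3 * k (v - u) ^ N + 2 * A * \<rho>1 ^ N) integrable_on W u"
        unfolding W_def by (intro integrable_continuous_real continuous_intros kc)
      fix v assume v: "v \<in> W u"
      have u: "u \<ge> u0" using elim(1) L by simp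
      show "norm ((E v - E u) * of_real (k (v - u) ^ N)) \<le> \<epsilon> / 3 * k (v - u) ^ N + 2 * A * \<rho>1 ^ N"
      proof (cases "\<bar>v - u\<bar> < \<eta>")
        case True
        hence "norm (E v - E u) * k (v - u) ^ N \<le> \<epsilon> / 3 * k (v - u) ^ N"
          using \<eta>'(2)[of u v] ge[OF v] u \<eta> k_nonneg by (intro mult_right_mono) auto
        moreover have "2 * A * \<rho>1 ^ N \<ge> 0" using A \<rho> by simp
        ultimately show ?thesis using k_nonneg by (simp add: norm_mult norm_power)
      next
        case False
        moreover have "\<bar>v - u\<bar> \<le> L / 2" using v unfolding W_def by (simp only: atLeastAtMost_iff) linarith
        ultimately have "k (v - u) \<le> \<rho>1" unfolding \<rho>1_def using \<eta> by (subst k_abs) (intro k_mono; simp)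
        hence "norm (E v - E u) * k (v - u) ^ N \<le> (2 * A) * \<rho>1 ^ N"
          using bdd[OF ge[OF v]] bdd[OF u] norm_triangle_ineq4[of "E v" "E u"] k_nonneg A
          by (intro mult_mono power_mono zero_le_power mult_nonneg_nonneg) simp_all
        moreover have "\<epsilon> / 3 * k (v - u) ^ N \<ge> 0" using eps k_nonneg by simp
        ultimately show ?thesis using k_nonneg by (simp add: norm_mult norm_power)
      qed
    qed
    also have "\<dots> = \<epsilon> / 3 * \<kappa> + 2 * A * L * \<rho>1 ^ N"
      unfolding \<kappa>_def W_def using int_k L
      by (subst integral_add)
         (simp_all only: integral_mult_right integrable_on_mult_right integrable_const_ivl
           integral_const_real content_real, simp_all)
    finally have 1: "norm (I u - E u * of_real \<kappa>) \<le> \<epsilon> / 3 * \<kappa> + 2 * A * L * \<rho>1 ^ N" .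
    have "2 * A * L * \<rho>1 ^ N = B * (\<rho>1 / \<rho>2) ^ N * (\<eta> * \<rho>2 ^ N)"
      using \<eta> \<rho> by (simp add: B_def power_divide)
    also have "\<dots> < \<epsilon> / 3 * (\<eta> * \<rho>2 ^ N)" using N pos by (intro mult_strict_right_mono) auto
    also have "\<dots> \<le> \<epsilon> / 3 * \<kappa>" using \<kappa> eps by (intro mult_left_mono) auto
    finally have 2: "2 * A * L * \<rho>1 ^ N < \<epsilon> / 3 * \<kappa>" .
    have "\<epsilon> / 3 * (\<eta> * \<rho>2 ^ N) \<le> \<epsilon> / 3 * \<kappa>" using \<kappa> eps by (intro mult_left_mono) auto
    hence 3: "norm (I u) < \<epsilon> / 3 * \<kappa>" using elim(2) by linarith
    have "norm (E u) * \<kappa> = norm (E u * of_real \<kappa>)" using \<kappa> pos by (simp add: norm_mult)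
    also have "\<dots> \<le> norm (I u) + norm (I u - E u * of_real \<kappa>)"
      by (metis norm_minus_commute norm_triangle_sub)
    also have "\<dots> < \<epsilon> * \<kappa>" using 1 2 3 by (simp add: field_simps)
    finally show ?case using \<kappa> pos by simp
  qed
qed

section \<open>The conserved quantity and the limit\<close>

lemma vector_increment_bound:
  fixes f :: "real \<Rightarrow> 'a::banach"
  assumes "a \<le> b" "\<And>v. a \<le> v \<Longrightarrow> v \<le> b \<Longrightarrow> (f has_vector_derivative f' v) (at v)"
    and "\<And>v. a \<le> v \<Longrightarrow> v \<le> b \<Longrightarrow> norm (f' v) \<le> B"
  shows "norm (f b - f a) \<le> B * (b - a)"
proof -
  have "(f' has_integral (f b - f a)) {a..b}"
    using assms by (intro fundamental_theorem_of_calculus) (auto intro: has_vector_derivative_at_within)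
  moreover have "B \<ge> 0" using assms(3)[of a] assms(1) norm_ge_zero[of "f' a"] by linarith
  ultimately have "norm (f b - f a) \<le> B * measure lborel {a..b}"
    using assms(3) by (intro has_integral_bound_real[where S = "{}"]) auto
  thus ?thesis using assms(1) by simp
qed

lemma window_increment_tendsto_0:
  fixes f :: "real \<Rightarrow> 'a::banach"
  assumes "\<And>v. (f has_vector_derivative f' v) (at v)" and "(f' \<longlongrightarrow> 0) at_top" and "a \<ge> 0"
  shows "((\<lambda>u. f u - f (u - a)) \<longlongrightarrow> 0) at_top"
proof (rule tendstoI)
  fix e :: real assume e: "e > 0"
  \<comment> \<open>Dividing by a + 1 instead of a keeps the final estimate strict and also covers a
    = 0.\<close>
  have "eventually (\<lambda>v. norm (f' v) < e / (a + 1)) at_top"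
    using assms(2,3) e by (intro order_tendstoD(2)[OF tendsto_norm_zero]) auto
  then obtain V where V: "\<And>v. v \<ge> V \<Longrightarrow> norm (f' v) < e / (a + 1)"
    unfolding eventually_at_top_linorder by blast
  show "eventually (\<lambda>u. dist (f u - f (u - a)) 0 < e) at_top"
    using eventually_ge_at_top[of "V + a"]
  proof eventually_elim
    case (elim u)
    have "norm (f u - f (u - a)) \<le> e / (a + 1) * (u - (u - a))"
      by (rule vector_increment_bound[where f' = f']) (use assms V elim in \<open>auto intro: less_imp_le\<close>)
    also have "\<dots> = e * (a / (a + 1))" by simp
    also have "\<dots> < e * 1" using e assms(3) by (intro mult_strict_left_mono) auto
    finally show ?case by simp
  qed
qed

lemma window_increment_tendsto_0_at_bot:
  fixes f :: "real \<Rightarrow> 'a::banach"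
  assumes "\<And>v. (f has_vector_derivative f' v) (at v)" and "(f' \<longlongrightarrow> 0) at_bot" and "a \<ge> 0"
  shows "((\<lambda>u. f u - f (u - a)) \<longlongrightarrow> 0) at_bot"
proof (rule tendstoI)
  fix e :: real assume e: "e > 0"
  have "eventually (\<lambda>v. norm (f' v) < e / (a + 1)) at_bot"
    using assms(2,3) e by (intro order_tendstoD(2)[OF tendsto_norm_zero]) auto
  then obtain V where V: "\<And>v. v \<le> V \<Longrightarrow> norm (f' v) < e / (a + 1)"
    unfolding eventually_at_bot_linorder by blast
  show "eventually (\<lambda>u. dist (f u - f (u - a)) 0 < e) at_bot"
    using eventually_le_at_bot[of V]
  proof eventually_elim
    case (elim u)
    have "norm (f u - f (u - a)) \<le> e / (a + 1) * (u - (u - a))"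
      by (rule vector_increment_bound[where f' = f']) (use assms V elim in \<open>auto intro: less_imp_le\<close>)
    also have "\<dots> = e * (a / (a + 1))" by simp
    also have "\<dots> < e * 1" using e assms(3) by (intro mult_strict_left_mono) auto
    finally show ?case by simp
  qed
qed

lemma has_vector_derivative_of_real_shift:
  assumes "\<And>w. (N has_field_derivative N' w) (at w)"
  shows "((\<lambda>u. N (of_real (u - a))) has_vector_derivative N' (of_real (u - a))) (at u)"
proof -
  have "((\<lambda>z. N (z - of_real a)) has_field_derivative N' (of_real u - of_real a) * 1) (at (of_real u))"
    by (rule DERIV_chain2[OF assms]) (auto intro!: derivative_eq_intros)
  from has_vector_derivative_real_field[OF this] show ?thesis by simp
qed

text \<open>All functions are in the logarithmic variable, so a sector becomes a horizontal strip of
  half-width \<phi>; working in a strip and not only on the real line makes Cauchy estimates for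
  derivatives available. \<open>F_at_bot\<close> is the normalisation: the equation alone determines
  \<open>F\<close> only up to solutions of the homogeneous equation, such as constants.\<close>

locale renewal_equation =
  fixes p q l m c \<phi> \<delta> C :: real and F G :: "complex \<Rightarrow> complex"
  assumes pq: "0 < p" "0 < q" "p + q = 1" and l: "0 < l" and m: "0 < m"
    and \<delta>: "0 < \<delta>" and \<phi>: "0 < \<phi>"
    and holF: "F holomorphic_on UNIV" and holG: "G holomorphic_on UNIV"
    and eq: "\<And>w. F w = of_real p * F (w - of_real l) + of_real q * F (w - of_real m) + G w"
    and G_bound: "\<And>w. Re w \<ge> 0 \<Longrightarrow> \<bar>Im w\<bar> \<le> \<phi> \<Longrightarrow> norm (G w - of_real c) \<le> C * exp (- \<delta> * Re w)"
    and F_at_bot: "((\<lambda>u. F (of_real u)) \<longlongrightarrow> 0) at_bot"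
begin

definition h where "h = p * l + q * m"
definition H where "H = (\<lambda>w. F w - of_real (c / h) * w)"

lemma h_pos: "h > 0" using pq l m by (simp add: h_def add_pos_pos)

lemma holH: "H holomorphic_on UNIV"
  unfolding H_def by (intro holomorphic_intros holF)

lemma H_eq: "H w = of_real p * H (w - of_real l) + of_real q * H (w - of_real m) + (G w - of_real c)"
proof -
  have "of_real p * (w - of_real l) + of_real q * (w - of_real m) = (of_real (p + q) * w - of_real h :: complex)"
    by (simp add: h_def algebra_simps)
  hence 1: "of_real p * (w - of_real l) + of_real q * (w - of_real m) = w - of_real h" using pq by simp
  define k :: complex where "k = of_real (c / h)"
  have 2: "k * of_real h = of_real c"
    using h_pos unfolding k_def by (simp only: of_real_mult[symmetric]) simp
  have H: "H w = F w - k * w" for w by (simp add: H_def k_def)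
  have "of_real p * H (w - of_real l) + of_real q * H (w - of_real m) =
     of_real p * F (w - of_real l) + of_real q * F (w - of_real m)
       - k * (of_real p * (w - of_real l) + of_real q * (w - of_real m))"
    unfolding H by (simp add: algebra_simps)
  also have "\<dots> = F w - G w - k * w + of_real c"
    unfolding 1 2[symmetric] using eq[of w] by (simp add: algebra_simps)
  finally show ?thesis by (simp add: H)
qed

lemma H_bounded: "\<exists>A. \<forall>w. Re w \<ge> - max l m \<longrightarrow> \<bar>Im w\<bar> \<le> \<phi> \<longrightarrow> norm (H w) \<le> A"
  by (rule renewal_solution_bounded[OF pq l m \<delta> H_eq G_bound])
     (auto intro: holomorphic_on_imp_continuous_on[OF holH])

text \<open>Cauchy's inequality on discs of radius min \<phi> 1, which for u \<ge> 1 stay inside the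
  strip. The first derivative gives the Lipschitz bound, the second the quadratic decay of Fourier
  coefficients.\<close>

lemma H_derivs_bounded:
  "\<exists>A\<ge>0. \<forall>u\<ge>1. norm (H (of_real u)) \<le> A \<and> norm (deriv H (of_real u)) \<le> A \<and> norm (deriv (deriv H) (of_real u)) \<le> A"
proof -
  obtain A where A: "\<And>w. Re w \<ge> - max l m \<Longrightarrow> \<bar>Im w\<bar> \<le> \<phi> \<Longrightarrow> norm (H w) \<le> A"
    using H_bounded by blast
  define r where "r = min \<phi> 1"
  have r: "r > 0" "r \<le> 1" "r \<le> \<phi>" using \<phi> by (auto simp: r_def)
  have D: "norm ((deriv ^^ n) H (of_real u)) \<le> fact n * A / r ^ n" if "u \<ge> 1" for n u
  proof (rule Cauchy_inequality[OF _ _ r(1)])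
    show "H holomorphic_on ball (of_real u) r" using holH by (rule holomorphic_on_subset) auto
    show "continuous_on (cball (of_real u) r) H"
      using holomorphic_on_imp_continuous_on[OF holH] by (rule continuous_on_subset) auto
    fix x :: complex assume x: "norm (of_real u - x) = r"
    have "\<bar>Re (of_real u - x)\<bar> \<le> r" "\<bar>Im (of_real u - x)\<bar> \<le> r"
      using abs_Re_le_cmod[of "of_real u - x"] abs_Im_le_cmod[of "of_real u - x"] x by auto
    thus "norm (H x) \<le> A" using r that l m by (intro A) auto
  qed
  have A0: "A \<ge> 0" by (rule order_trans[OF norm_ge_zero A[of 0]]) (use \<phi> l m in \<open>auto simp: le_max_iff_disj\<close>)
  define A' where "A' = A + A / r + 2 * A / r ^ 2"
  have nn: "A / r \<ge> 0" "2 * A / r ^ 2 \<ge> 0" using A0 r by auto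
  have "\<forall>u\<ge>1. norm (H (of_real u)) \<le> A' \<and> norm (deriv H (of_real u)) \<le> A' \<and> norm (deriv (deriv H) (of_real u)) \<le> A'"
  proof (intro allI impI conjI)
    fix u :: real assume u: "u \<ge> 1"
    have "norm (H (of_real u)) \<le> A" using D[OF u, of 0] by simp
    thus "norm (H (of_real u)) \<le> A'" unfolding A'_def using nn by linarith
    have "norm (deriv H (of_real u)) \<le> A / r" using D[OF u, of 1] by simp
    thus "norm (deriv H (of_real u)) \<le> A'" unfolding A'_def using nn A0 by linarith
    have "norm (deriv (deriv H) (of_real u)) \<le> 2 * A / r ^ 2"
      using D[OF u, of 2] by (simp add: numeral_2_eq_2)
    thus "norm (deriv (deriv H) (of_real u)) \<le> A'" unfolding A'_def using nn A0 by linarith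
  qed
  moreover have "A' \<ge> 0" unfolding A'_def using nn A0 by linarith
  ultimately show ?thesis by blast
qed

lemma G_tendsto: "((\<lambda>u. G (of_real u) - of_real c) \<longlongrightarrow> 0) at_top"
proof (rule Lim_null_comparison)
  show "eventually (\<lambda>u. norm (G (of_real u) - of_real c) \<le> C * exp (- \<delta> * u)) at_top"
    using eventually_ge_at_top[of 0]
  proof eventually_elim
    case (elim u)
    thus ?case using G_bound[of "of_real u"] \<phi> by simp
  qed
  show "((\<lambda>u. C * exp (- \<delta> * u)) \<longlongrightarrow> 0) at_top"
    using \<delta> by real_asymp
qed

lemma H_increment:
  shows "((\<lambda>u. H (of_real u) - H (of_real (u - l))) \<longlongrightarrow> 0) at_top"
    and "((\<lambda>u. H (of_real u) - H (of_real (u - m))) \<longlongrightarrow> 0) at_top"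
proof -
  obtain A where A: "\<And>u. u \<ge> 1 \<Longrightarrow> norm (H (of_real u)) \<le> A" using H_derivs_bounded by blast
  have "((\<lambda>u. H (of_real u) - of_real p * H (of_real (u - l)) - of_real q * H (of_real (u - m))) \<longlongrightarrow> 0) at_top"
    using G_tendsto by (subst H_eq) (simp add: algebra_simps)
  thus "((\<lambda>u. H (of_real u) - H (of_real (u - l))) \<longlongrightarrow> 0) at_top"
    by (rule renewal_increment_tendsto[OF pq l m A, rotated])
  have "((\<lambda>u. H (of_real u) - of_real q * H (of_real (u - m)) - of_real p * H (of_real (u - l))) \<longlongrightarrow> 0) at_top"
    using G_tendsto by (subst H_eq) (simp add: algebra_simps)
  thus "((\<lambda>u. H (of_real u) - H (of_real (u - m))) \<longlongrightarrow> 0) at_top"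
    by (rule renewal_increment_tendsto[OF pq(2,1) _ m l A, rotated 2]) (use pq in auto)
qed

definition windows :: "(complex \<Rightarrow> complex) \<Rightarrow> real \<Rightarrow> complex" where
  "windows N u = of_real p * (N (of_real u) - N (of_real (u - l))) + of_real q * (N (of_real u) - N (of_real (u - m)))"

text \<open>The renewal equation makes \<open>windows N\<close> an explicit primitive of the inhomogeneity; this
  conserved quantity identifies the limit.\<close>

lemma windows_derivative:
  fixes K E :: "complex \<Rightarrow> complex"
  assumes N: "\<And>w. (N has_field_derivative K w * exp (\<kappa> * w)) (at w)"
    and K: "\<And>w. K w = of_real p * K (w - of_real l) + of_real q * K (w - of_real m) + E w"
    and \<kappa>: "exp (\<kappa> * of_real l) = 1" "exp (\<kappa> * of_real m) = 1"
  shows "(windows N has_vector_derivative E (of_real u) * exp (\<kappa> * of_real u)) (at u)"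
proof -
  have e: "exp (\<kappa> * of_real (u - l)) = exp (\<kappa> * of_real u)" "exp (\<kappa> * of_real (u - m)) = exp (\<kappa> * of_real u)"
    using \<kappa> by (simp_all add: right_diff_distrib exp_diff)
  have N0: "((\<lambda>u. N (of_real u)) has_vector_derivative K (of_real u) * exp (\<kappa> * of_real u)) (at u)"
    using has_vector_derivative_of_real_shift[OF N, of 0 u] by (simp only: diff_zero)
  have "(windows N has_vector_derivative
     of_real p * (K (of_real u) * exp (\<kappa> * of_real u) - K (of_real (u - l)) * exp (\<kappa> * of_real (u - l))) +
     of_real q * (K (of_real u) * exp (\<kappa> * of_real u) - K (of_real (u - m)) * exp (\<kappa> * of_real (u - m)))) (at u)"
    unfolding windows_def[abs_def]
    by (intro has_vector_derivative_add has_vector_derivative_mult_right has_vector_derivative_diff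
          has_vector_derivative_of_real_shift[OF N] N0)
  also have "of_real p * (K (of_real u) * exp (\<kappa> * of_real u) - K (of_real (u - l)) * exp (\<kappa> * of_real (u - l))) +
     of_real q * (K (of_real u) * exp (\<kappa> * of_real u) - K (of_real (u - m)) * exp (\<kappa> * of_real (u - m)))
    = (of_real (p + q) * K (of_real u) - of_real p * K (of_real u - of_real l) - of_real q * K (of_real u - of_real m)) * exp (\<kappa> * of_real u)"
    unfolding e by (simp add: algebra_simps)
  also have "\<dots> = E (of_real u) * exp (\<kappa> * of_real u)"
    using K[of "of_real u"] pq by (simp add: algebra_simps)
  finally show ?thesis .
qed

text \<open>Two primitives are glued at 0. To the left, the windows of \<open>F\<close> vanish at
  minus infinity, so their value at 0 is the integral \<open>I1\<close>. To the right only G - c is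
  integrable, so the windows of \<open>H\<close> are followed instead and gain \<open>I2\<close>.
  The change from \<open>F\<close> to \<open>H\<close> at 0 costs the windows of (c / h) w exp
  (\<kappa> w), which is the case distinction in the limit.\<close>

lemma windows_limit:
  assumes \<kappa>: "exp (\<kappa> * of_real l) = 1" "exp (\<kappa> * of_real m) = 1" "Re \<kappa> = 0"
    and I1: "((\<lambda>t. integral {-t..0} (\<lambda>u. G (of_real u) * exp (\<kappa> * of_real u))) \<longlongrightarrow> I1) at_top"
    and I2: "((\<lambda>t. integral {0..t} (\<lambda>u. (G (of_real u) - of_real c) * exp (\<kappa> * of_real u))) \<longlongrightarrow> I2) at_top"
    and N: "\<And>w. (N has_field_derivative H w * exp (\<kappa> * w)) (at w)"
  shows "(windows N \<longlongrightarrow> I1 + I2 + (if \<kappa> = 0 then of_real (c * (p * l\<^sup>2 + q * m\<^sup>2) / (2 * h)) else - of_real c / \<kappa>)) at_top"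
proof -
  \<comment> \<open>\<open>Z\<close> is a primitive of w exp (\<kappa> w), the term by which
    \<open>F\<close> and \<open>H\<close> differ up to the factor c / h.\<close>
  define Z where "Z = (\<lambda>w. if \<kappa> = 0 then w\<^sup>2 / 2 else (w / \<kappa> - 1 / \<kappa>\<^sup>2) * exp (\<kappa> * w))"
  have Z: "(Z has_field_derivative w * exp (\<kappa> * w)) (at w)" for w
    unfolding Z_def by (cases "\<kappa> = 0") (auto intro!: derivative_eq_intros simp: field_simps power2_eq_square)
  define NF where "NF = (\<lambda>w. N w + of_real (c / h) * Z w)"
  have NF: "(NF has_field_derivative F w * exp (\<kappa> * w)) (at w)" for w
  proof -
    have "(NF has_field_derivative H w * exp (\<kappa> * w) + of_real (c / h) * (w * exp (\<kappa> * w))) (at w)"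
      unfolding NF_def by (intro derivative_intros N DERIV_cmult Z)
    thus ?thesis by (simp add: H_def algebra_simps)
  qed
  have dF: "(windows NF has_vector_derivative G (of_real u) * exp (\<kappa> * of_real u)) (at u)" for u
    by (rule windows_derivative[OF NF eq \<kappa>(1,2)])
  have dH: "(windows N has_vector_derivative (G (of_real u) - of_real c) * exp (\<kappa> * of_real u)) (at u)" for u
    by (rule windows_derivative[OF N H_eq \<kappa>(1,2)])
  have nexp: "norm (exp (\<kappa> * of_real u)) = 1" for u using \<kappa>(3) by simp
  have bot: "((\<lambda>u. F (of_real u) * exp (\<kappa> * of_real u)) \<longlongrightarrow> 0) at_bot"
    by (rule Lim_null_comparison[OF always_eventually tendsto_norm_zero[OF F_at_bot]])
       (simp add: norm_mult \<kappa>(3))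
  have shift0: "((\<lambda>u. NF (of_real u)) has_vector_derivative F (of_real u) * exp (\<kappa> * of_real u)) (at u)" for u
    using has_vector_derivative_of_real_shift[OF NF, of 0 u] by (simp only: diff_zero)
  have "(windows NF \<longlongrightarrow> of_real p * 0 + of_real q * 0) at_bot"
    unfolding windows_def[abs_def]
    by (intro tendsto_intros window_increment_tendsto_0_at_bot[OF shift0 bot]) (use l m in auto)
  hence "((\<lambda>t. windows NF (- t)) \<longlongrightarrow> 0) at_top"
    by (subst (asm) filterlim_at_bot_mirror) simp
  hence "((\<lambda>t. windows NF 0 - windows NF (- t)) \<longlongrightarrow> windows NF 0 - 0) at_top"
    by (intro tendsto_intros)
  moreover have "eventually (\<lambda>t. windows NF 0 - windows NF (- t) = integral {-t..0} (\<lambda>u. G (of_real u) * exp (\<kappa> * of_real u))) at_top"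
    using eventually_ge_at_top[of 0]
  proof eventually_elim
    case (elim t)
    show ?case
      by (rule integral_unique[symmetric], rule fundamental_theorem_of_calculus)
         (auto intro: has_vector_derivative_at_within dF simp: elim)
  qed
  ultimately have "((\<lambda>t. integral {-t..0} (\<lambda>u. G (of_real u) * exp (\<kappa> * of_real u))) \<longlongrightarrow> windows NF 0 - 0) at_top"
    by (rule Lim_transform_eventually)
  from tendsto_unique[OF trivial_limit_at_top_linorder this I1] have I1': "windows NF 0 = I1"
    by simp
  have e0: "exp (\<kappa> * of_real (- l)) = 1" "exp (\<kappa> * of_real (- m)) = 1" using \<kappa> by (simp_all add: exp_minus)
  have Z0: "Z 0 - Z (of_real (- l)) = (if \<kappa> = 0 then - of_real (l\<^sup>2 / 2) else of_real l / \<kappa>)"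
    "Z 0 - Z (of_real (- m)) = (if \<kappa> = 0 then - of_real (m\<^sup>2 / 2) else of_real m / \<kappa>)"
    unfolding Z_def e0 by (auto simp: field_simps power2_eq_square)
  have "windows NF 0 - windows N 0 = of_real (c / h) * (of_real p * (Z 0 - Z (of_real (- l))) + of_real q * (Z 0 - Z (of_real (- m))))"
    unfolding windows_def NF_def by (simp add: algebra_simps)
  also have "\<dots> = (if \<kappa> = 0 then - of_real (c * (p * l\<^sup>2 + q * m\<^sup>2) / (2 * h)) else of_real c / \<kappa>)"
  proof (cases "\<kappa> = 0")
    case True
    have "of_real (c / h) * (of_real p * (- of_real (l\<^sup>2 / 2)) + of_real q * (- of_real (m\<^sup>2 / 2))) =
       (of_real (c / h * (p * (- (l\<^sup>2 / 2)) + q * (- (m\<^sup>2 / 2)))) :: complex)" by simp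
    also have "c / h * (p * (- (l\<^sup>2 / 2)) + q * (- (m\<^sup>2 / 2))) = - (c * (p * l\<^sup>2 + q * m\<^sup>2) / (2 * h))"
      using h_pos by (simp add: field_simps)
    finally show ?thesis using True unfolding Z0 by simp
  next
    case False
    have "of_real (c / h) * (of_real p * (of_real l / \<kappa>) + of_real q * (of_real m / \<kappa>)) = of_real (c / h * h) / \<kappa>"
      by (simp add: h_def algebra_simps add_divide_distrib)
    thus ?thesis using False h_pos unfolding Z0 by simp
  qed
  finally have N0: "windows N 0 = I1 + (if \<kappa> = 0 then of_real (c * (p * l\<^sup>2 + q * m\<^sup>2) / (2 * h)) else - of_real c / \<kappa>)"
    unfolding I1' by (simp add: algebra_simps split: if_splits)
  have "((\<lambda>t. windows N 0 + integral {0..t} (\<lambda>u. (G (of_real u) - of_real c) * exp (\<kappa> * of_real u))) \<longlongrightarrow> windows N 0 + I2) at_top"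
    by (intro tendsto_intros I2)
  moreover have "eventually (\<lambda>t. windows N 0 + integral {0..t} (\<lambda>u. (G (of_real u) - of_real c) * exp (\<kappa> * of_real u)) = windows N t) at_top"
    using eventually_ge_at_top[of 0]
  proof eventually_elim
    case (elim t)
    have "integral {0..t} (\<lambda>u. (G (of_real u) - of_real c) * exp (\<kappa> * of_real u)) = windows N t - windows N 0"
      by (rule integral_unique, rule fundamental_theorem_of_calculus)
         (auto intro: has_vector_derivative_at_within dH simp: elim)
    thus ?case by simp
  qed
  ultimately have "(windows N \<longlongrightarrow> windows N 0 + I2) at_top" by (rule Lim_transform_eventually)
  thus ?thesis unfolding N0 by (simp add: add_ac)
qed

end

section \<open>Vanishing increments and the irrational case\<close>

lemma tendsto_increment_iff:
  fixes f :: "real \<Rightarrow> 'a::real_normed_vector"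
  shows "((\<lambda>u. f u - f (u - a)) \<longlongrightarrow> 0) at_top \<longleftrightarrow> ((\<lambda>u. f (u + a) - f u) \<longlongrightarrow> 0) at_top"
proof
  have sh: "filterlim (\<lambda>u::real. u + b) at_top at_top" for b
    by (subst add.commute, rule filterlim_tendsto_add_at_top[OF tendsto_const filterlim_ident])
  show "((\<lambda>u. f (u + a) - f u) \<longlongrightarrow> 0) at_top" if "((\<lambda>u. f u - f (u - a)) \<longlongrightarrow> 0) at_top"
    using filterlim_compose[OF that sh[of a]] by simp
  show "((\<lambda>u. f u - f (u - a)) \<longlongrightarrow> 0) at_top" if "((\<lambda>u. f (u + a) - f u) \<longlongrightarrow> 0) at_top"
    using filterlim_compose[OF that sh[of "-a"]] by simp
qed

lemma tendsto_increment_minus: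
  fixes f :: "real \<Rightarrow> 'a::real_normed_vector"
  assumes "((\<lambda>u. f (u + a) - f u) \<longlongrightarrow> 0) at_top"
  shows "((\<lambda>u. f (u + (- a)) - f u) \<longlongrightarrow> 0) at_top"
  using tendsto_minus[OF assms[folded tendsto_increment_iff]] by simp

lemma tendsto_increment_nat:
  fixes f :: "real \<Rightarrow> 'a::real_normed_vector"
  assumes "((\<lambda>u. f (u + a) - f u) \<longlongrightarrow> 0) at_top"
  shows "((\<lambda>u. f (u + real k * a) - f u) \<longlongrightarrow> 0) at_top"
proof (induction k)
  case (Suc k)
  from tendsto_increment_add[OF assms Suc] show ?case by (simp add: algebra_simps)
qed simp

lemma tendsto_increment_int:
  fixes f :: "real \<Rightarrow> 'a::real_normed_vector"
  assumes "((\<lambda>u. f (u + a) - f u) \<longlongrightarrow> 0) at_top"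
  shows "((\<lambda>u. f (u + real_of_int k * a) - f u) \<longlongrightarrow> 0) at_top"
proof (cases "k \<ge> 0")
  case True
  then obtain n where "k = int n" using nonneg_int_cases by blast
  thus ?thesis using tendsto_increment_nat[OF assms] by simp
next
  case False
  then obtain n where "k = - int n" by (metis int_cases2 linorder_le_cases of_nat_0_le_iff)
  thus ?thesis using tendsto_increment_minus[OF tendsto_increment_nat[OF assms, of n]] by simp
qed

text \<open>After division by m this is Kronecker's theorem for the fractional parts of k l / m; the
  integer parts that it discards are collected in j.\<close>

lemma irrational_combination_dense:
  fixes l m :: real
  assumes "l / m \<notin> \<rat>" "m > 0" "\<epsilon> > 0"
  shows "\<exists>i j :: int. \<bar>of_int i * l + of_int j * m - \<tau>\<bar> < \<epsilon>"
proof -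
  obtain k where k: "\<bar>frac (real k * (l / m)) - frac (\<tau> / m)\<bar> < \<epsilon> / m"
    using Kronecker_approx_1_explicit[OF assms(1), of "frac (\<tau> / m)" "\<epsilon> / m"] assms frac_lt_1[of "\<tau> / m"]
    by (metis divide_pos_pos frac_ge_0 less_imp_le)
  define j where "j = \<lfloor>\<tau> / m\<rfloor> - \<lfloor>real k * (l / m)\<rfloor>"
  have "frac (real k * (l / m)) - frac (\<tau> / m) = (real k * l + of_int j * m - \<tau>) / m"
    using assms(2) by (simp add: frac_def j_def field_simps)
  with k assms(2) have "\<bar>real k * l + of_int j * m - \<tau>\<bar> < \<epsilon>"
    by (simp add: abs_divide divide_less_cancel)
  thus ?thesis by (intro exI[of _ "int k"] exI[of _ j]) simp
qed

lemma summable_on_inverse_square_int: "(\<lambda>k::int. 1 / (of_int k)\<^sup>2 :: real) summable_on UNIV"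
proof -
  let ?f = "\<lambda>k::int. 1 / (of_int k)\<^sup>2 :: real"
  have "summable (\<lambda>n. 1 / real n ^ 2)" using inverse_power_summable[of 2, where ?'a = real] by (simp add: inverse_eq_divide)
  hence s: "(\<lambda>n. 1 / real n ^ 2) summable_on UNIV" by (intro norm_summable_imp_summable_on) auto
  have 1: "?f summable_on range int"
    by (subst summable_on_reindex) (use s in \<open>auto simp: o_def\<close>)
  have 2: "?f summable_on range (\<lambda>n. - int n)"
    by (subst summable_on_reindex) (use s in \<open>auto simp: o_def inj_on_def\<close>)
  have U: "(UNIV :: int set) = range int \<union> range (\<lambda>n. - int n)"
  proof -
    have "x \<in> range int \<union> range (\<lambda>n. - int n)" for x :: int by (cases x rule: int_cases2) auto
    thus ?thesis by blast
  qed
  show ?thesis unfolding U by (rule summable_on_union[OF 1 2])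
qed

context renewal_equation
begin

lemma H_lipschitz:
  obtains A where "A \<ge> 0" "\<And>u. u \<ge> 1 \<Longrightarrow> norm (H (of_real u)) \<le> A"
    "\<And>u v. u \<ge> 1 \<Longrightarrow> v \<ge> 1 \<Longrightarrow> norm (H (of_real u) - H (of_real v)) \<le> A * \<bar>u - v\<bar>"
proof -
  obtain A where A: "A \<ge> 0" "\<And>u. u \<ge> 1 \<Longrightarrow> norm (H (of_real u)) \<le> A" "\<And>u. u \<ge> 1 \<Longrightarrow> norm (deriv H (of_real u)) \<le> A"
    using H_derivs_bounded by blast
  have D: "(H has_field_derivative deriv H w) (at w)" for w
    using holH by (intro holomorphic_derivI[of _ UNIV]) auto
  have D': "((\<lambda>u. H (of_real u)) has_vector_derivative deriv H (of_real u)) (at u)" for u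
    using has_vector_derivative_of_real_shift[OF D, of 0 u] by (simp only: diff_zero)
  have le: "norm (H (of_real u) - H (of_real v)) \<le> A * \<bar>u - v\<bar>" if "v \<ge> 1" "v \<le> u" for u v
    using vector_increment_bound[of v u "\<lambda>u. H (of_real u)" "\<lambda>u. deriv H (of_real u)" A] that D' A by simp
  have "norm (H (of_real u) - H (of_real v)) \<le> A * \<bar>u - v\<bar>" if "u \<ge> 1" "v \<ge> 1" for u v
    using le[of v u] le[of u v] that by (metis abs_minus_commute linorder_le_cases norm_minus_commute)
  with A that show ?thesis by blast
qed

lemmas H_increment_forward = H_increment[THEN tendsto_increment_iff[of "\<lambda>u. H (of_real u)", THEN iffD1]]

lemma primitive_exists:
  obtains N where "\<And>w. (N has_field_derivative H w * exp (\<kappa> * w)) (at w)"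
proof -
  have "(\<lambda>w. H w * exp (\<kappa> * w)) holomorphic_on UNIV" by (intro holomorphic_intros holH)
  then obtain N where "\<And>x. x \<in> UNIV \<Longrightarrow> (N has_field_derivative H x * exp (\<kappa> * x)) (at x within UNIV)"
    by (rule holomorphic_convex_primitive'[of UNIV, rotated 2]) auto
  thus ?thesis by (intro that[of N]) simp
qed

text \<open>Increments along i l + j m vanish because those along l and m do. Such combinations are
  dense, and the Lipschitz bound covers the remaining distance to \<tau>.\<close>

lemma irrational_increment:
  assumes irr: "l / m \<notin> \<rat>"
  shows "((\<lambda>u. H (of_real (u + \<tau>)) - H (of_real u)) \<longlongrightarrow> 0) at_top"
proof (rule tendstoI)
  fix \<epsilon> :: real assume eps: "\<epsilon> > 0"
  obtain A where A: "A \<ge> 0" "\<And>u v. u \<ge> 1 \<Longrightarrow> v \<ge> 1 \<Longrightarrow> norm (H (of_real u) - H (of_real v)) \<le> A * \<bar>u - v\<bar>"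
    using H_lipschitz by metis
  define \<epsilon>' where "\<epsilon>' = \<epsilon> / (2 * (A + 1))"
  have e': "\<epsilon>' > 0" using eps A by (simp add: \<epsilon>'_def)
  obtain i j :: int where ij: "\<bar>of_int i * l + of_int j * m - \<tau>\<bar> < \<epsilon>'"
    using irrational_combination_dense[OF irr m e'] by blast
  define \<sigma> where "\<sigma> = of_int i * l + of_int j * m"
  have "((\<lambda>u. H (of_real (u + \<sigma>)) - H (of_real u)) \<longlongrightarrow> 0) at_top"
    unfolding \<sigma>_def
    by (intro tendsto_increment_add[of "\<lambda>u. H (of_real u)"] tendsto_increment_int[of "\<lambda>u. H (of_real u)"]
          H_increment_forward)
  hence "eventually (\<lambda>u. norm (H (of_real (u + \<sigma>)) - H (of_real u)) < \<epsilon> / 2) at_top"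
    using eps by (intro order_tendstoD(2)[OF tendsto_norm_zero]) auto
  thus "eventually (\<lambda>u. dist (H (of_real (u + \<tau>)) - H (of_real u)) 0 < \<epsilon>) at_top"
    using eventually_ge_at_top[of "1 + \<bar>\<sigma>\<bar> + \<bar>\<tau>\<bar>"]
  proof eventually_elim
    case (elim u)
    have "norm (H (of_real (u + \<tau>)) - H (of_real (u + \<sigma>))) \<le> A * \<bar>(u + \<tau>) - (u + \<sigma>)\<bar>"
      by (rule A(2)) (use elim in linarith)+
    also have "\<dots> \<le> A * \<epsilon>'" using ij A unfolding \<sigma>_def by (intro mult_left_mono) auto
    also have "\<dots> = (\<epsilon> / 2) * (A / (A + 1))" using A by (simp add: \<epsilon>'_def)
    also have "\<dots> \<le> (\<epsilon> / 2) * 1" using A eps by (intro mult_left_mono) auto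
    finally have "norm (H (of_real (u + \<tau>)) - H (of_real (u + \<sigma>))) \<le> \<epsilon> / 2" by simp
    moreover have "H (of_real (u + \<tau>)) - H (of_real u) = (H (of_real (u + \<tau>)) - H (of_real (u + \<sigma>))) + (H (of_real (u + \<sigma>)) - H (of_real u))"
      by simp
    ultimately show ?case using elim(1) norm_triangle_ineq[of "H (of_real (u + \<tau>)) - H (of_real (u + \<sigma>))" "H (of_real (u + \<sigma>)) - H (of_real u)"]
      by (simp only: dist_0_norm dist_norm diff_zero)
  qed
qed

text \<open>The preceding limit holds for each shift separately, while a window needs it uniformly
  over all shifts up to a. A finite grid of shifts together with the Lipschitz bound supplies the
  uniformity, so \<open>H\<close> is nearly constant on the whole window.\<close>

lemma irrational_window:
  assumes irr: "l / m \<notin> \<rat>" and a: "a > 0"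
    and N: "\<And>w. (N has_field_derivative H w) (at w)"
  shows "((\<lambda>u. N (of_real u) - N (of_real (u - a)) - of_real a * H (of_real u)) \<longlongrightarrow> 0) at_top"
proof (rule tendstoI)
  fix \<epsilon> :: real assume eps: "\<epsilon> > 0"
  obtain A where A: "A \<ge> 0" "\<And>u v. u \<ge> 1 \<Longrightarrow> v \<ge> 1 \<Longrightarrow> norm (H (of_real u) - H (of_real v)) \<le> A * \<bar>u - v\<bar>"
    using H_lipschitz by metis
  define \<epsilon>' where "\<epsilon>' = \<epsilon> / (4 * a)"
  have e': "\<epsilon>' > 0" using eps a by (simp add: \<epsilon>'_def)
  obtain n0 :: nat where n0: "A * a / \<epsilon>' < real n0" using reals_Archimedean2 by blast
  define n where "n = Suc n0"
  have n: "A * (a / real n) \<le> \<epsilon>'" "n > 0" using n0 e' by (simp_all add: n_def field_simps)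
  have "((\<lambda>u. H (of_real (u + (- (real j * a / real n)))) - H (of_real u)) \<longlongrightarrow> 0) at_top" for j
    by (rule irrational_increment[OF irr])
  hence "eventually (\<lambda>u. norm (H (of_real (u + (- (real j * a / real n)))) - H (of_real u)) < \<epsilon>') at_top" for j
    using e' by (intro order_tendstoD(2)[OF tendsto_norm_zero]) auto
  hence "eventually (\<lambda>u. \<forall>j\<in>{..n}. norm (H (of_real (u + (- (real j * a / real n)))) - H (of_real u)) < \<epsilon>') at_top"
    by (intro eventually_ball_finite) auto
  thus "eventually (\<lambda>u. dist (N (of_real u) - N (of_real (u - a)) - of_real a * H (of_real u)) 0 < \<epsilon>) at_top"
    using eventually_ge_at_top[of "1 + a"]
  proof eventually_elim
    case (elim u)
    \<comment> \<open>Subtracting the linear function with slope H u turns the claim into an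
      increment of \<open>N'\<close>, whose derivative is the deviation of \<open>H\<close> from H
      u.\<close>
    define N' where "N' = (\<lambda>v. N (of_real v) - of_real v * H (of_real u))"
    have "(N' has_vector_derivative H (of_real v) - H (of_real u)) (at v)" for v
    proof -
      have "((\<lambda>w. N w - w * H (of_real u)) has_field_derivative (H w - H (of_real u))) (at w)" for w
        by (auto intro!: derivative_eq_intros N)
      from has_vector_derivative_of_real_shift[OF this, of 0 v] show ?thesis
        unfolding N'_def by (simp only: diff_zero)
    qed
    moreover have "norm (H (of_real v) - H (of_real u)) \<le> 2 * \<epsilon>'" if v: "u - a \<le> v" "v \<le> u" for v
    proof -
      \<comment> \<open>The grid point u - j a / n is the last one that is not below v; it lies
        within a / n of v.\<close>
      define j where "j = nat \<lfloor>(u - v) * real n / a\<rfloor>"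
      have pos: "(u - v) * real n / a \<ge> 0" using v a by simp
      have "(u - v) * real n \<le> a * real n" using v by (intro mult_right_mono) auto
      hence "(u - v) * real n / a \<le> real n" using a by (simp add: field_simps)
      hence "\<lfloor>(u - v) * real n / a\<rfloor> \<le> int n" by linarith
      hence j: "j \<le> n" unfolding j_def by linarith
      have "real j \<le> (u - v) * real n / a" "(u - v) * real n / a \<le> real j + 1"
        unfolding j_def using pos by linarith+
      hence "real j * a / real n \<le> u - v" "u - v \<le> real j * a / real n + a / real n"
        using a n by (simp_all add: field_simps)
      moreover have "\<bar>v - (u + (- x))\<bar> \<le> y" if "x \<le> u - v" "u - v \<le> x + y" for x y
        using that by linarith
      ultimately have d: "\<bar>v - (u + (- (real j * a / real n)))\<bar> \<le> a / real n" by blast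
      have ja: "real j * a / real n \<le> a" using j a n by (simp add: field_simps)
      have "norm (H (of_real v) - H (of_real (u + (- (real j * a / real n))))) \<le> A * \<bar>v - (u + (- (real j * a / real n)))\<bar>"
        by (rule A(2)) (use elim v ja in linarith)+
      also have "\<dots> \<le> A * (a / real n)" using d A by (intro mult_left_mono) auto
      finally have 1: "norm (H (of_real v) - H (of_real (u + (- (real j * a / real n))))) \<le> \<epsilon>'" using n by linarith
      have 2: "norm (H (of_real (u + (- (real j * a / real n)))) - H (of_real u)) < \<epsilon>'"
        using elim(1) j by blast
      show ?thesis
        using norm_triangle_ineq[of "H (of_real v) - H (of_real (u + (- (real j * a / real n))))" "H (of_real (u + (- (real j * a / real n)))) - H (of_real u)"] 1 2
        by (simp only: diff_add_cancel add_diff_eq)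
    qed
    ultimately have "norm (N' u - N' (u - a)) \<le> 2 * \<epsilon>' * (u - (u - a))"
      using a by (intro vector_increment_bound) auto
    also have "\<dots> = \<epsilon> / 2" using a by (simp add: \<epsilon>'_def)
    also have "N' u - N' (u - a) = N (of_real u) - N (of_real (u - a)) - of_real a * H (of_real u)"
      by (simp add: N'_def algebra_simps)
    finally show ?case using eps by simp
  qed
qed

text \<open>Each window is asymptotically its length times H u, so the weighted windows are
  asymptotic to (p l + q m) H u = h H u.\<close>

lemma irrational_limit:
  assumes irr: "l / m \<notin> \<rat>"
    and N: "\<And>w. (N has_field_derivative H w) (at w)"
    and V: "(windows N \<longlongrightarrow> V) at_top"
  shows "((\<lambda>u. H (of_real u)) \<longlongrightarrow> V / of_real h) at_top"
proof -
  have "((\<lambda>u. windows N u - (of_real p * (N (of_real u) - N (of_real (u - l)) - of_real l * H (of_real u))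
        + of_real q * (N (of_real u) - N (of_real (u - m)) - of_real m * H (of_real u)))) \<longlongrightarrow> V - (of_real p * 0 + of_real q * 0)) at_top"
    by (intro tendsto_intros V irrational_window irr l m N)
  moreover have "windows N u - (of_real p * (N (of_real u) - N (of_real (u - l)) - of_real l * H (of_real u))
        + of_real q * (N (of_real u) - N (of_real (u - m)) - of_real m * H (of_real u))) = of_real h * H (of_real u)" for u
    by (simp add: windows_def h_def algebra_simps)
  ultimately have "((\<lambda>u. of_real h * H (of_real u) / of_real h) \<longlongrightarrow> V / of_real h) at_top"
    by (intro tendsto_divide tendsto_const) (use h_pos in auto)
  thus ?thesis using h_pos by simp
qed

end

section \<open>The lattice case and its Fourier series\<close>

lemma uniformly_continuous_on_uniform_limit:
  fixes f :: "'a \<Rightarrow> 'b::metric_space \<Rightarrow> 'c::metric_space"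
  assumes lim: "uniform_limit S f g F" and "F \<noteq> bot"
    and cont: "eventually (\<lambda>n. uniformly_continuous_on S (f n)) F"
  shows "uniformly_continuous_on S g"
  unfolding uniformly_continuous_on_def
proof (intro allI impI)
  fix e :: real assume e: "e > 0"
  have "eventually (\<lambda>n. \<forall>x\<in>S. dist (f n x) (g x) < e / 3) F"
    using lim e by (intro uniform_limitD) auto
  with cont have "eventually (\<lambda>n. uniformly_continuous_on S (f n) \<and> (\<forall>x\<in>S. dist (f n x) (g x) < e / 3)) F"
    by eventually_elim auto
  then obtain n where n: "uniformly_continuous_on S (f n)" "\<And>x. x \<in> S \<Longrightarrow> dist (f n x) (g x) < e / 3"
    using eventually_happens'[OF \<open>F \<noteq> bot\<close>] by blast
  then obtain d where d: "d > 0" "\<And>x x'. x \<in> S \<Longrightarrow> x' \<in> S \<Longrightarrow> dist x' x < d \<Longrightarrow> dist (f n x') (f n x) < e / 3"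
    using n(1)[unfolded uniformly_continuous_on_def, rule_format, of "e / 3"] e by auto
  have "dist (g x') (g x) < e" if "x \<in> S" "x' \<in> S" "dist x' x < d" for x x'
  proof -
    have "dist (g x') (g x) \<le> dist (g x') (f n x') + dist (f n x') (f n x) + dist (f n x) (g x)"
      using dist_triangle[of "g x'" "g x" "f n x'"] dist_triangle[of "f n x'" "g x" "f n x"] by linarith
    thus ?thesis using n(2)[OF that(1)] n(2)[OF that(2)] d(2)[OF that] by (simp add: dist_commute)
  qed
  thus "\<exists>d>0. \<forall>x\<in>S. \<forall>x'\<in>S. dist x' x < d \<longrightarrow> dist (g x') (g x) < e" using d(1) by blast
qed

lemma has_vector_derivative_cis_mult:
  "((\<lambda>v. cis (a * v)) has_vector_derivative of_real a * (\<i> * cis (a * x))) (at x)"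
proof -
  have "((\<lambda>z. exp (\<i> * of_real a * z)) has_field_derivative of_real a * (\<i> * exp (\<i> * of_real a * of_real x))) (at (of_real x))"
    by (auto intro!: derivative_eq_intros)
  from has_vector_derivative_real_field[OF this] show ?thesis by (simp add: cis_conv_exp mult.assoc)
qed

lemma norm_cis_diff_le: "norm (cis a - cis b) \<le> \<bar>a - b\<bar>"
proof -
  have *: "norm (cis a - cis b) \<le> 1 * (a - b)" if "b \<le> a" for a b
    by (rule vector_increment_bound[where f' = "\<lambda>t. \<i> * cis t"])
       (use that has_vector_derivative_cis_mult[of 1] in \<open>auto simp: norm_mult\<close>)
  show ?thesis using *[of a b] *[of b a] by (cases "a \<le> b") (auto simp: norm_minus_commute)
qed

lemma integral_cis_period:
  fixes k :: int assumes L: "L > 0"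
  shows "integral {u - L/2..u + L/2} (\<lambda>v. cis (2 * pi * k * v / L)) = (if k = 0 then of_real L else 0)"
proof (cases "k = 0")
  case False
  define a where "a = 2 * pi * k / L"
  have a: "a \<noteq> 0" using False L by (simp add: a_def)
  have "((\<lambda>v. cis (a * v)) has_integral (inverse (\<i> * of_real a) * cis (a * (u + L/2)) - inverse (\<i> * of_real a) * cis (a * (u - L/2)))) {u - L/2..u + L/2}"
  proof (rule fundamental_theorem_of_calculus)
    fix x
    have e: "inverse (\<i> * of_real a) * (of_real a * (\<i> * cis (a * x))) = cis (a * x)"
      using a by (simp add: field_simps)
    have "((\<lambda>v. inverse (\<i> * of_real a) * cis (a * v)) has_vector_derivative cis (a * x)) (at x)"
      using has_vector_derivative_mult_right[OF has_vector_derivative_cis_mult, of "inverse (\<i> * of_real a)" a x]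
      unfolding e .
    thus "((\<lambda>v. inverse (\<i> * of_real a) * cis (a * v)) has_vector_derivative cis (a * x)) (at x within {u - L/2..u + L/2})"
      by (rule has_vector_derivative_at_within)
  qed (use L in auto)
  moreover have "cis (a * (u + L/2)) = cis (a * (u - L/2))"
  proof -
    have "a * (u + L/2) = a * (u - L/2) + 2 * pi * of_int k" using L by (simp add: a_def field_simps)
    hence "cis (a * (u + L/2)) = cis (a * (u - L/2)) * cis (2 * pi * of_int k)"
      by (simp only: cis_mult)
    thus ?thesis using cis_multiple_2pi[of "of_int k"] by simp
  qed
  ultimately have "((\<lambda>v. cis (a * v)) has_integral 0) {u - L/2..u + L/2}" by simp
  hence "integral {u - L/2..u + L/2} (\<lambda>v. cis (a * v)) = 0" by (rule integral_unique)
  moreover have "a * v = 2 * pi * k * v / L" for v by (simp add: a_def)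
  ultimately show ?thesis using False by simp
qed (use L in \<open>simp add: scaleR_conv_of_real\<close>)

context renewal_equation
begin

text \<open>\<open>L\<close> is the span of the lattice generated by l and m, and exp (2 pi i k w /
  L) are the exponentials with both periods. The limits \<open>V\<close> stay abstract here; Mellin
  values are inserted only in the final section.\<close>

context
  fixes r s :: nat and L :: real and V :: "int \<Rightarrow> complex"
  assumes L: "L > 0" and r: "l = real r * L" and s: "m = real s * L" and coprime: "coprime r s"
    and V: "\<And>k N. (\<And>w. (N has_field_derivative H w * exp (\<i> * of_real (2 * pi * of_int k / L) * w)) (at w))
              \<Longrightarrow> (windows N \<longlongrightarrow> V k) at_top"
begin

text \<open>By Bezout, L is an integer combination of l = r L and m = s L, and increments along both
  vanish.\<close>

lemma lattice_increment: "((\<lambda>u. H (of_real (u + L)) - H (of_real u)) \<longlongrightarrow> 0) at_top"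
proof -
  obtain i j where ij: "i * int r + j * int s = gcd (int r) (int s)" using bezout_int by blast
  have "gcd (int r) (int s) = 1" using coprime by (simp add: gcd_int_int_eq coprime_iff_gcd_eq_1)
  hence "of_int i * real r + of_int j * real s = 1" using ij by (metis of_int_1 of_int_add of_int_mult of_int_of_nat_eq)
  hence "of_int i * l + of_int j * m = L" unfolding r s by (metis distrib_right mult.assoc mult_1)
  moreover have "((\<lambda>u. H (of_real (u + (of_int i * l + of_int j * m))) - H (of_real u)) \<longlongrightarrow> 0) at_top"
    by (intro tendsto_increment_add[of "\<lambda>u. H (of_real u)"] tendsto_increment_int[of "\<lambda>u. H (of_real u)"]
          H_increment_forward)
  ultimately show ?thesis by simp
qed

text \<open>The exponential has period L and the increments of \<open>H\<close> over L vanish, so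
  shifting a window of length L by a multiple of L changes its integral by o(1). A window of length
  l then counts as r such windows and one of length m as s. The weighted sum is (p r + q s) = h / L
  times a single window.\<close>

lemma lattice_window:
  assumes N: "\<And>w. (N has_field_derivative H w * exp (\<i> * of_real (2 * pi * of_int k / L) * w)) (at w)"
  shows "((\<lambda>u. N (of_real u) - N (of_real (u - L))) \<longlongrightarrow> V k * of_real (L / h)) at_top"
proof -
  define \<kappa> where "\<kappa> = \<i> * of_real (2 * pi * of_int k / L)"
  define w where "w = (\<lambda>u. N (of_real u) - N (of_real (u - L)))"
  have N': "(N has_field_derivative H w * exp (\<kappa> * w)) (at w)" for w using N by (simp only: \<kappa>_def)
  have eL: "exp (\<kappa> * of_real (v - L)) = exp (\<kappa> * of_real v)" for v
  proof -
    have "\<kappa> * of_real L = \<i> * of_real (2 * pi * of_int k)" using L by (simp add: \<kappa>_def)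
    hence "exp (\<kappa> * of_real L) = 1" by (simp add: exp_eq_1 mult.commute)
    thus ?thesis by (simp add: right_diff_distrib exp_diff)
  qed
  have N0: "((\<lambda>u. N (of_real u)) has_vector_derivative H (of_real u) * exp (\<kappa> * of_real u)) (at u)" for u
    using has_vector_derivative_of_real_shift[OF N', of 0 u] by (simp only: diff_zero)
  have dw: "(w has_vector_derivative (H (of_real v) - H (of_real (v - L))) * exp (\<kappa> * of_real v)) (at v)" for v
    using has_vector_derivative_diff[OF N0[of v] has_vector_derivative_of_real_shift[OF N', of L v]]
    unfolding w_def eL by (simp only: left_diff_distrib)
  have inc: "((\<lambda>v. H (of_real v) - H (of_real (v - L))) \<longlongrightarrow> 0) at_top"
    using lattice_increment by (rule tendsto_increment_iff[of "\<lambda>u. H (of_real u)", THEN iffD2])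
  have "((\<lambda>v. (H (of_real v) - H (of_real (v - L))) * exp (\<kappa> * of_real v)) \<longlongrightarrow> 0) at_top"
    by (rule Lim_null_comparison[OF always_eventually tendsto_norm_zero[OF inc]])
       (simp add: norm_mult \<kappa>_def)
  from window_increment_tendsto_0[OF dw this] have wj: "((\<lambda>u. w u - w (u - real j * L)) \<longlongrightarrow> 0) at_top" for j
    using L by simp
  have tel: "N (of_real u) - N (of_real (u - real n * L)) = (\<Sum>j<n. w (u - real j * L))" for n u
    by (induction n) (simp_all add: w_def algebra_simps)
  have sum0: "((\<lambda>u. of_nat n * w u - (N (of_real u) - N (of_real (u - real n * L)))) \<longlongrightarrow> 0) at_top" for n
  proof -
    have "((\<lambda>u. \<Sum>j<n. w u - w (u - real j * L)) \<longlongrightarrow> (\<Sum>j<n. 0)) at_top"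
      by (intro tendsto_sum wj)
    thus ?thesis unfolding tel by (simp add: sum_subtractf)
  qed
  have "((\<lambda>u. windows N u + (of_real p * (of_nat r * w u - (N (of_real u) - N (of_real (u - real r * L))))
        + of_real q * (of_nat s * w u - (N (of_real u) - N (of_real (u - real s * L)))))) \<longlongrightarrow> V k + (of_real p * 0 + of_real q * 0)) at_top"
    by (intro tendsto_intros sum0 V N)
  moreover have "windows N u + (of_real p * (of_nat r * w u - (N (of_real u) - N (of_real (u - real r * L))))
        + of_real q * (of_nat s * w u - (N (of_real u) - N (of_real (u - real s * L))))) = of_real (h / L) * w u" for u
  proof -
    have e: "real r * L = l" "real s * L = m" using r s by simp_all
    have "h / L = p * real r + q * real s"
    proof -
      have "h = (p * real r + q * real s) * L" unfolding distrib_right mult.assoc e by (rule h_def)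
      thus ?thesis using L by simp
    qed
    hence hL: "of_real (h / L) = (of_real p * of_nat r + of_real q * of_nat s :: complex)" by simp
    show ?thesis unfolding windows_def e hL by (simp add: algebra_simps)
  qed
  ultimately have "((\<lambda>u. of_real (h / L) * w u * of_real (L / h)) \<longlongrightarrow> (V k + (of_real p * 0 + of_real q * 0)) * of_real (L / h)) at_top"
    by (intro tendsto_mult tendsto_const) simp
  moreover have "of_real (h / L) * w u * of_real (L / h) = w u" for u using h_pos L by simp
  ultimately show ?thesis by (simp add: w_def)
qed

text \<open>Two integrations by parts over one period. The boundary term with 1 / \<kappa> contains
  an increment of \<open>H\<close> over L, which vanishes in the limit; everything else is bounded
  and carries 1 / \<kappa>^2. The resulting rate 1 / k^2 makes the Fourier series absolutely
  convergent.\<close>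

lemma lattice_coefficient_bound:
  "\<exists>B\<ge>0. \<forall>k. k \<noteq> 0 \<longrightarrow> norm (V k) \<le> B / (of_int k)\<^sup>2"
proof -
  obtain A where A: "A \<ge> 0" "\<And>u. u \<ge> 1 \<Longrightarrow> norm (deriv H (of_real u)) \<le> A"
      "\<And>u. u \<ge> 1 \<Longrightarrow> norm (deriv (deriv H) (of_real u)) \<le> A"
    using H_derivs_bounded by blast
  have "norm (V k) \<le> (A * (L + 2) * h * L / (4 * pi\<^sup>2)) / (of_int k)\<^sup>2" if k: "k \<noteq> 0" for k
  proof -
    define \<kappa> where "\<kappa> = \<i> * of_real (2 * pi * of_int k / L)"
    have \<kappa>0: "\<kappa> \<noteq> 0" using k L by (simp add: \<kappa>_def)
    have n\<kappa>: "norm (\<kappa>\<^sup>2) = 4 * pi\<^sup>2 * (of_int k)\<^sup>2 / L\<^sup>2" by (simp add: \<kappa>_def norm_power norm_mult power_mult_distrib norm_divide power_divide)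
    have nexp: "norm (exp (\<kappa> * of_real v)) = 1" for v by (simp add: \<kappa>_def)
    have eL: "exp (\<kappa> * of_real (v - L)) = exp (\<kappa> * of_real v)" for v
    proof -
      have "\<kappa> * of_real L = \<i> * of_real (2 * pi * of_int k)" using L by (simp add: \<kappa>_def)
      hence "exp (\<kappa> * of_real L) = 1" by (simp add: exp_eq_1 mult.commute)
      thus ?thesis by (simp add: right_diff_distrib exp_diff)
    qed
    obtain N where N: "\<And>w. (N has_field_derivative H w * exp (\<kappa> * w)) (at w)" using primitive_exists by blast
    have lim: "((\<lambda>u. N (of_real u) - N (of_real (u - L))) \<longlongrightarrow> V k * of_real (L / h)) at_top"
      by (rule lattice_window) (use N in \<open>simp only: \<kappa>_def\<close>)
    \<comment> \<open>\<open>B\<close> removes both boundary terms at once: its derivative is exp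
      (\<kappa> w) H'' / \<kappa>^2.\<close>
    define B where "B = (\<lambda>w. N w - exp (\<kappa> * w) * (H w / \<kappa> - deriv H w / \<kappa>\<^sup>2))"
    have H': "(H has_field_derivative deriv H w) (at w)" for w
      using holH by (intro holomorphic_derivI[of _ UNIV]) auto
    have H'': "(deriv H has_field_derivative deriv (deriv H) w) (at w)" for w
      using holomorphic_deriv[OF holH] by (intro holomorphic_derivI[of _ UNIV]) auto
    have B': "(B has_field_derivative exp (\<kappa> * w) * deriv (deriv H) w / \<kappa>\<^sup>2) (at w)" for w
      unfolding B_def using \<kappa>0
      by (auto intro!: derivative_eq_intros N H' H'' simp: field_simps power2_eq_square)
    have Bv: "((\<lambda>u. B (of_real u)) has_vector_derivative exp (\<kappa> * of_real u) * deriv (deriv H) (of_real u) / \<kappa>\<^sup>2) (at u)" for u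
      using has_vector_derivative_of_real_shift[OF B', of 0 u] by (simp only: diff_zero)
    have inc: "((\<lambda>v. H (of_real v) - H (of_real (v - L))) \<longlongrightarrow> 0) at_top"
      using lattice_increment by (rule tendsto_increment_iff[of "\<lambda>u. H (of_real u)", THEN iffD2])
    have bnd: "norm (N (of_real u) - N (of_real (u - L))) \<le> norm (H (of_real u) - H (of_real (u - L))) / norm \<kappa> + A * (L + 2) / norm (\<kappa>\<^sup>2)"
      if u: "u \<ge> 1 + L" for u
    proof -
      have "norm (B (of_real u) - B (of_real (u - L))) \<le> A / norm (\<kappa>\<^sup>2) * (u - (u - L))"
        by (rule vector_increment_bound[OF _ Bv])
           (use u L in \<open>simp_all add: norm_mult norm_divide nexp divide_right_mono A(3) del: norm_exp_eq_Re\<close>)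
      hence 1: "norm (B (of_real u) - B (of_real (u - L))) \<le> A * L / norm (\<kappa>\<^sup>2)" by simp
      have 2: "norm (exp (\<kappa> * of_real u) * ((H (of_real u) - H (of_real (u - L))) / \<kappa>)) = norm (H (of_real u) - H (of_real (u - L))) / norm \<kappa>"
        by (simp add: norm_mult norm_divide nexp del: norm_exp_eq_Re)
      have "norm (deriv H (of_real u) - deriv H (of_real (u - L))) \<le> A + A"
        using A(2)[of u] A(2)[of "u - L"] u L by (intro order_trans[OF norm_triangle_ineq4] add_mono) auto
      hence 3: "norm (exp (\<kappa> * of_real u) * ((deriv H (of_real u) - deriv H (of_real (u - L))) / \<kappa>\<^sup>2)) \<le> 2 * A / norm (\<kappa>\<^sup>2)"
        by (simp add: norm_mult norm_divide nexp divide_right_mono del: norm_exp_eq_Re)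
      have "N (of_real u) - N (of_real (u - L)) = (B (of_real u) - B (of_real (u - L)))
        + exp (\<kappa> * of_real u) * ((H (of_real u) - H (of_real (u - L))) / \<kappa>)
        - exp (\<kappa> * of_real u) * ((deriv H (of_real u) - deriv H (of_real (u - L))) / \<kappa>\<^sup>2)"
        unfolding B_def eL by (simp add: algebra_simps diff_divide_distrib)
      hence "norm (N (of_real u) - N (of_real (u - L))) \<le> norm (B (of_real u) - B (of_real (u - L)))
        + norm (exp (\<kappa> * of_real u) * ((H (of_real u) - H (of_real (u - L))) / \<kappa>))
        + norm (exp (\<kappa> * of_real u) * ((deriv H (of_real u) - deriv H (of_real (u - L))) / \<kappa>\<^sup>2))"
        by (simp only:) (intro order_trans[OF norm_triangle_ineq4] add_mono norm_triangle_ineq order_refl)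
      also have "\<dots> \<le> A * L / norm (\<kappa>\<^sup>2) + norm (H (of_real u) - H (of_real (u - L))) / norm \<kappa> + 2 * A / norm (\<kappa>\<^sup>2)"
        using 1 2 3 by linarith
      also have "\<dots> = norm (H (of_real u) - H (of_real (u - L))) / norm \<kappa> + A * (L + 2) / norm (\<kappa>\<^sup>2)"
        by (simp add: distrib_left add_divide_distrib)
      finally show ?thesis .
    qed
    have "norm (V k * of_real (L / h)) \<le> 0 / norm \<kappa> + A * (L + 2) / norm (\<kappa>\<^sup>2)"
    proof (rule tendsto_le[OF trivial_limit_at_top_linorder _ tendsto_norm[OF lim]])
      show "((\<lambda>u. norm (H (of_real u) - H (of_real (u - L))) / norm \<kappa> + A * (L + 2) / norm (\<kappa>\<^sup>2)) \<longlongrightarrow> 0 / norm \<kappa> + A * (L + 2) / norm (\<kappa>\<^sup>2)) at_top"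
        by (intro tendsto_intros tendsto_norm_zero inc) (use \<kappa>0 in auto)
      show "eventually (\<lambda>u. norm (N (of_real u) - N (of_real (u - L))) \<le> norm (H (of_real u) - H (of_real (u - L))) / norm \<kappa> + A * (L + 2) / norm (\<kappa>\<^sup>2)) at_top"
        using eventually_ge_at_top[of "1 + L"] by eventually_elim (rule bnd)
    qed
    hence "norm (V k) * (L / h) \<le> A * (L + 2) / (4 * pi\<^sup>2 * (of_int k)\<^sup>2 / L\<^sup>2)"
      using L h_pos unfolding n\<kappa> by (simp add: norm_mult norm_divide)
    hence "norm (V k) * (L / h) * (h / L) \<le> A * (L + 2) / (4 * pi\<^sup>2 * (of_int k)\<^sup>2 / L\<^sup>2) * (h / L)"
      using L h_pos by (intro mult_right_mono) auto
    also have "norm (V k) * (L / h) * (h / L) = norm (V k)" using L h_pos by simp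
    also have "A * (L + 2) / (4 * pi\<^sup>2 * (of_int k)\<^sup>2 / L\<^sup>2) * (h / L) = (A * (L + 2) * h * L / (4 * pi\<^sup>2)) / (of_int k)\<^sup>2"
      using L by (simp add: power2_eq_square mult_ac)
    finally show ?thesis .
  qed
  moreover have "A * (L + 2) * h * L / (4 * pi\<^sup>2) \<ge> 0" using A L h_pos by simp
  ultimately show ?thesis by blast
qed

lemma lattice_summable: "(\<lambda>k. norm (V k)) summable_on UNIV"
proof -
  obtain B where B: "B \<ge> 0" "\<And>k. k \<noteq> 0 \<Longrightarrow> norm (V k) \<le> B / (of_int k)\<^sup>2" using lattice_coefficient_bound by blast
  have "(\<lambda>k::int. B * (1 / (of_int k)\<^sup>2)) summable_on (UNIV - {0})"
    by (intro summable_on_cmult_right summable_on_subset_banach[OF summable_on_inverse_square_int]) auto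
  hence "(\<lambda>k. norm (V k)) summable_on (UNIV - {0})"
    by (rule summable_on_comparison_test) (use B in auto)
  hence "(\<lambda>k. norm (V k)) summable_on insert 0 (UNIV - {0})" by (subst summable_on_insert_iff)
  thus ?thesis by (simp add: insert_UNIV)
qed

text \<open>The series S / h is periodic and continuous, and by orthogonality its window
  coefficients are V k L / h, exactly the limits found for \<open>H\<close>. The difference thus has
  vanishing window coefficients and, being bounded and uniformly continuous, tends to 0.\<close>

lemma lattice_limit:
  "((\<lambda>u. H (of_real u) - (\<Sum>\<^sub>\<infinity>k. V k * cis (- 2 * pi * of_int k * u / L)) / of_real h) \<longlongrightarrow> 0) at_top"
proof -
  define t where "t = (\<lambda>k u. V k * cis (- 2 * pi * of_int k * u / L))"
  define S where "S = (\<lambda>u. \<Sum>\<^sub>\<infinity>k. t k u)"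
  have nt: "norm (t k u) \<le> norm (V k)" for k u by (simp add: t_def norm_mult)
  have unif: "uniform_limit UNIV (\<lambda>X u. \<Sum>k\<in>X. t k u) S (finite_subsets_at_top UNIV)"
    unfolding S_def by (rule Weierstrass_m_test_general[OF _ lattice_summable]) (rule nt)
  have ut: "uniformly_continuous_on UNIV (t k)" for k
  proof (rule lipschitz_on_uniformly_continuous[of "norm (V k) * (2 * pi * \<bar>of_int k\<bar> / L)"], rule lipschitz_onI)
    fix u v :: real
    have "norm (t k u - t k v) = norm (V k) * norm (cis (- 2 * pi * of_int k * u / L) - cis (- 2 * pi * of_int k * v / L))"
      unfolding t_def by (simp only: right_diff_distrib[symmetric] norm_mult)
    also have "\<dots> \<le> norm (V k) * \<bar>(- 2 * pi * of_int k * u / L) - (- 2 * pi * of_int k * v / L)\<bar>"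
      by (intro mult_left_mono norm_cis_diff_le) auto
    also have "(- 2 * pi * of_int k * u / L) - (- 2 * pi * of_int k * v / L) = - (2 * pi * of_int k / L) * (u - v)"
      using L by (simp add: field_simps)
    also have "\<bar>- (2 * pi * of_int k / L) * (u - v)\<bar> = (2 * pi * \<bar>of_int k\<bar> / L) * \<bar>u - v\<bar>"
      using L by (simp add: abs_mult)
    finally show "dist (t k u) (t k v) \<le> norm (V k) * (2 * pi * \<bar>of_int k\<bar> / L) * dist u v"
      by (simp add: dist_norm mult_ac)
  qed (use L in auto)
  have us: "uniformly_continuous_on UNIV (\<lambda>u. \<Sum>k\<in>X. t k u)" if "finite X" for X
    using that by (induction rule: finite_induct)
      (auto intro!: uniformly_continuous_on_add ut uniformly_continuous_on_const)
  have uS: "uniformly_continuous_on UNIV S"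
    by (rule uniformly_continuous_on_uniform_limit[OF unif])
       (auto intro!: eventually_finite_subsets_at_top_weakI us)
  have uS1: "uniformly_continuous_on {1..} S"
    using uS unfolding uniformly_continuous_on_def by (meson UNIV_I)
  have contS: "continuous_on UNIV S" using uS by (rule uniformly_continuous_imp_continuous)
  have bS: "norm (S u) \<le> (\<Sum>\<^sub>\<infinity>k. norm (V k))" for u
    unfolding S_def using norm_infsum_bound[of "\<lambda>k. t k u" UNIV] lattice_summable
    by (simp add: t_def norm_mult)
  have intS: "integral {u - L/2..u + L/2} (\<lambda>v. S v * cis (2 * pi * of_int k * v / L)) = V k * of_real L" for u k
  proof -
    define e where "e = (\<lambda>v. cis (2 * pi * of_int k * v / L))"
    have "uniform_limit {u - L/2..u + L/2} (\<lambda>X v. (\<Sum>k\<in>X. t k v) * e v) (\<lambda>v. S v * e v) (finite_subsets_at_top UNIV)"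
    proof (rule uniform_limitI)
      fix \<epsilon> :: real assume "\<epsilon> > 0"
      from uniform_limitD[OF unif this]
      show "eventually (\<lambda>X. \<forall>v\<in>{u - L/2..u + L/2}. dist ((\<Sum>k\<in>X. t k v) * e v) (S v * e v) < \<epsilon>) (finite_subsets_at_top UNIV)"
        by eventually_elim (simp add: dist_norm e_def norm_mult flip: left_diff_distrib)
    qed
    then obtain I J where I: "\<And>X. ((\<lambda>v. (\<Sum>k\<in>X. t k v) * e v) has_integral I X) {u - L/2..u + L/2}"
      and J: "((\<lambda>v. S v * e v) has_integral J) {u - L/2..u + L/2}" "(I \<longlongrightarrow> J) (finite_subsets_at_top UNIV)"
      by (rule uniform_limit_integral)
         (auto simp: t_def e_def intro!: continuous_intros, use L in auto)
    have "I X = V k * of_real L" if X: "finite X" "k \<in> X" for X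
    proof -
      have te: "t j v * e v = V j * cis (2 * pi * of_int (k - j) * v / L)" for j v
        by (simp add: t_def e_def cis_mult mult.assoc diff_divide_distrib algebra_simps)
      have "I X = integral {u - L/2..u + L/2} (\<lambda>v. \<Sum>j\<in>X. t j v * e v)"
        using I[of X] by (simp add: sum_distrib_right integral_unique)
      also have "\<dots> = (\<Sum>j\<in>X. integral {u - L/2..u + L/2} (\<lambda>v. t j v * e v))"
        by (rule integral_sum[OF X(1)])
           (auto simp: t_def e_def intro!: integrable_continuous_real continuous_intros, use L in auto)
      also have "\<dots> = (\<Sum>j\<in>X. V j * (if k = j then of_real L else 0))"
        by (simp only: te integral_mult_right integral_cis_period[OF L] right_minus_eq)
      also have "\<dots> = (\<Sum>j\<in>X. if k = j then V k * of_real L else 0)" by (intro sum.cong) auto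
      also have "\<dots> = V k * of_real L" using X by simp
      finally show ?thesis .
    qed
    hence "eventually (\<lambda>X. I X = V k * of_real L) (finite_subsets_at_top UNIV)"
      unfolding eventually_finite_subsets_at_top by (intro exI[of _ "{k}"]) auto
    hence "(I \<longlongrightarrow> V k * of_real L) (finite_subsets_at_top UNIV)" by (rule tendsto_eventually)
    with J(2) have "J = V k * of_real L" by (rule tendsto_unique[OF finite_subsets_at_top_neq_bot])
    thus ?thesis using integral_unique[OF J(1)] by (simp only: e_def)
  qed
  define E where "E = (\<lambda>u. H (of_real u) - S u / of_real h)"
  obtain A where A: "A \<ge> 0" "\<And>u. u \<ge> 1 \<Longrightarrow> norm (H (of_real u)) \<le> A"
    "\<And>u v. u \<ge> 1 \<Longrightarrow> v \<ge> 1 \<Longrightarrow> norm (H (of_real u) - H (of_real v)) \<le> A * \<bar>u - v\<bar>"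
    using H_lipschitz by metis
  have contH: "continuous_on X (\<lambda>u. H (of_real u))" for X
    using continuous_on_compose2[OF holomorphic_on_imp_continuous_on[OF holH], of X of_real]
    by (auto intro: continuous_intros)
  have "(E \<longlongrightarrow> 0) at_top"
  proof (rule tendsto_0_of_window_coefficients[OF L])
    show "continuous_on UNIV E" unfolding E_def
      by (intro continuous_intros contH contS) (use h_pos in auto)
    show "uniformly_continuous_on {1..} E"
    proof -
      have "uniformly_continuous_on {1..} (\<lambda>u. H (of_real u))"
        by (rule lipschitz_on_uniformly_continuous[of A], rule lipschitz_onI)
           (use A in \<open>auto simp: dist_norm\<close>)
      moreover have "uniformly_continuous_on {1..} (\<lambda>u. inverse (of_real h) * S u)"
        by (intro bounded_linear.uniformly_continuous_on[OF bounded_linear_mult_right] uS1)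
      ultimately have "uniformly_continuous_on {1..} (\<lambda>u. H (of_real u) - inverse (of_real h) * S u)"
        by (rule uniformly_continuous_on_diff)
      thus ?thesis by (simp add: E_def divide_inverse mult.commute)
    qed
    show "norm (E u) \<le> A + (\<Sum>\<^sub>\<infinity>k. norm (V k)) / h" if "u \<ge> 1" for u
    proof -
      have "norm (E u) \<le> norm (H (of_real u)) + norm (S u / of_real h)" unfolding E_def by (rule norm_triangle_ineq4)
      thus ?thesis using A(2)[OF that] bS[of u] h_pos divide_right_mono[OF bS[of u], of h]
        by (simp add: norm_divide)
    qed
    fix k :: int
    define \<kappa> where "\<kappa> = \<i> * of_real (2 * pi * of_int k / L)"
    obtain N where N: "\<And>w. (N has_field_derivative H w * exp (\<kappa> * w)) (at w)" using primitive_exists by blast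
    have lim: "((\<lambda>u. N (of_real u) - N (of_real (u - L))) \<longlongrightarrow> V k * of_real (L / h)) at_top"
      by (rule lattice_window) (use N in \<open>simp only: \<kappa>_def\<close>)
    have cis_e: "exp (\<kappa> * of_real v) = cis (2 * pi * of_int k * v / L)" for v
      by (simp add: cis_conv_exp \<kappa>_def mult.assoc)
    have N0: "((\<lambda>u. N (of_real u)) has_vector_derivative H (of_real u) * cis (2 * pi * of_int k * u / L)) (at u)" for u
      using has_vector_derivative_of_real_shift[OF N, of 0 u] by (simp only: diff_zero cis_e)
    have IH: "integral {u - L/2..u + L/2} (\<lambda>v. H (of_real v) * cis (2 * pi * of_int k * v / L))
        = N (of_real (u + L/2)) - N (of_real (u + L/2 - L))" for u
    proof -
      have "u + L/2 - L = u - L/2" by simp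
      moreover have "((\<lambda>v. H (of_real v) * cis (2 * pi * of_int k * v / L)) has_integral N (of_real (u + L/2)) - N (of_real (u - L/2))) {u - L/2..u + L/2}"
        by (rule fundamental_theorem_of_calculus) (use L in \<open>auto intro: has_vector_derivative_at_within N0\<close>)
      ultimately show ?thesis by (simp only: integral_unique)
    qed
    have sh: "filterlim (\<lambda>u::real. u + L/2) at_top at_top"
      by (subst add.commute, rule filterlim_tendsto_add_at_top[OF tendsto_const filterlim_ident])
    have "((\<lambda>u. integral {u - L/2..u + L/2} (\<lambda>v. H (of_real v) * cis (2 * pi * of_int k * v / L))) \<longlongrightarrow> V k * of_real (L / h)) at_top"
      unfolding IH using filterlim_compose[OF lim sh] .
    moreover have "integral {u - L/2..u + L/2} (\<lambda>v. E v * cis (2 * pi * of_int k * v / L)) =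
      integral {u - L/2..u + L/2} (\<lambda>v. H (of_real v) * cis (2 * pi * of_int k * v / L)) - V k * of_real (L / h)" for u
    proof -
      have "E v * cis (2 * pi * of_int k * v / L) = H (of_real v) * cis (2 * pi * of_int k * v / L) - S v * cis (2 * pi * of_int k * v / L) / of_real h" for v
        by (simp add: E_def left_diff_distrib)
      moreover have "(\<lambda>v. H (of_real v) * cis (2 * pi * of_int k * v / L)) integrable_on {u - L/2..u + L/2}"
        by (intro integrable_continuous_real continuous_intros contH) (use L in auto)
      moreover have "(\<lambda>v. S v * cis (2 * pi * of_int k * v / L) / of_real h) integrable_on {u - L/2..u + L/2}"
        by (intro integrable_continuous_real continuous_intros continuous_on_subset[OF contS]) (use L h_pos in auto)
      ultimately have "integral {u - L/2..u + L/2} (\<lambda>v. E v * cis (2 * pi * of_int k * v / L)) =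
        integral {u - L/2..u + L/2} (\<lambda>v. H (of_real v) * cis (2 * pi * of_int k * v / L)) - integral {u - L/2..u + L/2} (\<lambda>v. S v * cis (2 * pi * of_int k * v / L) / of_real h)"
        by (simp only: integral_diff)
      also have "integral {u - L/2..u + L/2} (\<lambda>v. S v * cis (2 * pi * of_int k * v / L) / of_real h) = V k * of_real (L / h)"
        using intS[of u k] by simp
      finally show ?thesis .
    qed
    ultimately show "((\<lambda>u. integral {u - L/2..u + L/2} (\<lambda>v. E v * cis (2 * pi * of_int k * v / L))) \<longlongrightarrow> 0) at_top"
      by (simp only: LIM_zero)
  qed
  thus ?thesis by (simp add: E_def S_def t_def)
qed

end

end

section \<open>Recurrences with binomial splitting\<close>

lemma Bernstein_reflect: "k \<le> n \<Longrightarrow> Bernstein n (n - k) (1 - p) = Bernstein n k p"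
  by (simp add: Bernstein_def binomial_symmetric[of k n] mult_ac)

lemma sum_Bernstein_reflect: "(\<Sum>k\<le>n. Bernstein n k p * w (n - k)) = (\<Sum>k\<le>n. Bernstein n k (1 - p) * w k)"
proof -
  have "(\<Sum>k\<le>n. Bernstein n k p * w (n - k)) = (\<Sum>k\<le>n. Bernstein n (n - k) p * w (n - (n - k)))"
    by (rule sum.nat_diff_reindex[symmetric, of _ "Suc n", simplified lessThan_Suc_atMost diff_Suc_Suc diff_Suc_1', simplified])
  also have "\<dots> = (\<Sum>k\<le>n. Bernstein n k (1 - p) * w k)"
    using Bernstein_reflect[of _ n "1 - p"] by (intro sum.cong) auto
  finally show ?thesis .
qed

text \<open>This conditions n + 1 binomial trials on the outcome of one of them; algebraically it is
  Pascal's rule.\<close>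

lemma sum_Bernstein_Suc:
  "(\<Sum>k\<le>Suc n. Bernstein (Suc n) k p * w k) = (\<Sum>k\<le>n. Bernstein n k p * (p * w (Suc k) + (1 - p) * w k))"
proof -
  let ?q = "1 - p"
  have "(\<Sum>k\<le>Suc n. Bernstein (Suc n) k p * w k)
      = ?q ^ Suc n * w 0 + (\<Sum>k\<le>n. Bernstein (Suc n) (Suc k) p * w (Suc k))"
    by (subst sum.atMost_Suc_shift) (simp add: Bernstein_def)
  also have "(\<Sum>k\<le>n. Bernstein (Suc n) (Suc k) p * w (Suc k))
      = (\<Sum>k\<le>n. Bernstein n k p * (p * w (Suc k))) + (\<Sum>k\<le>n. (n choose Suc k) * p ^ Suc k * ?q ^ (n - k) * w (Suc k))"
    by (simp add: Bernstein_def algebra_simps flip: sum.distrib)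
  also have "?q ^ Suc n * w 0 + (\<dots>) = (\<Sum>k\<le>n. Bernstein n k p * (p * w (Suc k)))
       + (\<Sum>k\<le>Suc n. (n choose k) * p ^ k * ?q ^ (Suc n - k) * w k)"
    by (subst sum.atMost_Suc_shift[of "\<lambda>k. (n choose k) * p ^ k * ?q ^ (Suc n - k) * w k"]) simp
  also have "(\<Sum>k\<le>Suc n. (n choose k) * p ^ k * ?q ^ (Suc n - k) * w k) = (\<Sum>k\<le>n. Bernstein n k p * (?q * w k))"
    by (simp add: Bernstein_def Suc_diff_le mult_ac)
  finally show ?thesis by (simp add: distrib_left sum.distrib)
qed

text \<open>Jensen's inequality for the concave power x^\<gamma> at the mean n p + 1 of k + 1. The
  tangent line at the mean comes from Young's inequality.\<close>

lemma sum_Bernstein_powr_le: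
  fixes p \<gamma> :: real
  assumes p: "0 \<le> p" "p \<le> 1" and \<gamma>: "0 \<le> \<gamma>" "\<gamma> \<le> 1"
  shows "(\<Sum>k\<le>n. Bernstein n k p * real (Suc k) powr \<gamma>) \<le> (real n * p + 1) powr \<gamma>"
proof -
  define y where "y = real n * p + 1"
  have y: "y > 0" using p by (simp add: y_def add_nonneg_pos)
  have "real (Suc k) powr \<gamma> \<le> y powr \<gamma> * (1 - \<gamma>) + y powr \<gamma> * \<gamma> / y * (real k + 1)" for k
  proof -
    have "(real (Suc k) / y) powr \<gamma> * 1 powr (1 - \<gamma>) \<le> \<gamma> * (real (Suc k) / y) + (1 - \<gamma>) * 1"
      by (rule Youngs_inequality_0) (use y \<gamma> in auto)
    hence "y powr \<gamma> * (real (Suc k) / y) powr \<gamma> \<le> y powr \<gamma> * (\<gamma> * (real (Suc k) / y) + (1 - \<gamma>) * 1)"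
      by (intro mult_left_mono) auto
    thus ?thesis using y by (simp add: powr_divide algebra_simps)
  qed
  hence "(\<Sum>k\<le>n. Bernstein n k p * real (Suc k) powr \<gamma>) \<le> (\<Sum>k\<le>n. Bernstein n k p * (y powr \<gamma> * (1 - \<gamma>) + y powr \<gamma> * \<gamma> / y * (real k + 1)))"
    using p by (intro sum_mono mult_left_mono Bernstein_nonneg) auto
  also have "\<dots> = y powr \<gamma> * (1 - \<gamma>) * (\<Sum>k\<le>n. Bernstein n k p) + y powr \<gamma> * \<gamma> / y * ((\<Sum>k\<le>n. real k * Bernstein n k p) + (\<Sum>k\<le>n. Bernstein n k p))"
  proof -
    have "(\<Sum>k\<le>n. Bernstein n k p * (A + B * (real k + 1))) = A * (\<Sum>k\<le>n. Bernstein n k p) + B * ((\<Sum>k\<le>n. real k * Bernstein n k p) + (\<Sum>k\<le>n. Bernstein n k p))" for A B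
      by (simp add: sum_distrib_left sum.distrib[symmetric] algebra_simps del: sum_Bernstein sum_k_Bernstein)
    thus ?thesis .
  qed
  also have "\<dots> = y powr \<gamma> * (1 - \<gamma>) + y powr \<gamma> * \<gamma> / y * y" by (simp add: sum_k_Bernstein y_def)
  also have "\<dots> = y powr \<gamma>" using y by (simp add: algebra_simps)
  finally show ?thesis by (simp add: y_def)
qed

text \<open>An extra item enlarges the left part with probability p and the right part otherwise, so
  only one of the two summands changes. The coefficients of the differences therefore add up to 1,
  where those of \<open>a\<close> add up to 2.\<close>

lemma splitting_recurrence_difference:
  fixes a t :: "nat \<Rightarrow> real"
  assumes rec: "\<And>n. a n = (\<Sum>k\<le>n. Bernstein n k p * (a k + a (n - k))) + t n"
  shows "a (Suc n) - a n = (\<Sum>k\<le>n. Bernstein n k p * (p * (a (Suc k) - a k) + (1 - p) * (a (Suc (n - k)) - a (n - k)))) + (t (Suc n) - t n)"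
proof -
  have "(\<Sum>k\<le>Suc n. Bernstein (Suc n) k p * (a k + a (Suc n - k)))
     = (\<Sum>k\<le>n. Bernstein n k p * (p * (a (Suc k) + a (Suc n - Suc k)) + (1 - p) * (a k + a (Suc n - k))))"
    by (rule sum_Bernstein_Suc)
  also have "\<dots> = (\<Sum>k\<le>n. Bernstein n k p * (p * (a (Suc k) - a k) + (1 - p) * (a (Suc (n - k)) - a (n - k))) + Bernstein n k p * (a k + a (n - k)))"
    by (intro sum.cong refl) (simp add: Suc_diff_le algebra_simps)
  also have "\<dots> = (\<Sum>k\<le>n. Bernstein n k p * (p * (a (Suc k) - a k) + (1 - p) * (a (Suc (n - k)) - a (n - k)))) + (a n - t n)"
    using rec[of n] by (simp add: sum.distrib)
  finally show ?thesis using rec[of "Suc n"] by linarith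
qed

text \<open>With total weight 1 and subproblems of mean size below n, the majorant K (n +
  1)^\<gamma> shrinks by the factor \<rho>^\<gamma> < 1 in one step. \<open>K\<close> is the fixed
  point of K \<rho>^\<gamma> + C = K.\<close>

lemma splitting_recurrence_difference_bound:
  fixes a t :: "nat \<Rightarrow> real"
  assumes p: "0 < p" "p < 1" and \<gamma>: "0 < \<gamma>" "\<gamma> \<le> 1"
    and a01: "a 0 = 0" "a 1 = 0"
    and rec: "\<And>n. a n = (\<Sum>k\<le>n. Bernstein n k p * (a k + a (n - k))) + t n"
    and t: "\<And>n. \<bar>t (Suc n) - t n\<bar> \<le> C * real (Suc n) powr \<gamma>"
  shows "\<exists>K\<ge>0. \<forall>n. \<bar>a (Suc n) - a n\<bar> \<le> K * real (Suc n) powr \<gamma>"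
proof -
  define q where "q = 1 - p"
  have q: "0 < q" "q < 1" using p by (auto simp: q_def)
  define d where "d = (\<lambda>n. a (Suc n) - a n)"
  \<comment> \<open>The smallest factor with n max p q + 1 \<le> \<rho> (n + 1) for all n \<ge> 1;
    equality holds at n = 1.\<close>
  define \<rho> where "\<rho> = (1 + max p q) / 2"
  have \<rho>: "0 < \<rho>" "\<rho> < 1" using p q by (auto simp: \<rho>_def max_def)
  have C: "C \<ge> 0" using t[of 0] abs_ge_zero[of "t (Suc 0) - t 0"] by auto
  have \<rho>\<gamma>: "\<rho> powr \<gamma> < 1" using powr_less_mono2[of \<gamma> \<rho> 1] \<rho> \<gamma> by simp
  define K where "K = C / (1 - \<rho> powr \<gamma>)"
  have "K * (1 - \<rho> powr \<gamma>) = C" using \<rho>\<gamma> by (simp add: K_def)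
  hence K: "K \<ge> 0" "K * \<rho> powr \<gamma> + C = K"
    using C \<rho>\<gamma> by (simp add: K_def, simp add: right_diff_distrib)
  define W where "W = (\<lambda>n. K * real (Suc n) powr \<gamma>)"
  have W: "W n \<ge> 0" for n using K by (simp add: W_def)
  have key: "(\<Sum>k\<le>n. Bernstein n k p * (p * W k + q * W (n - k))) + C * real (Suc n) powr \<gamma> \<le> W n" if n: "n \<ge> 1" for n
  proof -
    have bd: "(\<Sum>k\<le>n. Bernstein n k x * real (Suc k) powr \<gamma>) \<le> \<rho> powr \<gamma> * real (Suc n) powr \<gamma>"
      if x: "0 < x" "x \<le> max p q" for x
    proof -
      have "x \<le> 1" using x p q by auto
      have "real n * x + 1 \<le> real n * max p q + 1" using x by (intro add_right_mono mult_left_mono) auto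
      also have "\<dots> \<le> \<rho> * real (Suc n)"
      proof -
        have "0 \<le> (1 - max p q) * (real n - 1)" using n p q by (intro mult_nonneg_nonneg) auto
        thus ?thesis by (simp add: \<rho>_def field_simps)
      qed
      finally have "real n * x + 1 \<le> \<rho> * real (Suc n)" .
      hence "(real n * x + 1) powr \<gamma> \<le> (\<rho> * real (Suc n)) powr \<gamma>"
        using x \<gamma> by (intro powr_mono2) auto
      also have "\<dots> = \<rho> powr \<gamma> * real (Suc n) powr \<gamma>" by (rule powr_mult)
      finally show ?thesis using sum_Bernstein_powr_le[of x \<gamma> n] x \<open>x \<le> 1\<close> \<gamma> by linarith
    qed
    have "(\<Sum>k\<le>n. Bernstein n k p * (p * W k + q * W (n - k))) = p * K * (\<Sum>k\<le>n. Bernstein n k p * real (Suc k) powr \<gamma>)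
        + q * K * (\<Sum>k\<le>n. Bernstein n k p * real (Suc (n - k)) powr \<gamma>)"
      by (simp add: W_def sum_distrib_left sum.distrib[symmetric] algebra_simps)
    also have "(\<Sum>k\<le>n. Bernstein n k p * real (Suc (n - k)) powr \<gamma>) = (\<Sum>k\<le>n. Bernstein n k q * real (Suc k) powr \<gamma>)"
      unfolding q_def by (rule sum_Bernstein_reflect[of n p "\<lambda>k. real (Suc k) powr \<gamma>"])
    also have "p * K * (\<Sum>k\<le>n. Bernstein n k p * real (Suc k) powr \<gamma>) + q * K * (\<Sum>k\<le>n. Bernstein n k q * real (Suc k) powr \<gamma>)
      \<le> p * K * (\<rho> powr \<gamma> * real (Suc n) powr \<gamma>) + q * K * (\<rho> powr \<gamma> * real (Suc n) powr \<gamma>)"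
      using p q K by (intro add_mono mult_left_mono bd) auto
    also have "\<dots> = K * \<rho> powr \<gamma> * real (Suc n) powr \<gamma>" by (simp add: q_def algebra_simps)
    also have "\<dots> + C * real (Suc n) powr \<gamma> = W n" using K(2) by (simp add: W_def distrib_right[symmetric])
    finally show ?thesis by simp
  qed
  have "\<bar>d n\<bar> \<le> W n" for n
  proof (induction n rule: less_induct)
    case (less n)
    show ?case
    proof (cases "n = 0")
      case True
      thus ?thesis using a01 W[of 0] by (simp add: d_def)
    next
      case False
      show ?thesis
      proof (rule ccontr)
        assume "\<not> \<bar>d n\<bar> \<le> W n"
        \<comment> \<open>The difference \<open>d n\<close> also occurs on the right, at k = n and k
          = 0, so the induction hypothesis alone does not bound it. Its excess over
          \<open>W n\<close> satisfies y \<le> (p^(n+1) + q^(n+1)) y, which is impossible for n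
          \<ge> 1. At n = 0 that factor is 1, and the initial values are used instead.\<close>
        define y where "y = \<bar>d n\<bar> - W n"
        have y: "y > 0" using \<open>\<not> \<bar>d n\<bar> \<le> W n\<close> by (simp add: y_def)
        have dk: "\<bar>d k\<bar> \<le> W k + (if k = n then y else 0)" if "k \<le> n" for k
          using less[of k] that by (cases "k = n") (auto simp: y_def)
        have B: "Bernstein n k p \<ge> 0" for k using p by (intro Bernstein_nonneg) auto
        have "\<bar>d n\<bar> = \<bar>(\<Sum>k\<le>n. Bernstein n k p * (p * d k + q * d (n - k))) + (t (Suc n) - t n)\<bar>"
          using splitting_recurrence_difference[OF rec, of n] by (simp add: d_def q_def)
        also have "\<dots> \<le> (\<Sum>k\<le>n. \<bar>Bernstein n k p * (p * d k + q * d (n - k))\<bar>) + C * real (Suc n) powr \<gamma>"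
          by (intro order_trans[OF abs_triangle_ineq] add_mono sum_abs t)
        also have "(\<Sum>k\<le>n. \<bar>Bernstein n k p * (p * d k + q * d (n - k))\<bar>)
           \<le> (\<Sum>k\<le>n. Bernstein n k p * (p * (W k + (if k = n then y else 0)) + q * (W (n - k) + (if k = 0 then y else 0))))"
        proof (rule sum_mono)
          fix k assume k: "k \<in> {..n}"
          have "\<bar>p * d k + q * d (n - k)\<bar> \<le> p * \<bar>d k\<bar> + q * \<bar>d (n - k)\<bar>"
            using p q abs_triangle_ineq[of "p * d k" "q * d (n - k)"] by (simp add: abs_mult)
          also have "\<dots> \<le> p * (W k + (if k = n then y else 0)) + q * (W (n - k) + (if n - k = n then y else 0))"
            using k p q by (intro add_mono mult_left_mono dk) auto
          also have "(n - k = n) = (k = 0)" using k False by auto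
          finally show "\<bar>Bernstein n k p * (p * d k + q * d (n - k))\<bar> \<le> Bernstein n k p * (p * (W k + (if k = n then y else 0)) + q * (W (n - k) + (if k = 0 then y else 0)))"
            using B[of k] by (simp only: abs_mult abs_of_nonneg mult_left_mono)
        qed
        also have "(\<Sum>k\<le>n. Bernstein n k p * (p * (W k + (if k = n then y else 0)) + q * (W (n - k) + (if k = 0 then y else 0))))
           = (\<Sum>k\<le>n. Bernstein n k p * (p * W k + q * W (n - k))) + (\<Sum>k\<le>n. if k = n then p * p ^ n * y else 0) + (\<Sum>k\<le>n. if k = 0 then q * q ^ n * y else 0)"
          unfolding sum.distrib[symmetric]
          by (intro sum.cong refl) (auto simp: Bernstein_def q_def algebra_simps)
        also have "\<dots> = (\<Sum>k\<le>n. Bernstein n k p * (p * W k + q * W (n - k))) + (p ^ Suc n + q ^ Suc n) * y"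
          by (simp add: algebra_simps)
        finally have "\<bar>d n\<bar> \<le> W n + (p ^ Suc n + q ^ Suc n) * y" using key[of n] False by simp
        moreover have "p ^ Suc n + q ^ Suc n < 1"
        proof -
          have "p ^ Suc n < p * 1" "q ^ Suc n < q * 1" unfolding power_Suc using p q False
            by (intro mult_strict_left_mono; simp add: power_less_one_iff)+
          thus ?thesis by (simp add: q_def)
        qed
        hence "(p ^ Suc n + q ^ Suc n) * y < 1 * y" using y by (intro mult_strict_right_mono)
        ultimately show False by (simp add: y_def)
      qed
    qed
  qed
  thus ?thesis using K by (auto simp: d_def W_def)
qed

section \<open>De-Poissonization and the functional equation\<close>

lemma increment_powr_bound:
  fixes a :: "nat \<Rightarrow> real"
  assumes \<gamma>: "0 \<le> \<gamma>" and K: "K \<ge> 0" and d: "\<And>n. \<bar>a (Suc n) - a n\<bar> \<le> K * real (Suc n) powr \<gamma>"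
  shows "\<bar>a m - a n\<bar> \<le> K * \<bar>real m - real n\<bar> * real (m + n + 1) powr \<gamma>"
proof -
  have *: "\<bar>a (n + j) - a n\<bar> \<le> K * real j * real (n + j + n + 1) powr \<gamma>" for n j
  proof -
    have "a (n + j) - a n = (\<Sum>i<j. a (Suc (n + i)) - a (n + i))"
      by (induction j) simp_all
    hence "\<bar>a (n + j) - a n\<bar> = \<bar>\<Sum>i<j. a (Suc (n + i)) - a (n + i)\<bar>" by (simp only:)
    also have "\<dots> \<le> (\<Sum>i<j. \<bar>a (Suc (n + i)) - a (n + i)\<bar>)" by (rule sum_abs)
    also have "\<dots> \<le> (\<Sum>i<j. K * real (n + j + n + 1) powr \<gamma>)"
    proof (rule sum_mono)
      fix i assume "i \<in> {..<j}"
      hence "real (Suc (n + i)) powr \<gamma> \<le> real (n + j + n + 1) powr \<gamma>" using \<gamma> by (intro powr_mono2) auto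
      thus "\<bar>a (Suc (n + i)) - a (n + i)\<bar> \<le> K * real (n + j + n + 1) powr \<gamma>"
        using d[of "n + i"] K mult_left_mono by (meson order_trans)
    qed
    finally show ?thesis by (simp add: mult_ac)
  qed
  show ?thesis
  proof (cases "n \<le> m")
    case True
    then obtain j where "m = n + j" using le_Suc_ex by blast
    thus ?thesis using *[of n j] by simp
  next
    case False
    then obtain j where "n = m + j" using le_Suc_ex by (metis nat_le_linear)
    thus ?thesis using *[of m j] by (simp add: abs_minus_commute add_ac)
  qed
qed

lemma Poisson_moments:
  fixes x :: real
  shows "(\<lambda>m. exp (- x) * (x ^ m / fact m)) sums 1"
    and "(\<lambda>m. exp (- x) * (x ^ m / fact m) * (real m - x)\<^sup>2) sums x"
proof -
  have s0: "(\<lambda>m. x ^ m / fact m) sums exp x"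
    using exp_converges[of x] by (simp add: divide_inverse mult.commute)
  have s1: "(\<lambda>m. real m * (x ^ m / fact m)) sums (x * exp x)"
  proof -
    have "(\<lambda>m. real (Suc m) * (x ^ Suc m / fact (Suc m))) = (\<lambda>m. x * (x ^ m / fact m))"
      by (intro ext) (simp add: fact_Suc del: of_nat_Suc)
    with sums_mult[OF s0, of x] have "(\<lambda>m. real (Suc m) * (x ^ Suc m / fact (Suc m))) sums (x * exp x)" by simp
    from sums_Suc[OF this] show ?thesis by simp
  qed
  have s2: "(\<lambda>m. real m * real m * (x ^ m / fact m)) sums (x * (x * exp x + exp x))"
  proof -
    have "(\<lambda>m. real (Suc m) * real (Suc m) * (x ^ Suc m / fact (Suc m))) = (\<lambda>m. x * (real m * (x ^ m / fact m) + x ^ m / fact m))"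
    proof (intro ext)
      fix m
      have "real (Suc m) * real (Suc m) * (x ^ Suc m / fact (Suc m)) = real (Suc m) * (x * (x ^ m / fact m))"
        by (simp add: fact_Suc del: of_nat_Suc)
      also have "real (Suc m) * (x * y) = x * (real m * y + y)" for y by (simp add: algebra_simps)
      finally show "real (Suc m) * real (Suc m) * (x ^ Suc m / fact (Suc m)) = x * (real m * (x ^ m / fact m) + x ^ m / fact m)" .
    qed
    with sums_mult[OF sums_add[OF s1 s0], of x]
    have "(\<lambda>m. real (Suc m) * real (Suc m) * (x ^ Suc m / fact (Suc m))) sums (x * (x * exp x + exp x))" by simp
    from sums_Suc[OF this] show ?thesis by simp
  qed
  have e: "exp (- x) * exp x = 1" by (simp flip: exp_add)
  show "(\<lambda>m. exp (- x) * (x ^ m / fact m)) sums 1" using sums_mult[OF s0, of "exp (- x)"] e by simp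
  have "(\<lambda>m. exp (- x) * (real m * real m * (x ^ m / fact m) - 2 * x * (real m * (x ^ m / fact m)) + x\<^sup>2 * (x ^ m / fact m)))
     sums (exp (- x) * (x * (x * exp x + exp x) - 2 * x * (x * exp x) + x\<^sup>2 * exp x))"
    by (intro sums_mult sums_add sums_diff s0 s1 s2)
  moreover have "exp (- x) * (x * (x * exp x + exp x) - 2 * x * (x * exp x) + x\<^sup>2 * exp x) = (exp (- x) * exp x) * x"
    by (simp add: algebra_simps power2_eq_square)
  moreover have "exp (- x) * (real m * real m * (x ^ m / fact m) - 2 * x * (real m * (x ^ m / fact m)) + x\<^sup>2 * (x ^ m / fact m))
      = exp (- x) * (x ^ m / fact m) * (real m - x)\<^sup>2" for m
  proof -
    have "w * (M * M * y - 2 * x * (M * y) + x\<^sup>2 * y) = w * y * (M - x)\<^sup>2" for w y M :: real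
      by (simp add: power2_eq_square algebra_simps)
    thus ?thesis .
  qed
  ultimately show "(\<lambda>m. exp (- x) * (x ^ m / fact m) * (real m - x)\<^sup>2) sums x" by (simp only: e mult_1)
qed

text \<open>The value at n of the Poisson generating function is the mean of a m under a Poisson law
  with mean n. The difference bound reduces a m - a n to |m - n| times about n^\<gamma>, and |m - n|
  is of order n^(1/2) on average. The error n^(\<gamma> + 1/2) is o(n) since \<gamma> < 1/2.\<close>

lemma depoissonization:
  fixes a :: "nat \<Rightarrow> real"
  assumes \<gamma>: "0 \<le> \<gamma>" "\<gamma> < 1 / 2" and K: "K \<ge> 0" and d: "\<And>n. \<bar>a (Suc n) - a n\<bar> \<le> K * real (Suc n) powr \<gamma>"
    and conv: "\<And>z::complex. summable (\<lambda>n. of_real (a n) * z ^ n / fact n)"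
  shows "(\<lambda>n. (of_real (a n) - poisson_gf a (of_nat n)) / of_nat n) \<longlonglongrightarrow> 0"
proof -
  have bound: "norm (of_real (a n) - poisson_gf a (of_nat n)) \<le> K * (2 * real n + 1) powr \<gamma> * (sqrt (real n) + 1)"
    if n: "n \<ge> 1" for n
  proof -
    define x where "x = real n"
    have x: "x > 0" using n by (simp add: x_def)
    define P where "P = (\<lambda>m. exp (- x) * (x ^ m / fact m))"
    have P: "P m \<ge> 0" for m using x by (simp add: P_def)
    have P1: "P sums 1" and P2: "(\<lambda>m. P m * (real m - x)\<^sup>2) sums x"
      using Poisson_moments[of x] by (simp_all add: P_def)
    have "(\<lambda>m. exp (- of_nat n :: complex) * (of_real (a m) * of_nat n ^ m / fact m)) sums poisson_gf a (of_nat n)"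
      unfolding poisson_gf_def by (intro sums_mult summable_sums conv)
    moreover have "exp (- of_nat n :: complex) * (of_real (a m) * of_nat n ^ m / fact m) = of_real (P m * a m)" for m
      by (simp add: P_def x_def exp_of_real[symmetric] exp_minus)
    ultimately have "(\<lambda>m. complex_of_real (P m * a m)) sums poisson_gf a (of_nat n)" by simp
    moreover have "(\<lambda>m. complex_of_real (P m * a n)) sums of_real (1 * a n)"
      by (intro sums_of_real sums_mult2 P1)
    ultimately have S: "(\<lambda>m. complex_of_real (P m * a n) - of_real (P m * a m)) sums (of_real (1 * a n) - poisson_gf a (of_nat n))"
      by (rule sums_diff[rotated])
    define g where "g = (\<lambda>m. K * (2 * x + 1) powr \<gamma> * ((sqrt x / 2) * P m + (1 / (2 * sqrt x) + 1 / (2 * x + 1)) * (P m * (real m - x)\<^sup>2)))"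
    have gs: "g sums (K * (2 * x + 1) powr \<gamma> * ((sqrt x / 2) * 1 + (1 / (2 * sqrt x) + 1 / (2 * x + 1)) * x))"
      unfolding g_def by (intro sums_mult sums_add P1 P2)
    have le: "norm (complex_of_real (P m * a n) - of_real (P m * a m)) \<le> g m" for m
    proof -
      define D where "D = \<bar>real m - x\<bar>"
      have D: "D \<ge> 0" "D\<^sup>2 = (real m - x)\<^sup>2" by (simp_all add: D_def)
      have 1: "\<bar>a n - a m\<bar> \<le> K * D * real (n + m + 1) powr \<gamma>"
        using increment_powr_bound[OF \<gamma>(1) K d, of n m] by (simp add: D_def x_def abs_minus_commute)
      \<comment> \<open>Factoring out 2 x + 1 leaves a base of at least 1, whose exponent may be
        raised from \<gamma> to 1. The estimate becomes quadratic in D, so the variance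
        suffices.\<close>
      have "(2 * x + 1) * (1 + D / (2 * x + 1)) = 2 * x + 1 + D" using x by (simp add: distrib_left)
      hence "real (n + m + 1) \<le> (2 * x + 1) * (1 + D / (2 * x + 1))" by (simp add: D_def x_def)
      hence "real (n + m + 1) powr \<gamma> \<le> ((2 * x + 1) * (1 + D / (2 * x + 1))) powr \<gamma>"
        using \<gamma> by (intro powr_mono2) auto
      also have "\<dots> = (2 * x + 1) powr \<gamma> * (1 + D / (2 * x + 1)) powr \<gamma>" by (rule powr_mult)
      also have "\<dots> \<le> (2 * x + 1) powr \<gamma> * (1 + D / (2 * x + 1)) powr 1"
        using x D \<gamma> by (intro mult_left_mono powr_mono) auto
      finally have 2: "real (n + m + 1) powr \<gamma> \<le> (2 * x + 1) powr \<gamma> * (1 + D / (2 * x + 1))" using x D by simp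
      \<comment> \<open>The arithmetic-geometric mean inequality at the scale of the standard
        deviation sqrt x replaces the first absolute moment by the second.\<close>
      have 3: "D \<le> sqrt x / 2 + 1 / (2 * sqrt x) * D\<^sup>2"
      proof -
        have "0 \<le> (sqrt x - D)\<^sup>2 / (2 * sqrt x)" using x by simp
        also have "\<dots> = sqrt x / 2 + 1 / (2 * sqrt x) * D\<^sup>2 - D" using x by (simp add: power2_diff field_simps power2_eq_square)
        finally show ?thesis by simp
      qed
      have "norm (complex_of_real (P m * a n) - of_real (P m * a m)) = P m * \<bar>a n - a m\<bar>"
        using P[of m] by (simp only: of_real_diff[symmetric] right_diff_distrib[symmetric] norm_of_real abs_mult abs_of_nonneg)
      also have "\<dots> \<le> P m * (K * D * ((2 * x + 1) powr \<gamma> * (1 + D / (2 * x + 1))))"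
        using P[of m] 1 2 K D mult_left_mono[OF 2, of "K * D"] by (intro mult_left_mono) auto
      also have "\<dots> = K * (2 * x + 1) powr \<gamma> * P m * (D + 1 / (2 * x + 1) * D\<^sup>2)" by (simp add: algebra_simps power2_eq_square)
      also have "\<dots> \<le> K * (2 * x + 1) powr \<gamma> * P m * (sqrt x / 2 + 1 / (2 * sqrt x) * D\<^sup>2 + 1 / (2 * x + 1) * D\<^sup>2)"
        using 3 K P[of m] by (intro mult_left_mono) auto
      also have "\<dots> = g m" unfolding g_def D(2)[symmetric] by (simp add: algebra_simps)
      finally show ?thesis .
    qed
    have "norm (\<Sum>m. complex_of_real (P m * a n) - of_real (P m * a m)) \<le> suminf g"
      using le sums_summable[OF gs] by (rule norm_suminf_le)
    hence "norm (of_real (a n) - poisson_gf a (of_nat n)) \<le> K * (2 * x + 1) powr \<gamma> * ((sqrt x / 2) * 1 + (1 / (2 * sqrt x) + 1 / (2 * x + 1)) * x)"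
      using sums_unique[OF S] sums_unique[OF gs] by simp
    also have "\<dots> \<le> K * (2 * x + 1) powr \<gamma> * (sqrt x + 1)"
    proof -
      have "x / sqrt x = sqrt x" using x by (simp add: real_div_sqrt)
      moreover have "x / (2 * x + 1) \<le> 1" using x by simp
      ultimately have "(sqrt x / 2) * 1 + (1 / (2 * sqrt x) + 1 / (2 * x + 1)) * x \<le> sqrt x + 1"
        by (simp add: distrib_right)
      thus ?thesis using K by (intro mult_left_mono) auto
    qed
    finally show ?thesis by (simp add: x_def)
  qed
  show ?thesis
  proof (rule Lim_null_comparison)
    show "eventually (\<lambda>n. norm ((of_real (a n) - poisson_gf a (of_nat n)) / of_nat n) \<le> K * ((2 * real n + 1) powr \<gamma> * (sqrt (real n) + 1) / real n)) sequentially"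
      using eventually_ge_at_top[of 1]
    proof eventually_elim
      case (elim n)
      from divide_right_mono[OF bound[OF elim], of "real n"] show ?case by (simp add: norm_divide mult.assoc)
    qed
    have "(\<lambda>n. (2 * real n + 1) powr \<gamma> * (sqrt (real n) + 1) / real n) \<longlonglongrightarrow> 0"
      using \<gamma> by real_asymp
    from tendsto_mult_left[OF this, of K]
    show "(\<lambda>n. K * ((2 * real n + 1) powr \<gamma> * (sqrt (real n) + 1) / real n)) \<longlonglongrightarrow> 0" by simp
  qed
qed

text \<open>Poisson thinning: binomial averaging is the convolution of exponential series with exp
  ((1 - p) z) = exp z exp (- p z), and the last factor completes the Poisson generating function at
  p z.\<close>

lemma Poisson_series_Bernstein:
  fixes a :: "nat \<Rightarrow> real" and z :: complex
  assumes conv: "\<And>z::complex. summable (\<lambda>n. norm (of_real (a n) * z ^ n / fact n))"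
  shows "(\<lambda>n. of_real (\<Sum>k\<le>n. Bernstein n k p * a k) * z ^ n / fact n) sums (exp z * poisson_gf a (of_real p * z))"
proof -
  define u where "u = (\<lambda>k. of_real (a k) * (of_real p * z) ^ k / fact k)"
  define v where "v = (\<lambda>k. (of_real (1 - p) * z) ^ k / fact k)"
  have v: "v sums exp (of_real (1 - p) * z)"
    using exp_converges[of "of_real (1 - p) * z"] by (simp add: v_def scaleR_conv_of_real divide_inverse mult.commute)
  have nv: "summable (\<lambda>k. norm (v k))"
    using summable_norm_exp[of "of_real (1 - p) * z"] by (simp add: v_def divide_inverse scaleR_conv_of_real norm_mult norm_inverse mult.commute)
  have "(\<lambda>n. \<Sum>k\<le>n. u k * v (n - k)) sums ((\<Sum>k. u k) * (\<Sum>k. v k))"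
    by (rule Cauchy_product_sums[OF _ nv]) (use conv in \<open>simp add: u_def\<close>)
  moreover have "(\<Sum>k\<le>n. u k * v (n - k)) = of_real (\<Sum>k\<le>n. Bernstein n k p * a k) * z ^ n / fact n" for n
  proof -
    have "u k * v (n - k) = of_real (Bernstein n k p * a k) * z ^ n / fact n" if "k \<le> n" for k
    proof -
      have "z ^ n = z ^ k * z ^ (n - k)" using that by (simp flip: power_add)
      moreover have "of_nat (n choose k) / fact n = (1 / (fact k * fact (n - k)) :: complex)"
        using that by (simp add: binomial_fact)
      hence "of_real (Bernstein n k p) / fact n = (of_real p ^ k * of_real (1 - p) ^ (n - k) / (fact k * fact (n - k)) :: complex)"
        by (simp add: Bernstein_def field_simps)
      ultimately show ?thesis
        by (simp add: u_def v_def power_mult_distrib) (simp add: field_simps)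
    qed
    thus ?thesis by (simp add: sum_distrib_right sum_divide_distrib)
  qed
  moreover have "(\<Sum>k. u k) * (\<Sum>k. v k) = exp z * poisson_gf a (of_real p * z)"
  proof -
    have "exp (of_real (1 - p) * z) = exp z * exp (- (of_real p * z))" by (simp add: algebra_simps flip: exp_add)
    thus ?thesis using sums_unique[OF v] by (simp add: poisson_gf_def u_def)
  qed
  ultimately show ?thesis by simp
qed

lemma poisson_gf_functional_equation:
  fixes a t :: "nat \<Rightarrow> real" and z :: complex
  assumes conv: "\<And>z::complex. summable (\<lambda>n. norm (of_real (a n) * z ^ n / fact n))"
    and conv_t: "\<And>z::complex. summable (\<lambda>n. of_real (t n) * z ^ n / fact n)"
    and rec: "\<And>n. a n = (\<Sum>k\<le>n. Bernstein n k p * (a k + a (n - k))) + t n"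
  shows "poisson_gf a z = poisson_gf a (of_real p * z) + poisson_gf a (of_real (1 - p) * z) + poisson_gf t z"
proof -
  have e: "exp (- z) * exp z = 1" by (simp flip: exp_add)
  have "(\<lambda>n. of_real (\<Sum>k\<le>n. Bernstein n k p * a k) * z ^ n / fact n + of_real (\<Sum>k\<le>n. Bernstein n k (1 - p) * a k) * z ^ n / fact n + of_real (t n) * z ^ n / fact n)
    sums (exp z * poisson_gf a (of_real p * z) + exp z * poisson_gf a (of_real (1 - p) * z) + (\<Sum>n. of_real (t n) * z ^ n / fact n))"
    by (intro sums_add Poisson_series_Bernstein conv summable_sums conv_t)
  moreover have "of_real (\<Sum>k\<le>n. Bernstein n k p * a k) * z ^ n / fact n + of_real (\<Sum>k\<le>n. Bernstein n k (1 - p) * a k) * z ^ n / fact n + of_real (t n) * z ^ n / fact n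
     = of_real (a n) * z ^ n / fact n" for n
  proof -
    have "a n = (\<Sum>k\<le>n. Bernstein n k p * a k) + (\<Sum>k\<le>n. Bernstein n k (1 - p) * a k) + t n"
      using rec[of n] sum_Bernstein_reflect[of n p a] by (simp add: distrib_left sum.distrib)
    hence "(of_real (a n) :: complex) = of_real (\<Sum>k\<le>n. Bernstein n k p * a k) + of_real (\<Sum>k\<le>n. Bernstein n k (1 - p) * a k) + of_real (t n)"
      by (metis of_real_add)
    thus ?thesis by (simp only: distrib_right add_divide_distrib)
  qed
  ultimately have "(\<Sum>n. of_real (a n) * z ^ n / fact n) = exp z * poisson_gf a (of_real p * z) + exp z * poisson_gf a (of_real (1 - p) * z) + (\<Sum>n. of_real (t n) * z ^ n / fact n)"
    by (simp add: sums_iff)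
  hence "poisson_gf a z = (exp (- z) * exp z) * poisson_gf a (of_real p * z) + (exp (- z) * exp z) * poisson_gf a (of_real (1 - p) * z) + poisson_gf t z"
    unfolding poisson_gf_def[of a z] poisson_gf_def[of t z] by (simp only: distrib_left mult.assoc)
  thus ?thesis by (simp add: e)
qed

section \<open>Expectation of the splitting process\<close>

context prob_space
begin

text \<open>Events of a single coordinate belong to the algebra generated by the whole sequence.
  \<open>J\<close> is cast to \<open>real\<close> because \<open>indep_var\<close> needs both
  variables in one type.\<close>

lemma indep_quadrupleD:
  assumes ind: "indep_quadruple M X X' J T"
    and X: "\<And>n. X n \<in> borel_measurable M" and X': "\<And>n. X' n \<in> borel_measurable M"
    and J: "J \<in> measurable M (count_space UNIV)"
  shows "indep_var borel (X k) borel (\<lambda>\<omega>. real (J \<omega>))" "indep_var borel (X' k) borel (\<lambda>\<omega>. real (J \<omega>))"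
proof -
  define F where "F = (\<lambda>j. [sets (vimage_algebra (space M) (\<lambda>\<omega> k. X k \<omega>) seq_algebra),
            sets (vimage_algebra (space M) (\<lambda>\<omega> k. X' k \<omega>) seq_algebra),
            sets (vimage_algebra (space M) J (count_space UNIV)),
            sets (vimage_algebra (space M) T borel)] ! j)"
  have F: "indep_sets F {..<4::nat}" using ind unfolding indep_quadruple_def F_def .
  have sub: "sigma_sets (space M) {Y k -` A \<inter> space M |A. A \<in> sets borel} \<subseteq> sets (vimage_algebra (space M) (\<lambda>\<omega> k. Y k \<omega>) seq_algebra)"
    for Y :: "nat \<Rightarrow> 'a \<Rightarrow> real" and k
  proof -
    have "{Y k -` A \<inter> space M |A. A \<in> sets borel} \<subseteq> sets (vimage_algebra (space M) (\<lambda>\<omega> k. Y k \<omega>) seq_algebra)"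
    proof safe
      fix A :: "real set" assume A: "A \<in> sets borel"
      have "(\<lambda>f. f k) -` A \<inter> space seq_algebra \<in> sets seq_algebra"
        by (rule measurable_sets[OF _ A]) (rule measurable_component_singleton, simp)
      from in_vimage_algebra[OF this, of "\<lambda>\<omega> k. Y k \<omega>" "space M"]
      have "(\<lambda>\<omega> k. Y k \<omega>) -` ((\<lambda>f. f k) -` A \<inter> space seq_algebra) \<inter> space M \<in> sets (vimage_algebra (space M) (\<lambda>\<omega> k. Y k \<omega>) seq_algebra)" .
      also have "(\<lambda>\<omega> k. Y k \<omega>) -` ((\<lambda>f. f k) -` A \<inter> space seq_algebra) \<inter> space M = Y k -` A \<inter> space M"
        by (auto simp: space_PiM PiE_def)
      finally show "Y k -` A \<inter> space M \<in> sets (vimage_algebra (space M) (\<lambda>\<omega> k. Y k \<omega>) seq_algebra)" .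
    qed
    from sets.sigma_sets_subset[OF this] show ?thesis by simp
  qed
  have subJ: "sigma_sets (space M) {(\<lambda>\<omega>. real (J \<omega>)) -` A \<inter> space M |A. A \<in> sets borel} \<subseteq> sets (vimage_algebra (space M) J (count_space UNIV))"
  proof -
    have "{(\<lambda>\<omega>. real (J \<omega>)) -` A \<inter> space M |A. A \<in> sets borel} \<subseteq> sets (vimage_algebra (space M) J (count_space UNIV))"
    proof safe
      fix A :: "real set" assume "A \<in> sets borel"
      have "J -` (real -` A) \<inter> space M \<in> sets (vimage_algebra (space M) J (count_space UNIV))"
        by (rule in_vimage_algebra) simp
      thus "(\<lambda>\<omega>. real (J \<omega>)) -` A \<inter> space M \<in> sets (vimage_algebra (space M) J (count_space UNIV))"
        by (simp add: vimage_def)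
    qed
    from sets.sigma_sets_subset[OF this] show ?thesis by simp
  qed
  have main: "indep_var borel (Y k) borel (\<lambda>\<omega>. real (J \<omega>))"
    if Y: "\<And>n. Y n \<in> borel_measurable M" and i: "i < 2" "F i = sets (vimage_algebra (space M) (\<lambda>\<omega> k. Y k \<omega>) seq_algebra)"
    for Y k i
  proof -
    have Fe: "F j \<subseteq> events" if "j < 4" for j using F that unfolding indep_sets_def by auto
    have F2: "F 2 = sets (vimage_algebra (space M) J (count_space UNIV))" by (simp add: F_def)
    have "indep_set (sigma_sets (space M) {Y k -` A \<inter> space M |A. A \<in> sets borel})
        (sigma_sets (space M) {(\<lambda>\<omega>. real (J \<omega>)) -` A \<inter> space M |A. A \<in> sets borel})"
    proof (rule indep_setI)
      show "sigma_sets (space M) {Y k -` A \<inter> space M |A. A \<in> sets borel} \<subseteq> events"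
        using sub[of Y k] Fe[of i] i by auto
      show "sigma_sets (space M) {(\<lambda>\<omega>. real (J \<omega>)) -` A \<inter> space M |A. A \<in> sets borel} \<subseteq> events"
        using subJ Fe[of 2] F2 by auto
      fix a b assume a: "a \<in> sigma_sets (space M) {Y k -` A \<inter> space M |A. A \<in> sets borel}"
        and b: "b \<in> sigma_sets (space M) {(\<lambda>\<omega>. real (J \<omega>)) -` A \<inter> space M |A. A \<in> sets borel}"
      have "prob (\<Inter>j\<in>{i, 2}. (if j = i then a else b)) = (\<Prod>j\<in>{i, 2}. prob (if j = i then a else b))"
        by (rule indep_setsD[OF F]) (use a b sub[of Y k] subJ i F2 in auto)
      thus "prob (a \<inter> b) = prob a * prob b" using i by (auto simp: Int_commute)
    qed
    thus ?thesis unfolding indep_var_eq using Y J by auto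
  qed
  show "indep_var borel (X k) borel (\<lambda>\<omega>. real (J \<omega>))" by (rule main[OF X, of 0]) (auto simp: F_def)
  show "indep_var borel (X' k) borel (\<lambda>\<omega>. real (J \<omega>))" by (rule main[OF X', of 1]) (auto simp: F_def)
qed

text \<open>Almost surely the random index is one of 0, ..., n, so the variable is the finite sum of
  Y k over the events J = k. On each of them independence factors the expectation.\<close>

lemma integral_random_index:
  fixes Y :: "nat \<Rightarrow> 'a \<Rightarrow> real"
  assumes J: "J \<in> measurable M (count_space UNIV)" and bin: "distr M (count_space UNIV) J = measure_pmf (binomial_pmf n p)"
    and p: "0 \<le> p" "p \<le> 1"
    and Y: "\<And>k. Y k \<in> borel_measurable M" and int: "\<And>k. k \<le> n \<Longrightarrow> integrable M (Y k)"
    and ind: "\<And>k. indep_var borel (Y k) borel (\<lambda>\<omega>. real (J \<omega>))"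
  shows "integrable M (\<lambda>\<omega>. Y (J \<omega>) \<omega>)"
    and "integral\<^sup>L M (\<lambda>\<omega>. Y (J \<omega>) \<omega>) = (\<Sum>k\<le>n. Bernstein n k p * integral\<^sup>L M (Y k))"
proof -
  have meas: "(\<lambda>\<omega>. Y (J \<omega>) \<omega>) \<in> borel_measurable M"
    by (rule measurable_compose_countable[OF Y J])
  have "AE k in distr M (count_space UNIV) J. k \<le> n"
    unfolding bin by (auto simp: AE_measure_pmf_iff set_pmf_binomial_eq p split: if_splits)
  hence J_le: "AE \<omega> in M. J \<omega> \<le> n" by (subst (asm) AE_distr_iff[OF J]) auto
  have eq: "AE \<omega> in M. Y (J \<omega>) \<omega> = (\<Sum>k\<le>n. Y k \<omega> * indicator {k} (J \<omega>))"
    using J_le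
  proof eventually_elim
    case (elim \<omega>)
    have "(\<Sum>k\<le>n. Y k \<omega> * indicator {k} (J \<omega>)) = (\<Sum>k\<le>n. if k = J \<omega> then Y k \<omega> else 0)"
      by (intro sum.cong) (auto simp: indicator_def)
    thus ?case using elim by simp
  qed
  have ind': "indep_var borel (Y k) borel (\<lambda>\<omega>. indicator {k} (J \<omega>) :: real)" for k
  proof -
    have "indep_var borel ((\<lambda>x. x) \<circ> Y k) borel ((indicator {real k} :: real \<Rightarrow> real) \<circ> (\<lambda>\<omega>. real (J \<omega>)))"
      by (rule indep_var_compose[OF ind]) auto
    moreover have "indicator {real k} (real (J \<omega>)) = (indicator {k} (J \<omega>) :: real)" for \<omega>
      by (simp add: indicator_def)
    ultimately show ?thesis by (simp only: o_def)
  qed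
  have intJ: "integrable M (\<lambda>\<omega>. indicator {k} (J \<omega>) :: real)" for k
  proof (rule integrable_const_bound[where B = 1])
    show "(\<lambda>\<omega>. indicator {k} (J \<omega>) :: real) \<in> borel_measurable M"
      using measurable_compose[OF J, of "indicator {k}" borel] by simp
  qed (auto simp: indicator_def)
  have EJ: "integral\<^sup>L M (\<lambda>\<omega>. indicator {k} (J \<omega>) :: real) = Bernstein n k p" for k
  proof -
    have "integral\<^sup>L M (\<lambda>\<omega>. indicator {k} (J \<omega>) :: real) = integral\<^sup>L (distr M (count_space UNIV) J) (indicator {k})"
      by (subst integral_distr[OF J]) auto
    also have "\<dots> = pmf (binomial_pmf n p) k" unfolding bin by (simp add: pmf.rep_eq)
    finally show ?thesis using p by (simp add: Bernstein_def)
  qed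
  have prod: "integrable M (\<lambda>\<omega>. Y k \<omega> * indicator {k} (J \<omega>))"
    "integral\<^sup>L M (\<lambda>\<omega>. Y k \<omega> * indicator {k} (J \<omega>)) = Bernstein n k p * integral\<^sup>L M (Y k)" if "k \<le> n" for k
    using indep_var_integrable[OF ind'[of k] int[OF that] intJ] indep_var_lebesgue_integral[OF ind'[of k] int[OF that] intJ] EJ[of k]
    by (simp_all add: mult.commute)
  have int_sum: "integrable M (\<lambda>\<omega>. \<Sum>k\<le>n. Y k \<omega> * indicator {k} (J \<omega>))"
    by (intro Bochner_Integration.integrable_sum prod) auto
  show "integrable M (\<lambda>\<omega>. Y (J \<omega>) \<omega>)"
    using int_sum by (subst integrable_cong_AE[OF meas _ eq]) auto
  have "integral\<^sup>L M (\<lambda>\<omega>. Y (J \<omega>) \<omega>) = integral\<^sup>L M (\<lambda>\<omega>. \<Sum>k\<le>n. Y k \<omega> * indicator {k} (J \<omega>))"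
    by (rule integral_cong_AE[OF meas _ eq]) (use int_sum in auto)
  also have "\<dots> = (\<Sum>k\<le>n. Bernstein n k p * integral\<^sup>L M (Y k))"
    by (subst Bochner_Integration.integral_sum) (auto intro!: prod simp: prod)
  finally show "integral\<^sup>L M (\<lambda>\<omega>. Y (J \<omega>) \<omega>) = (\<Sum>k\<le>n. Bernstein n k p * integral\<^sup>L M (Y k))" .
qed

text \<open>Monotone convergence. It serves to obtain integrability from a recurrence in which the
  unknown absolute mean occurs on both sides: a truncated mean is always finite and can be moved
  across.\<close>

lemma integrable_of_bounded_truncations:
  fixes Y :: "'a \<Rightarrow> real"
  assumes Y: "Y \<in> borel_measurable M" and bd: "\<And>m::nat. integral\<^sup>L M (\<lambda>\<omega>. min \<bar>Y \<omega>\<bar> (real m)) \<le> C"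
  shows "integrable M Y"
proof -
  have int: "integrable M (\<lambda>\<omega>. min \<bar>Y \<omega>\<bar> (real m))" for m
    by (rule integrable_const_bound[where B = "real m"]) (use Y in auto)
  have mono: "integral\<^sup>L M (\<lambda>\<omega>. min \<bar>Y \<omega>\<bar> (real m)) \<le> integral\<^sup>L M (\<lambda>\<omega>. min \<bar>Y \<omega>\<bar> (real k))" if "m \<le> k" for m k
    by (rule integral_mono[OF int int]) (use that in auto)
  obtain x where x: "(\<lambda>m. integral\<^sup>L M (\<lambda>\<omega>. min \<bar>Y \<omega>\<bar> (real m))) \<longlonglongrightarrow> x"
    by (rule incseq_convergent[of "\<lambda>m. integral\<^sup>L M (\<lambda>\<omega>. min \<bar>Y \<omega>\<bar> (real m))" C])
       (use mono bd in \<open>auto simp: incseq_def\<close>)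
  have "integrable M (\<lambda>\<omega>. \<bar>Y \<omega>\<bar>)"
  proof (rule integral_monotone_convergence_nonneg(1)[OF int _ _ _ x])
    show "AE \<omega> in M. mono (\<lambda>m. min \<bar>Y \<omega>\<bar> (real m))" by (auto simp: mono_def)
    show "AE \<omega> in M. (\<lambda>m. min \<bar>Y \<omega>\<bar> (real m)) \<longlonglongrightarrow> \<bar>Y \<omega>\<bar>"
    proof (rule AE_I2, rule tendsto_eventually)
      fix \<omega>
      obtain N :: nat where "\<bar>Y \<omega>\<bar> \<le> real N" using real_arch_simple by blast
      thus "eventually (\<lambda>m. min \<bar>Y \<omega>\<bar> (real m) = \<bar>Y \<omega>\<bar>) sequentially"
        by (intro eventually_sequentiallyI[of N] min_absorb1) (simp add: order_trans)
    qed
  qed (use Y in \<open>auto simp: borel_measurable_abs\<close>)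
  thus ?thesis using Y by (simp add: integrable_abs_iff)
qed

text \<open>The hypotheses make only the tolls \<open>T n\<close> integrable; integrability of
  \<open>X n\<close> is derived first, by strong induction. The identity for \<open>a n\<close> has
  \<open>a n\<close> on its right-hand side too, since all items may fall to one side.\<close>

lemma splitting_recurrence_expectation:
  fixes X X' T :: "nat \<Rightarrow> 'a \<Rightarrow> real" and J :: "nat \<Rightarrow> 'a \<Rightarrow> nat"
  assumes p: "0 < p" "p < 1"
    and X_rv: "\<And>n. X n \<in> borel_measurable M"
    and X'_rv: "\<And>n. X' n \<in> borel_measurable M"
    and J_rv: "\<And>n. n \<ge> 2 \<Longrightarrow> J n \<in> measurable M (count_space UNIV)"
    and T_int: "\<And>n. n \<ge> 2 \<Longrightarrow> integrable M (T n)"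
    and X0: "AE \<omega> in M. X 0 \<omega> = 0" and X1: "AE \<omega> in M. X 1 \<omega> = 0"
    and copy: "distr M seq_algebra (\<lambda>\<omega> k. X' k \<omega>) = distr M seq_algebra (\<lambda>\<omega> k. X k \<omega>)"
    and J_binom: "\<And>n. n \<ge> 2 \<Longrightarrow>
          distr M (count_space UNIV) (J n) = measure_pmf (binomial_pmf n p)"
    and indep: "\<And>n. n \<ge> 2 \<Longrightarrow> indep_quadruple M X X' (J n) (T n)"
    and recurrence: "\<And>n. n \<ge> 2 \<Longrightarrow>
          distr M borel (X n) =
          distr M borel (\<lambda>\<omega>. X (J n \<omega>) \<omega> + X' (n - J n \<omega>) \<omega> + T n \<omega>)"
  defines "a \<equiv> (\<lambda>n. integral\<^sup>L M (X n))"
  shows "a 0 = 0" "a 1 = 0"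
    "a n = (\<Sum>k\<le>n. Bernstein n k p * (a k + a (n - k))) + (if n < 2 then 0 else integral\<^sup>L M (T n))"
proof -
  show a0: "a 0 = 0" unfolding a_def by (subst integral_cong_AE[OF X_rv _ X0]) auto
  show a1: "a 1 = 0" unfolding a_def by (subst integral_cong_AE[OF X_rv _ X1]) auto
  have marg: "distr M borel (X' k) = distr M borel (X k)" for k
  proof -
    have m: "(\<lambda>\<omega> k. Y k \<omega>) \<in> measurable M seq_algebra" if "\<And>n. Y n \<in> borel_measurable M" for Y :: "nat \<Rightarrow> 'a \<Rightarrow> real"
      using that by (intro measurable_PiM_single') (auto simp: space_PiM)
    have c: "(\<lambda>f. f k) \<in> measurable seq_algebra borel" for k :: nat by (rule measurable_component_singleton) simp
    have "distr (distr M seq_algebra (\<lambda>\<omega> k. Y k \<omega>)) borel (\<lambda>f. f k) = distr M borel (Y k)" if "\<And>n. Y n \<in> borel_measurable M" for Y :: "nat \<Rightarrow> 'a \<Rightarrow> real"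
      by (subst distr_distr[OF c m[OF that]]) (simp add: o_def)
    thus ?thesis using copy X_rv X'_rv by metis
  qed
  have E': "integral\<^sup>L M (\<lambda>\<omega>. g (X' k \<omega>)) = integral\<^sup>L M (\<lambda>\<omega>. g (X k \<omega>))" if "g \<in> borel_measurable borel" for k and g :: "real \<Rightarrow> real"
    using integral_distr[OF X_rv that, of k] integral_distr[OF X'_rv that, of k] marg[of k] by simp
  have rec_meas: "(\<lambda>\<omega>. X (J n \<omega>) \<omega> + X' (n - J n \<omega>) \<omega> + T n \<omega>) \<in> borel_measurable M" if "n \<ge> 2" for n
    using measurable_compose_countable[OF X_rv J_rv[OF that]]
      measurable_compose_countable[of "\<lambda>k. X' (n - k)" M borel, OF X'_rv J_rv[OF that]] T_int[OF that] by simp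
  have Erec: "integral\<^sup>L M (\<lambda>\<omega>. g (X n \<omega>)) = integral\<^sup>L M (\<lambda>\<omega>. g (X (J n \<omega>) \<omega> + X' (n - J n \<omega>) \<omega> + T n \<omega>))"
    if "g \<in> borel_measurable borel" "n \<ge> 2" for n and g :: "real \<Rightarrow> real"
    using integral_distr[OF X_rv that(1), of n] integral_distr[OF rec_meas[OF that(2)] that(1)] recurrence[OF that(2)] by simp
  have ind: "indep_var borel (\<lambda>\<omega>. g (X k \<omega>)) borel (\<lambda>\<omega>. real (J n \<omega>))" "indep_var borel (\<lambda>\<omega>. g (X' k \<omega>)) borel (\<lambda>\<omega>. real (J n \<omega>))"
    if "g \<in> borel_measurable borel" "n \<ge> 2" for n k and g :: "real \<Rightarrow> real"
  proof -
    have "indep_var borel (g \<circ> Y) borel ((\<lambda>x. x) \<circ> (\<lambda>\<omega>. real (J n \<omega>)))" if "indep_var borel Y borel (\<lambda>\<omega>. real (J n \<omega>))" for Y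
      by (rule indep_var_compose[OF that \<open>g \<in> borel_measurable borel\<close>]) auto
    from this[OF indep_quadrupleD(1)[OF indep[OF that(2)] X_rv X'_rv J_rv[OF that(2)]]]
      this[OF indep_quadrupleD(2)[OF indep[OF that(2)] X_rv X'_rv J_rv[OF that(2)]]]
    show "indep_var borel (\<lambda>\<omega>. g (X k \<omega>)) borel (\<lambda>\<omega>. real (J n \<omega>))" "indep_var borel (\<lambda>\<omega>. g (X' k \<omega>)) borel (\<lambda>\<omega>. real (J n \<omega>))"
      by (simp_all only: o_def)
  qed
  have X_int: "integrable M (X n)" for n
  proof (induction n rule: less_induct)
    case (less n)
    show ?case
    proof (cases "n < 2")
      case True
      hence "n = 0 \<or> n = 1" by auto
      hence "AE \<omega> in M. X n \<omega> = 0" using X0 X1 by auto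
      thus ?thesis by (subst integrable_cong_AE[OF X_rv _ \<open>AE \<omega> in M. X n \<omega> = 0\<close>]) auto
    next
      case False
      hence n: "n \<ge> 2" by simp
      define A where "A = (\<Sum>k\<in>{1..<n}. Bernstein n k p * (integral\<^sup>L M (\<lambda>\<omega>. \<bar>X k \<omega>\<bar>) + integral\<^sup>L M (\<lambda>\<omega>. \<bar>X (n - k) \<omega>\<bar>))) + integral\<^sup>L M (\<lambda>\<omega>. \<bar>T n \<omega>\<bar>)"
      define s where "s = p ^ n + (1 - p) ^ n"
      have s: "s < 1"
      proof -
        have "p ^ n < p ^ 1" "(1 - p) ^ n < (1 - p) ^ 1" using p n by (intro power_strict_decreasing; simp)+
        thus ?thesis by (simp add: s_def)
      qed
      show ?thesis
      proof (rule integrable_of_bounded_truncations[OF X_rv])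
        fix m :: nat
        \<comment> \<open>Truncation at m is subadditive, so the recurrence in law gives S n \<le> s
          S n + A, where s = p^n + (1 - p)^n < 1 is the probability of a trivial split and
          \<open>A\<close> involves smaller indices and the toll only. As S n is finite, it is at
          most A / (1 - s), uniformly in m.\<close>
        define g where "g = (\<lambda>x::real. min \<bar>x\<bar> (real m))"
        have g: "g \<in> borel_measurable borel" unfolding g_def by measurable
        define S where "S = (\<lambda>k. integral\<^sup>L M (\<lambda>\<omega>. g (X k \<omega>)))"
        have gint: "integrable M (\<lambda>\<omega>. g (Y \<omega>))" if "Y \<in> borel_measurable M" for Y
          by (rule integrable_const_bound[where B = "real m"]) (use measurable_compose[OF that g] in \<open>auto simp: g_def\<close>)
        have Xc: "(\<lambda>\<omega>. g (X k \<omega>)) \<in> borel_measurable M" "(\<lambda>\<omega>. g (X' k \<omega>)) \<in> borel_measurable M" for k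
          using measurable_compose[OF X_rv g] measurable_compose[OF X'_rv g] by auto
        note m1 = integral_random_index[OF J_rv[OF n] J_binom[OF n] less_imp_le[OF p(1)] less_imp_le[OF p(2)], where Y = "\<lambda>k \<omega>. g (X k \<omega>)",
            OF Xc(1) gint[OF X_rv] ind(1)[OF g n]]
        note m2 = integral_random_index[OF J_rv[OF n] J_binom[OF n] less_imp_le[OF p(1)] less_imp_le[OF p(2)], where Y = "\<lambda>k \<omega>. g (X' (n - k) \<omega>)",
            OF Xc(2) gint[OF X'_rv] ind(2)[OF g n]]
        have Tn: "integrable M (\<lambda>\<omega>. \<bar>T n \<omega>\<bar>)" using T_int[OF n] by simp
        have "S n = integral\<^sup>L M (\<lambda>\<omega>. g (X (J n \<omega>) \<omega> + X' (n - J n \<omega>) \<omega> + T n \<omega>))"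
          unfolding S_def by (rule Erec[OF g n])
        also have "\<dots> \<le> integral\<^sup>L M (\<lambda>\<omega>. g (X (J n \<omega>) \<omega>) + g (X' (n - J n \<omega>) \<omega>) + \<bar>T n \<omega>\<bar>)"
        proof (rule integral_mono)
          show "integrable M (\<lambda>\<omega>. g (X (J n \<omega>) \<omega> + X' (n - J n \<omega>) \<omega> + T n \<omega>))"
            by (rule gint[OF rec_meas[OF n]])
          show "integrable M (\<lambda>\<omega>. g (X (J n \<omega>) \<omega>) + g (X' (n - J n \<omega>) \<omega>) + \<bar>T n \<omega>\<bar>)"
            by (intro Bochner_Integration.integrable_add m1(1) m2(1) Tn)
          have "g (x + y + z) \<le> g x + g y + \<bar>z\<bar>" for x y z
            unfolding g_def min_def using of_nat_0_le_iff[of m, where ?'a = real] by (auto simp: abs_if)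
          thus "g (X (J n \<omega>) \<omega> + X' (n - J n \<omega>) \<omega> + T n \<omega>) \<le> g (X (J n \<omega>) \<omega>) + g (X' (n - J n \<omega>) \<omega>) + \<bar>T n \<omega>\<bar>" for \<omega> .
        qed
        also have "\<dots> = (\<Sum>k\<le>n. Bernstein n k p * S k) + (\<Sum>k\<le>n. Bernstein n k p * S (n - k)) + integral\<^sup>L M (\<lambda>\<omega>. \<bar>T n \<omega>\<bar>)"
          using m1 m2 Tn by (simp add: S_def E'[OF g])
        also have "\<dots> = (\<Sum>k\<le>n. Bernstein n k p * (S k + S (n - k))) + integral\<^sup>L M (\<lambda>\<omega>. \<bar>T n \<omega>\<bar>)"
          by (simp add: distrib_left sum.distrib)
        also have "{..n} = insert 0 (insert n {1..<n})" using n by auto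
        also have "(\<Sum>k\<in>\<dots>. Bernstein n k p * (S k + S (n - k))) = (1 - p) ^ n * (S 0 + S n) + (p ^ n * (S n + S 0) + (\<Sum>k\<in>{1..<n}. Bernstein n k p * (S k + S (n - k))))"
          using n by (simp add: Bernstein_def)
        also have "S 0 = 0"
        proof -
          have "AE \<omega> in M. g (X 0 \<omega>) = 0" using X0 by eventually_elim (simp add: g_def)
          from integral_cong_AE[OF Xc(1) _ this] show ?thesis unfolding S_def by simp
        qed
        finally have 1: "S n \<le> s * S n + ((\<Sum>k\<in>{1..<n}. Bernstein n k p * (S k + S (n - k))) + integral\<^sup>L M (\<lambda>\<omega>. \<bar>T n \<omega>\<bar>))"
          by (simp add: s_def algebra_simps)
        have Sle: "S k \<le> integral\<^sup>L M (\<lambda>\<omega>. \<bar>X k \<omega>\<bar>)" if "k < n" for k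
          unfolding S_def by (rule integral_mono[OF gint[OF X_rv]]) (use less[OF that] in \<open>auto simp: g_def\<close>)
        have "(\<Sum>k\<in>{1..<n}. Bernstein n k p * (S k + S (n - k))) \<le> (\<Sum>k\<in>{1..<n}. Bernstein n k p * (integral\<^sup>L M (\<lambda>\<omega>. \<bar>X k \<omega>\<bar>) + integral\<^sup>L M (\<lambda>\<omega>. \<bar>X (n - k) \<omega>\<bar>)))"
          using p by (intro sum_mono mult_left_mono add_mono Sle Bernstein_nonneg) auto
        hence "S n \<le> s * S n + A" using 1 by (simp add: A_def)
        hence "S n * (1 - s) \<le> A" by (simp add: algebra_simps)
        hence "S n \<le> A / (1 - s)" using s by (simp add: pos_le_divide_eq)
        thus "integral\<^sup>L M (\<lambda>\<omega>. min \<bar>X n \<omega>\<bar> (real m)) \<le> A / (1 - s)" by (simp add: S_def g_def)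
      qed
    qed
  qed
  have X'_int: "integrable M (X' k)" and X'_E: "integral\<^sup>L M (X' k) = a k" for k
  proof -
    have "integrable M (\<lambda>\<omega>. (\<lambda>x. x) (X k \<omega>))" using X_int by simp
    hence "integrable (distr M borel (X k)) (\<lambda>x. x)" by (subst integrable_distr_eq[OF X_rv]) auto
    hence "integrable (distr M borel (X' k)) (\<lambda>x. x)" by (simp add: marg)
    thus "integrable M (X' k)" by (subst (asm) integrable_distr_eq[OF X'_rv]) auto
    show "integral\<^sup>L M (X' k) = a k" using E'[of "\<lambda>x. x" k] by (simp add: a_def)
  qed
  show "a n = (\<Sum>k\<le>n. Bernstein n k p * (a k + a (n - k))) + (if n < 2 then 0 else integral\<^sup>L M (T n))"
  proof (cases "n < 2")
    case True
    hence "n = 0 \<or> n = 1" by auto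
    thus ?thesis using a0 a1 by auto
  next
    case False
    hence n: "n \<ge> 2" by simp
    have id: "(\<lambda>x::real. x) \<in> borel_measurable borel" by simp
    note m1 = integral_random_index[OF J_rv[OF n] J_binom[OF n] less_imp_le[OF p(1)] less_imp_le[OF p(2)], where Y = X,
            OF X_rv X_int ind(1)[OF id n]]
    note m2 = integral_random_index[OF J_rv[OF n] J_binom[OF n] less_imp_le[OF p(1)] less_imp_le[OF p(2)], where Y = "\<lambda>k. X' (n - k)",
            OF X'_rv X'_int ind(2)[OF id n]]
    have "a n = integral\<^sup>L M (\<lambda>\<omega>. X (J n \<omega>) \<omega> + X' (n - J n \<omega>) \<omega> + T n \<omega>)"
      unfolding a_def by (rule Erec[OF id n])
    also have "\<dots> = (\<Sum>k\<le>n. Bernstein n k p * a k) + (\<Sum>k\<le>n. Bernstein n k p * a (n - k)) + integral\<^sup>L M (T n)"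
      using m1 m2 T_int[OF n] by (simp add: X'_E) (simp add: a_def)
    finally show ?thesis using n by (simp add: distrib_left sum.distrib)
  qed
qed

end

section \<open>Sector bounds and coefficient differences\<close>

lemma bounded_on_atLeast:
  fixes f :: "real \<Rightarrow> real"
  assumes cont: "continuous_on {x0..} f" and lim: "(f \<longlongrightarrow> l) at_top"
  shows "\<exists>D\<ge>0. \<forall>x\<ge>x0. f x \<le> D"
proof -
  have "eventually (\<lambda>x. f x < l + 1) at_top" using lim by (intro order_tendstoD) auto
  then obtain R where R: "\<And>x. x \<ge> R \<Longrightarrow> f x < l + 1" unfolding eventually_at_top_linorder by blast
  have "compact (f ` {x0..R})"
    by (intro compact_continuous_image continuous_on_subset[OF cont]) auto
  hence "bounded (f ` {x0..R})" by (rule compact_imp_bounded)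
  then obtain B where B: "\<And>x. x0 \<le> x \<Longrightarrow> x \<le> R \<Longrightarrow> norm (f x) \<le> B"
    unfolding bounded_iff by (meson atLeastAtMost_iff imageI)
  show ?thesis
  proof (intro exI[of _ "\<bar>l + 1\<bar> + \<bar>B\<bar>"] conjI allI impI)
    fix x assume x: "x \<ge> x0"
    show "f x \<le> \<bar>l + 1\<bar> + \<bar>B\<bar>"
      using R[of x] B[of x] x by (cases "x \<ge> R") auto
  qed simp
qed

text \<open>A slightly larger exponent absorbs the logarithmic factor for either sign of \<beta>; on
  x \<ge> 1 the logarithm stays away from 0. From here on growth is measured by powers
  alone.\<close>

lemma powr_log_plus_bound:
  fixes \<alpha> \<beta> a :: real
  assumes "\<alpha> < a"
  shows "\<exists>D\<ge>0. \<forall>x\<ge>1. x powr \<alpha> * log_plus x powr \<beta> \<le> D * x powr a"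
proof -
  have lim: "((\<lambda>x::real. x powr (\<alpha> - a) * ln (1 + x) powr \<beta>) \<longlongrightarrow> 0) at_top"
    using assms by real_asymp
  have "continuous_on {1::real..} (\<lambda>x. x powr (\<alpha> - a) * ln (1 + x) powr \<beta>)"
    by (intro continuous_intros) auto
  from bounded_on_atLeast[OF this lim]
  obtain D where D: "D \<ge> 0" "\<And>x. x \<ge> 1 \<Longrightarrow> x powr (\<alpha> - a) * ln (1 + x) powr \<beta> \<le> D" by blast
  have "x powr \<alpha> * log_plus x powr \<beta> \<le> D * x powr a" if "x \<ge> 1" for x
  proof -
    have "x powr \<alpha> = x powr (\<alpha> - a) * x powr a" by (simp flip: powr_add)
    hence "x powr \<alpha> * log_plus x powr \<beta> = (x powr (\<alpha> - a) * ln (1 + x) powr \<beta>) * x powr a"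
      by (simp add: log_plus_def mult_ac)
    also have "\<dots> \<le> D * x powr a" using D(2)[OF that] by (intro mult_right_mono) auto
    finally show ?thesis .
  qed
  thus ?thesis using D by blast
qed

lemma powr_exp_bound:
  fixes b k k' :: real
  assumes "k < k'"
  shows "\<exists>D\<ge>0. \<forall>x\<ge>1. x powr b * exp (k * x) \<le> D * exp (k' * x)"
proof -
  define e where "e = k' - k"
  have e: "e > 0" using assms by (simp add: e_def)
  have lim: "((\<lambda>x::real. x powr b * exp (- e * x)) \<longlongrightarrow> 0) at_top"
    using e by real_asymp
  have "continuous_on {1::real..} (\<lambda>x. x powr b * exp (- e * x))"
    by (intro continuous_intros) auto
  from bounded_on_atLeast[OF this lim]
  obtain D where D: "D \<ge> 0" "\<And>x. x \<ge> 1 \<Longrightarrow> x powr b * exp (- e * x) \<le> D" by blast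
  have "x powr b * exp (k * x) \<le> D * exp (k' * x)" if "x \<ge> 1" for x
  proof -
    have "exp (k * x) = exp (- e * x) * exp (k' * x)" by (simp add: e_def algebra_simps flip: exp_add)
    hence "x powr b * exp (k * x) = x powr b * exp (- e * x) * exp (k' * x)" by simp
    also have "\<dots> \<le> D * exp (k' * x)" using D(2)[OF that] by (intro mult_right_mono) auto
    finally show ?thesis .
  qed
  thus ?thesis using D by blast
qed

lemma Re_le_norm_cos:
  assumes "0 \<le> \<phi>" "\<phi> \<le> \<bar>Arg z\<bar>"
  shows "Re z \<le> norm z * cos \<phi>"
proof -
  have "Re z = norm z * cos (Arg z)" by (metis Re_rcis rcis_cmod_Arg)
  also have "cos (Arg z) = cos \<bar>Arg z\<bar>" by (simp add: abs_if)
  also have "cos \<bar>Arg z\<bar> \<le> cos \<phi>"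
    using assms Arg_bounded[of z] by (intro cos_monotone_0_pi_le) auto
  finally show ?thesis by (simp add: mult_left_mono)
qed

text \<open>Both alternatives of the theorem are brought to one form, with the same angle for the
  inner and the outer bound. Under the second one the angle is \<theta>, which may differ from that
  in \<open>JS\<close>. On the sector between them, if there is one, and for the term c z, the outer
  bound follows from Re z \<le> norm z cos \<theta>, which beats any power of norm z.\<close>

lemma sector_bounds:
  fixes g :: "complex \<Rightarrow> complex" and c \<alpha> \<beta> \<theta> :: real
  assumes \<theta>: "0 < \<theta>" "\<theta> < pi / 2"
    and cases: "(g \<in> JS \<alpha> \<beta> \<and> c = 0) \<or>
          (g \<in> JS_all \<and>
           (\<lambda>z. norm (g z - of_real c * z))
             \<in> O[inf at_infinity (principal {z. \<bar>Arg z\<bar> \<le> \<theta>})](\<lambda>z.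
                  norm z powr \<alpha> * log_plus (norm z) powr \<beta>))"
  obtains \<phi> where "0 < \<phi>" "\<phi> < pi / 2" "g holomorphic_on UNIV"
    "\<And>a. a > \<alpha> \<Longrightarrow> \<exists>C\<ge>0. \<forall>z. 1 \<le> norm z \<longrightarrow> \<bar>Arg z\<bar> \<le> \<phi> \<longrightarrow> norm (g z - of_real c * z) \<le> C * norm z powr a"
    "\<exists>\<epsilon>>0. \<exists>C\<ge>0. \<forall>z. 1 \<le> norm z \<longrightarrow> \<phi> \<le> \<bar>Arg z\<bar> \<longrightarrow> norm (exp z * (g z - of_real c * z)) \<le> C * exp ((1 - \<epsilon>) * norm z)"
proof -
  from cases show thesis
  proof
    assume "g \<in> JS \<alpha> \<beta> \<and> c = 0"
    hence c: "c = 0" and JS: "g \<in> JS \<alpha> \<beta>" by auto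
    from JS obtain \<phi> C \<epsilon> C' where hol: "g holomorphic_on UNIV" and \<phi>: "0 < \<phi>" "\<phi> < pi / 2"
      and C: "\<And>z. 1 \<le> norm z \<Longrightarrow> \<bar>Arg z\<bar> \<le> \<phi> \<Longrightarrow> norm (g z) \<le> C * (norm z powr \<alpha> * log_plus (norm z) powr \<beta>)"
      and \<epsilon>: "\<epsilon> > 0" and C': "\<And>z. 1 \<le> norm z \<Longrightarrow> \<phi> \<le> \<bar>Arg z\<bar> \<Longrightarrow> norm (exp z * g z) \<le> C' * exp ((1 - \<epsilon>) * norm z)"
      unfolding JS_def mem_Collect_eq by metis
    show thesis
    proof (rule that[OF \<phi> hol])
      fix a assume "a > \<alpha>"
      then obtain D where D: "D \<ge> 0" "\<And>x. x \<ge> 1 \<Longrightarrow> x powr \<alpha> * log_plus x powr \<beta> \<le> D * x powr a"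
        using powr_log_plus_bound by metis
      show "\<exists>C\<ge>0. \<forall>z. 1 \<le> norm z \<longrightarrow> \<bar>Arg z\<bar> \<le> \<phi> \<longrightarrow> norm (g z - of_real c * z) \<le> C * norm z powr a"
      proof (intro exI[of _ "\<bar>C\<bar> * D"] conjI allI impI)
        fix z :: complex assume z: "1 \<le> norm z" "\<bar>Arg z\<bar> \<le> \<phi>"
        have "norm (g z - of_real c * z) \<le> C * (norm z powr \<alpha> * log_plus (norm z) powr \<beta>)" using C[OF z] c by simp
        also have "\<dots> \<le> \<bar>C\<bar> * (norm z powr \<alpha> * log_plus (norm z) powr \<beta>)" by (intro mult_right_mono) auto
        also have "\<dots> \<le> \<bar>C\<bar> * (D * norm z powr a)" by (intro mult_left_mono D(2) z) auto
        finally show "norm (g z - of_real c * z) \<le> \<bar>C\<bar> * D * norm z powr a" by (simp add: mult_ac)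
      qed (use D in auto)
    next
      show "\<exists>\<epsilon>>0. \<exists>C\<ge>0. \<forall>z. 1 \<le> norm z \<longrightarrow> \<phi> \<le> \<bar>Arg z\<bar> \<longrightarrow> norm (exp z * (g z - of_real c * z)) \<le> C * exp ((1 - \<epsilon>) * norm z)"
      proof (rule exI[of _ \<epsilon>], rule conjI[OF \<epsilon>], rule exI[of _ "\<bar>C'\<bar>"], intro conjI allI impI)
        fix z :: complex assume z: "1 \<le> norm z" "\<phi> \<le> \<bar>Arg z\<bar>"
        have "norm (exp z * (g z - of_real c * z)) \<le> C' * exp ((1 - \<epsilon>) * norm z)" using C'[OF z] c by simp
        also have "\<dots> \<le> \<bar>C'\<bar> * exp ((1 - \<epsilon>) * norm z)" by (intro mult_right_mono) auto
        finally show "norm (exp z * (g z - of_real c * z)) \<le> \<bar>C'\<bar> * exp ((1 - \<epsilon>) * norm z)" .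
      qed simp
    qed
  next
    assume A: "g \<in> JS_all \<and>
           (\<lambda>z. norm (g z - of_real c * z))
             \<in> O[inf at_infinity (principal {z. \<bar>Arg z\<bar> \<le> \<theta>})](\<lambda>z.
                  norm z powr \<alpha> * log_plus (norm z) powr \<beta>)"
    then obtain \<alpha>' \<beta>' where JS: "g \<in> JS \<alpha>' \<beta>'" by (auto simp: JS_all_def)
    from JS obtain \<phi> C \<epsilon> C' where hol: "g holomorphic_on UNIV" and \<phi>: "0 < \<phi>" "\<phi> < pi / 2"
      and C: "\<And>z. 1 \<le> norm z \<Longrightarrow> \<bar>Arg z\<bar> \<le> \<phi> \<Longrightarrow> norm (g z) \<le> C * (norm z powr \<alpha>' * log_plus (norm z) powr \<beta>')"
      and \<epsilon>: "\<epsilon> > 0" and C': "\<And>z. 1 \<le> norm z \<Longrightarrow> \<phi> \<le> \<bar>Arg z\<bar> \<Longrightarrow> norm (exp z * g z) \<le> C' * exp ((1 - \<epsilon>) * norm z)"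
      unfolding JS_def mem_Collect_eq by metis
    from A obtain K where "eventually (\<lambda>z. norm (norm (g z - of_real c * z)) \<le> K * norm (norm z powr \<alpha> * log_plus (norm z) powr \<beta>))
        (inf at_infinity (principal {z. \<bar>Arg z\<bar> \<le> \<theta>}))"
      by (auto elim!: landau_o.bigE)
    then obtain R where R: "\<And>z. norm z \<ge> R \<Longrightarrow> \<bar>Arg z\<bar> \<le> \<theta> \<Longrightarrow> norm (g z - of_real c * z) \<le> K * \<bar>norm z powr \<alpha> * log_plus (norm z) powr \<beta>\<bar>"
      unfolding eventually_inf_principal eventually_at_infinity by auto
    have "compact ((\<lambda>z. g z - of_real c * z) ` cball 0 R)"
      by (intro compact_continuous_image continuous_intros continuous_on_subset[OF holomorphic_on_imp_continuous_on[OF hol]]) auto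
    hence "bounded ((\<lambda>z. g z - of_real c * z) ` cball 0 R)" by (rule compact_imp_bounded)
    then obtain B where B0: "\<forall>y\<in>(\<lambda>z. g z - of_real c * z) ` cball 0 R. norm y \<le> B"
      unfolding bounded_iff by blast
    have B: "norm (g z - of_real c * z) \<le> B" if "norm z \<le> R" for z
      using B0 that by auto
    show thesis
    proof (rule that[OF \<theta> hol])
      fix a assume "a > \<alpha>"
      then obtain D where D: "D \<ge> 0" "\<And>x. x \<ge> 1 \<Longrightarrow> x powr \<alpha> * log_plus x powr \<beta> \<le> D * x powr a"
        using powr_log_plus_bound by metis
      \<comment> \<open>For 1 \<le> norm z < R only the compactness bound \<open>B\<close> is
        available; there 1 + |R|^(-a) times (norm z)^a is at least 1, for a of either sign.\<close>
      define K' where "K' = \<bar>K\<bar> * D + \<bar>B\<bar> * (1 + \<bar>R\<bar> powr (- a))"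
      show "\<exists>C\<ge>0. \<forall>z. 1 \<le> norm z \<longrightarrow> \<bar>Arg z\<bar> \<le> \<theta> \<longrightarrow> norm (g z - of_real c * z) \<le> C * norm z powr a"
      proof (intro exI[of _ K'] conjI allI impI)
        fix z :: complex assume z: "1 \<le> norm z" "\<bar>Arg z\<bar> \<le> \<theta>"
        have nn: "\<bar>K\<bar> * D * norm z powr a \<ge> 0" "\<bar>B\<bar> * (1 + \<bar>R\<bar> powr (- a)) * norm z powr a \<ge> 0" using D by auto
        show "norm (g z - of_real c * z) \<le> K' * norm z powr a"
        proof (cases "norm z \<ge> R")
          case True
          have "norm (g z - of_real c * z) \<le> K * (norm z powr \<alpha> * log_plus (norm z) powr \<beta>)" using R[OF True z(2)] by (simp add: abs_mult)
          also have "\<dots> \<le> \<bar>K\<bar> * (norm z powr \<alpha> * log_plus (norm z) powr \<beta>)" by (intro mult_right_mono) auto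
          also have "\<dots> \<le> \<bar>K\<bar> * (D * norm z powr a)" by (intro mult_left_mono D(2) z) auto
          finally have "norm (g z - of_real c * z) \<le> \<bar>K\<bar> * D * norm z powr a" by (simp only: mult.assoc)
          thus ?thesis using nn(2) unfolding K'_def distrib_right by linarith
        next
          case False
          have "1 \<le> (1 + \<bar>R\<bar> powr (- a)) * norm z powr a"
          proof (cases "a \<ge> 0")
            case True
            hence "1 \<le> norm z powr a" using z by (simp add: ge_one_powr_ge_zero)
            thus ?thesis by (smt (verit) mult_less_cancel_right2 mult_nonneg_nonneg powr_ge_zero)
          next
            case a: False
            have "z \<noteq> 0" using z by auto
            hence "1 = norm z powr (- a) * norm z powr a" by (simp flip: powr_add)
            also have "\<dots> \<le> \<bar>R\<bar> powr (- a) * norm z powr a" using False z a by (intro mult_right_mono powr_mono2) auto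
            also have "\<dots> \<le> (1 + \<bar>R\<bar> powr (- a)) * norm z powr a" by (intro mult_right_mono) auto
            finally show ?thesis .
          qed
          hence "\<bar>B\<bar> * 1 \<le> \<bar>B\<bar> * ((1 + \<bar>R\<bar> powr (- a)) * norm z powr a)" by (intro mult_left_mono) auto
          moreover have "norm (g z - of_real c * z) \<le> \<bar>B\<bar>" using B[of z] False by force
          ultimately have "norm (g z - of_real c * z) \<le> \<bar>B\<bar> * (1 + \<bar>R\<bar> powr (- a)) * norm z powr a" by (simp add: mult.assoc)
          thus ?thesis using nn(1) unfolding K'_def distrib_right[of "\<bar>K\<bar> * D"] by linarith
        qed
      qed (use D in \<open>auto simp: K'_def\<close>)
    next
      \<comment> \<open>The gap between cos \<theta> and k absorbs the polynomial factors, the gap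
        between k and 1 is left for the final exponent.\<close>
      define k where "k = (1 + cos \<theta>) / 2"
      have "cos \<theta> < cos 0" using \<theta> pi_gt_zero by (intro cos_monotone_0_pi) linarith+
      hence k: "cos \<theta> < k" "k < 1" by (auto simp: k_def)
      obtain D1 where D1: "D1 \<ge> 0" "\<And>x. x \<ge> 1 \<Longrightarrow> x powr \<alpha>' * log_plus x powr \<beta>' \<le> D1 * x powr (\<alpha>' + 1)"
        using powr_log_plus_bound[of \<alpha>' "\<alpha>' + 1" \<beta>'] by auto
      obtain D2 where D2: "D2 \<ge> 0" "\<And>x. x \<ge> 1 \<Longrightarrow> x powr (\<alpha>' + 1) * exp (cos \<theta> * x) \<le> D2 * exp (k * x)"
        using powr_exp_bound[OF k(1)] by metis
      obtain D3 where D3: "D3 \<ge> 0" "\<And>x. x \<ge> 1 \<Longrightarrow> x powr 1 * exp (cos \<theta> * x) \<le> D3 * exp (k * x)"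
        using powr_exp_bound[OF k(1)] by metis
      define \<epsilon>' where "\<epsilon>' = min \<epsilon> (1 - k)"
      have \<epsilon>': "\<epsilon>' > 0" using \<epsilon> k by (simp add: \<epsilon>'_def)
      define K' where "K' = \<bar>C'\<bar> + \<bar>C\<bar> * D1 * D2 + \<bar>c\<bar> * D3"
      show "\<exists>\<epsilon>>0. \<exists>C\<ge>0. \<forall>z. 1 \<le> norm z \<longrightarrow> \<theta> \<le> \<bar>Arg z\<bar> \<longrightarrow> norm (exp z * (g z - of_real c * z)) \<le> C * exp ((1 - \<epsilon>) * norm z)"
      proof (rule exI[of _ \<epsilon>'], rule conjI[OF \<epsilon>'], rule exI[of _ K'], intro conjI allI impI)
        fix z :: complex assume z: "1 \<le> norm z" "\<theta> \<le> \<bar>Arg z\<bar>"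
        define x where "x = norm z"
        have x: "x \<ge> 1" using z by (simp add: x_def)
        define E where "E = exp ((1 - \<epsilon>') * x)"
        have E: "exp ((1 - \<epsilon>) * x) \<le> E" "exp (k * x) \<le> E"
          unfolding E_def using x by (auto simp: \<epsilon>'_def intro!: mult_right_mono)
        have "Re z \<le> cos \<theta> * x" using Re_le_norm_cos[of \<theta> z] z \<theta> by (simp add: x_def mult.commute)
        hence e: "norm (exp z) \<le> exp (cos \<theta> * x)" by simp
        have "norm (exp z * (of_real c * z)) = \<bar>c\<bar> * (x powr 1 * norm (exp z))" using x by (simp add: norm_mult x_def)
        also have "\<dots> \<le> \<bar>c\<bar> * (x powr 1 * exp (cos \<theta> * x))" by (intro mult_left_mono e) auto
        also have "\<dots> \<le> \<bar>c\<bar> * (D3 * exp (k * x))" by (intro mult_left_mono D3(2) x) auto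
        also have "\<dots> \<le> \<bar>c\<bar> * (D3 * E)" using D3(1) E by (intro mult_left_mono) auto
        finally have 1: "norm (exp z * (of_real c * z)) \<le> \<bar>c\<bar> * D3 * E" by (simp add: mult_ac)
        have 2: "norm (exp z * g z) \<le> (\<bar>C'\<bar> + \<bar>C\<bar> * D1 * D2) * E"
        proof (cases "\<phi> \<le> \<bar>Arg z\<bar>")
          case True
          have "norm (exp z * g z) \<le> C' * exp ((1 - \<epsilon>) * x)" using C'[OF z(1) True] by (simp add: x_def)
          also have "\<dots> \<le> \<bar>C'\<bar> * E" using E by (intro mult_mono) auto
          also have "\<dots> \<le> (\<bar>C'\<bar> + \<bar>C\<bar> * D1 * D2) * E" using D1(1) D2(1) by (intro mult_right_mono) (auto simp: E_def)
          finally show ?thesis .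
        next
          case False
          have "norm (g z) \<le> C * (x powr \<alpha>' * log_plus x powr \<beta>')" using C[OF z(1)] False by (simp add: x_def)
          also have "\<dots> \<le> \<bar>C\<bar> * (x powr \<alpha>' * log_plus x powr \<beta>')" by (intro mult_right_mono) auto
          also have "\<dots> \<le> \<bar>C\<bar> * (D1 * x powr (\<alpha>' + 1))" by (intro mult_left_mono D1(2) x) auto
          finally have "norm (exp z * g z) \<le> exp (cos \<theta> * x) * (\<bar>C\<bar> * (D1 * x powr (\<alpha>' + 1)))"
            unfolding norm_mult using e by (intro mult_mono) auto
          also have "\<dots> = \<bar>C\<bar> * D1 * (x powr (\<alpha>' + 1) * exp (cos \<theta> * x))" by (simp add: mult_ac)
          also have "\<dots> \<le> \<bar>C\<bar> * D1 * (D2 * exp (k * x))" using D1(1) by (intro mult_left_mono D2(2) x) auto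
          also have "\<dots> \<le> \<bar>C\<bar> * D1 * (D2 * E)" using D1(1) D2(1) E by (intro mult_left_mono) auto
          also have "\<dots> \<le> (\<bar>C'\<bar> + \<bar>C\<bar> * D1 * D2) * E" by (simp add: distrib_right E_def)
          finally show ?thesis .
        qed
        have "norm (exp z * (g z - of_real c * z)) \<le> norm (exp z * g z) + norm (exp z * (of_real c * z))"
          by (simp only: right_diff_distrib norm_triangle_ineq4)
        also have "\<dots> \<le> K' * E" using 1 2 by (simp add: K'_def distrib_right)
        finally show "norm (exp z * (g z - of_real c * z)) \<le> K' * exp ((1 - \<epsilon>') * norm z)" by (simp add: E_def x_def)
      qed (use D1 D2 D3 in \<open>auto simp: K'_def\<close>)
    qed
  qed
qed

section \<open>Stirling and Cauchy estimates for coefficient differences\<close>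

text \<open>The quotient of n! and sqrt n (n / e)^n is nonincreasing and equals e at n = 1.
  Monotonicity amounts to ln (1 + 1 / x) \<ge> 2 / (2 x + 1).\<close>

lemma fact_upper_bound:
  assumes "n \<ge> 1"
  shows "fact n \<le> exp 1 * sqrt (real n) * (real n ^ n * exp (- real n))"
  using assms
proof (induction n rule: nat_induct_at_least)
  case base
  show ?case by (simp flip: exp_add)
next
  case (Suc n)
  define x where "x = real n"
  have x: "x \<ge> 1" using Suc.hyps by (simp add: x_def)
  have "ln (x + 1) - ln x \<ge> 2 * (x + 1 - x) / (x + (x + 1))"
    by (rule ln_inverse_approx_ge) (use x in auto)
  hence "(x + 1 / 2) * (ln (x + 1) - ln x) \<ge> (x + 1 / 2) * (2 / (2 * x + 1))"
    using x by (intro mult_left_mono) (auto simp: add_ac)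
  also have "(x + 1 / 2) * (2 / (2 * x + 1)) = 1" using x by (simp add: field_simps)
  finally have key: "1 + ((x + 1 / 2) * ln x) \<le> (x + 1 / 2) * ln (x + 1)" by (simp add: algebra_simps)
  have e: "sqrt y * y powr x = exp ((x + 1 / 2) * ln y)" if "y > 0" for y
    using that by (simp add: powr_def powr_half_sqrt[symmetric] algebra_simps flip: exp_add)
  have "exp 1 * (sqrt x * x powr x) \<le> sqrt (x + 1) * (x + 1) powr x"
    using key x by (simp add: e flip: exp_add)
  hence st: "exp 1 * (sqrt x * x ^ n) \<le> sqrt (x + 1) * (x + 1) ^ n"
    using x by (simp add: x_def powr_realpow)
  have "fact (Suc n) = (x + 1) * fact n" by (simp add: x_def add_ac)
  also have "\<dots> \<le> (x + 1) * (exp 1 * sqrt x * (x ^ n * exp (- x)))"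
    using Suc.IH x by (intro mult_left_mono) (auto simp: x_def)
  also have "\<dots> = (x + 1) * exp (- x) * (exp 1 * (sqrt x * x ^ n))" by simp
  also have "\<dots> \<le> (x + 1) * exp (- x) * (sqrt (x + 1) * (x + 1) ^ n)"
    using x by (intro mult_left_mono st) auto
  also have "exp (- x) = exp 1 * exp (- (x + 1))" by (simp flip: exp_add)
  also have "(x + 1) * (exp 1 * exp (- (x + 1))) * (sqrt (x + 1) * (x + 1) ^ n) = exp 1 * sqrt (x + 1) * ((x + 1) ^ Suc n * exp (- (x + 1)))"
    by simp
  finally show ?case by (simp add: x_def add_ac)
qed

lemma cos_le_one_minus_square:
  fixes t :: real
  assumes "0 \<le> t" "t \<le> pi"
  shows "cos t \<le> 1 - t\<^sup>2 / 8"
proof -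
  \<comment> \<open>Here cos t = 1 - 2 (sin (2 y))^2, so sin (2 y) \<ge> y is to be shown. A quarter
    of t lies in [0, pi / 4], where (cos y)^2 \<ge> 1 / 2, and sin y \<ge> y cos y does the
    rest.\<close>
  define y where "y = t / 4"
  have y: "0 \<le> y" "y \<le> pi / 4" using assms by (auto simp: y_def)
  have "sin 0 - 0 * cos 0 \<le> sin y - y * cos y"
  proof (rule DERIV_nonneg_imp_nondecreasing[OF y(1)])
    fix x assume x: "0 \<le> x" "x \<le> y"
    have "x * sin x \<ge> 0" using x y pi_gt_zero by (intro mult_nonneg_nonneg sin_ge_zero) linarith+
    moreover have "((\<lambda>x. sin x - x * cos x) has_real_derivative x * sin x) (at x)"
      by (auto intro!: derivative_eq_intros)
    ultimately show "\<exists>y. ((\<lambda>x. sin x - x * cos x) has_real_derivative y) (at x) \<and> 0 \<le> y" by blast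
  qed
  hence s: "y * cos y \<le> sin y" by simp
  have "cos (pi / 4) \<le> cos y" using y pi_gt_zero by (intro cos_monotone_0_pi_le) linarith+
  hence c: "cos y \<ge> sqrt 2 / 2" by (simp add: cos_45)
  hence "(sqrt 2 / 2)\<^sup>2 \<le> (cos y)\<^sup>2" by (intro power_mono) auto
  hence "1 / 2 \<le> (cos y)\<^sup>2" by (simp add: power_divide)
  hence "2 * y * (1 / 2) \<le> 2 * y * (cos y)\<^sup>2" using y by (intro mult_left_mono) auto
  also have "\<dots> = 2 * (y * cos y) * cos y" by (simp add: power2_eq_square)
  also have "\<dots> \<le> 2 * sin y * cos y"
    using s c by (intro mult_right_mono) (auto intro: order_trans[of _ "sqrt 2 / 2"])
  also have "\<dots> = sin (2 * y)" by (simp add: sin_double)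
  finally have "y \<le> sin (2 * y)" by simp
  hence "y\<^sup>2 \<le> (sin (2 * y))\<^sup>2" using y by (intro power_mono) auto
  moreover have "cos t = 1 - 2 * (sin (2 * y))\<^sup>2" using cos_double_sin[of "2 * y"] by (simp add: y_def)
  ultimately show ?thesis by (simp add: y_def power_divide)
qed

lemma exponential_gf_coefficient:
  fixes e :: "nat \<Rightarrow> complex"
  assumes "\<And>z. (\<lambda>n. e n * z ^ n / fact n) sums A z"
  shows "(deriv ^^ n) A 0 = e n" "A holomorphic_on UNIV"
proof -
  have "A has_fps_expansion Abs_fps (\<lambda>n. e n / fact n)"
    by (rule has_fps_expansionI) (use assms in \<open>simp add: field_simps\<close>)
  from fps_nth_fps_expansion[OF this, of n] show "(deriv ^^ n) A 0 = e n" by simp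
  have "A holomorphic_on ball 0 r" for r
    by (rule power_series_holomorphic[of 0 r "\<lambda>n. e n / fact n"]) (use assms in \<open>simp add: field_simps\<close>)
  have "A field_differentiable at z" for z
  proof -
    have "A holomorphic_on ball 0 (norm z + 1)" by fact
    thus ?thesis by (rule holomorphic_on_imp_differentiable_at) auto
  qed
  thus "A holomorphic_on UNIV" by (simp add: holomorphic_on_def field_differentiable_at_within)
qed

text \<open>Both coefficients are taken on the circle of radius m = k + 1, where m / m! = 1 / k!
  gives them a common factor. The integrand of the difference then has the factor 1 - cis t, which
  vanishes at the saddle point t = 0. This zero gains m^(-1/2) over the estimate of a single
  coefficient.\<close>

lemma coefficient_difference_integral:
  fixes e :: "nat \<Rightarrow> complex" and m :: nat
  assumes sums: "\<And>z. (\<lambda>n. e n * z ^ n / fact n) sums A z" and m: "m = Suc k"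
  shows "((\<lambda>t. A (of_nat m * cis t) * (1 - cis t) / cis t ^ m) has_integral
     (of_real (2 * pi) * (of_nat m ^ k / fact k) * (e m - e k))) {0..2 * pi}"
proof -
  have A: "A holomorphic_on UNIV" using exponential_gf_coefficient[OF sums] by blast
  have M: "real m > 0" using m by simp
  have cont: "continuous_on (cball 0 (real m)) A" "A holomorphic_on ball 0 (real m)"
    using holomorphic_on_subset[OF A] holomorphic_on_imp_continuous_on by blast+
  have C: "((\<lambda>u. A u / (u - 0) ^ Suc j) has_contour_integral (2 * pi * \<i>) / fact j * e j) (circlepath 0 (real m))" for j
    using Cauchy_has_contour_integral_higher_derivative_circlepath[OF cont, of 0 j] M
    by (simp add: exponential_gf_coefficient(1)[OF sums])
  have "((\<lambda>u. of_nat m * (A u / (u - 0) ^ Suc m) - A u / (u - 0) ^ Suc k) has_contour_integral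
      of_nat m * ((2 * pi * \<i>) / fact m * e m) - (2 * pi * \<i>) / fact k * e k) (circlepath 0 (real m))"
    by (intro has_contour_integral_diff has_contour_integral_lmul C)
  moreover have "of_nat m * ((2 * pi * \<i>) / fact m * e m) - (2 * pi * \<i>) / fact k * e k = 2 * pi * \<i> / fact k * (e m - e k)"
  proof -
    have "fact m = (of_nat m * fact k :: complex)" using m by simp
    thus ?thesis using M by (simp add: right_diff_distrib)
  qed
  ultimately have "((\<lambda>u. of_nat m * (A u / (u - 0) ^ Suc m) - A u / (u - 0) ^ Suc k) has_contour_integral
      2 * pi * \<i> / fact k * (e m - e k)) (part_circlepath 0 (real m) 0 (2 * pi))" by (simp add: circlepath_def)
  hence "((\<lambda>t. (of_nat m * (A (0 + real m * cis t) / (0 + real m * cis t - 0) ^ Suc m) - A (0 + real m * cis t) / (0 + real m * cis t - 0) ^ Suc k) * real m * \<i> * cis t)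
       has_integral 2 * pi * \<i> / fact k * (e m - e k)) {0..2 * pi}"
    by (subst (asm) has_contour_integral_part_circlepath_iff) auto
  from has_integral_mult_right[OF this, of "of_nat m ^ k / \<i>"]
  have "((\<lambda>t. of_nat m ^ k / \<i> * ((of_nat m * (A (0 + real m * cis t) / (0 + real m * cis t - 0) ^ Suc m) - A (0 + real m * cis t) / (0 + real m * cis t - 0) ^ Suc k) * real m * \<i> * cis t))
       has_integral of_nat m ^ k / \<i> * (2 * pi * \<i> / fact k * (e m - e k))) {0..2 * pi}" .
  moreover have "of_nat m ^ k / \<i> * ((of_nat m * (A (0 + real m * cis t) / (0 + real m * cis t - 0) ^ Suc m) - A (0 + real m * cis t) / (0 + real m * cis t - 0) ^ Suc k) * real m * \<i> * cis t)
      = A (of_nat m * cis t) * (1 - cis t) / cis t ^ m" for t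
  proof -
    define \<mu> where "\<mu> = (of_nat m :: complex)"
    have \<mu>: "\<mu> \<noteq> 0" using M by (simp add: \<mu>_def)
    have gen: "\<mu> ^ k / \<i> * ((\<mu> * (a / (\<mu> * z) ^ Suc m) - a / (\<mu> * z) ^ Suc k) * \<mu> * \<i> * z) = a * (1 - z) / z ^ m" if z: "z \<noteq> 0" for a z
      unfolding m using \<mu> z by (simp add: power_mult_distrib field_simps)
    show ?thesis using gen[of "cis t" "A (of_nat m * cis t)"] by (simp add: \<mu>_def)
  qed
  moreover have "of_nat m ^ k / \<i> * (2 * pi * \<i> / fact k * (e m - e k)) = of_real (2 * pi) * (of_nat m ^ k / fact k) * (e m - e k)"
  proof -
    have "x / w * (y * w / f * v) = y * (x / f) * v" if "w \<noteq> 0" for x w y f v :: complex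
      using that by simp
    from this[OF complex_i_not_zero] show ?thesis .
  qed
  ultimately show ?thesis by (simp only:)
qed

text \<open>The two terms are the halves of one Gaussian peak at t = 0 modulo 2 pi. The linear
  factor makes the primitive elementary and the bound 1 / k instead of order k^(-1/2).\<close>

lemma integral_gaussian_moment_le:
  fixes k :: real
  assumes "k > 0"
  shows "integral {0..2 * pi} (\<lambda>t. t * exp (- k * t\<^sup>2) + (2 * pi - t) * exp (- k * (2 * pi - t)\<^sup>2)) \<le> 1 / k"
    "(\<lambda>t. t * exp (- k * t\<^sup>2) + (2 * pi - t) * exp (- k * (2 * pi - t)\<^sup>2)) integrable_on {0..2 * pi}"
proof -
  define P where "P = (\<lambda>t::real. (exp (- k * (2 * pi - t)\<^sup>2) - exp (- k * t\<^sup>2)) / (2 * k))"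
  have "((\<lambda>t. t * exp (- k * t\<^sup>2) + (2 * pi - t) * exp (- k * (2 * pi - t)\<^sup>2)) has_integral P (2 * pi) - P 0) {0..2 * pi}"
  proof (rule fundamental_theorem_of_calculus)
    fix t
    have "(P has_real_derivative t * exp (- k * t\<^sup>2) + (2 * pi - t) * exp (- k * (2 * pi - t)\<^sup>2)) (at t)"
      unfolding P_def using assms by (auto intro!: derivative_eq_intros simp: field_simps)
    thus "(P has_vector_derivative t * exp (- k * t\<^sup>2) + (2 * pi - t) * exp (- k * (2 * pi - t)\<^sup>2)) (at t within {0..2 * pi})"
      by (simp add: has_real_derivative_iff_has_vector_derivative has_vector_derivative_at_within)
  qed simp
  moreover have "P (2 * pi) - P 0 \<le> 1 / k" using assms by (simp add: P_def field_simps)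
  ultimately show "integral {0..2 * pi} (\<lambda>t. t * exp (- k * t\<^sup>2) + (2 * pi - t) * exp (- k * (2 * pi - t)\<^sup>2)) \<le> 1 / k"
    "(\<lambda>t. t * exp (- k * t\<^sup>2) + (2 * pi - t) * exp (- k * (2 * pi - t)\<^sup>2)) integrable_on {0..2 * pi}"
    by (auto simp: has_integral_iff)
qed

text \<open>In the sector the Cauchy integral is of order x^a exp x / x, and Stirling's formula
  contributes sqrt x exp (- x); the product is x^(a - 1/2). The exponentially smaller outer part
  becomes bounded.\<close>

lemma coefficient_difference_bound:
  fixes t :: "nat \<Rightarrow> real" and c a \<phi> \<epsilon> C1 C2 :: real
  assumes conv: "\<And>z::complex. summable (\<lambda>n. of_real (t n) * z ^ n / fact n)"
    and \<epsilon>: "\<epsilon> > 0" and a: "1 / 2 \<le> a"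
    and C: "C1 \<ge> 0" "C2 \<ge> 0"
    and inside: "\<And>z. 1 \<le> norm z \<Longrightarrow> \<bar>Arg z\<bar> \<le> \<phi> \<Longrightarrow> norm (poisson_gf t z - of_real c * z) \<le> C1 * norm z powr a"
    and outside: "\<And>z. 1 \<le> norm z \<Longrightarrow> \<phi> \<le> \<bar>Arg z\<bar> \<Longrightarrow> norm (exp z * (poisson_gf t z - of_real c * z)) \<le> C2 * exp ((1 - \<epsilon>) * norm z)"
  shows "\<exists>B. \<forall>k. \<bar>t (Suc k) - t k\<bar> \<le> B * real (Suc k) powr (a - 1 / 2)"
proof -
  \<comment> \<open>As the exponential series of n is z exp z, subtracting c n from the coefficients
    subtracts c z from the Poisson generating function. The differences change by the constant c
    only.\<close>
  define e where "e = (\<lambda>n. t n - c * real n)"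
  define A where "A = (\<lambda>z. exp z * (poisson_gf t z - of_real c * z))"
  have sums: "(\<lambda>n. of_real (e n) * z ^ n / fact n) sums A z" for z :: complex
  proof -
    have ee: "exp z * exp (- z) = 1" by (simp flip: exp_add)
    have "(\<lambda>n. of_nat n * (z ^ n / fact n)) sums (z * exp z)"
    proof -
      have "(\<lambda>n. z ^ n / fact n) sums exp z"
        using exp_converges[of z] by (simp add: scaleR_conv_of_real divide_inverse mult.commute)
      from sums_mult[OF this, of z] have "(\<lambda>n. z * (z ^ n / fact n)) sums (z * exp z)" .
      moreover have "z * (z ^ n / fact n) = of_nat (Suc n) * (z ^ Suc n / fact (Suc n))" for n
        by (simp add: fact_Suc del: of_nat_Suc)
      ultimately have "(\<lambda>n. of_nat (Suc n) * (z ^ Suc n / fact (Suc n))) sums (z * exp z)" by simp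
      from sums_Suc[OF this] show ?thesis by simp
    qed
    hence "(\<lambda>n. of_real (t n) * z ^ n / fact n - of_real c * (of_nat n * (z ^ n / fact n))) sums ((\<Sum>n. of_real (t n) * z ^ n / fact n) - of_real c * (z * exp z))"
      by (intro sums_diff sums_mult summable_sums conv)
    moreover have "(\<Sum>n. of_real (t n) * z ^ n / fact n) = (exp z * exp (- z)) * (\<Sum>n. of_real (t n) * z ^ n / fact n)" by (simp add: ee)
    hence "(\<Sum>n. of_real (t n) * z ^ n / fact n) - of_real c * (z * exp z) = A z"
      by (simp add: A_def poisson_gf_def right_diff_distrib mult_ac)
    moreover have "of_real (t n) * z ^ n / fact n - of_real c * (of_nat n * (z ^ n / fact n)) = of_real (e n) * z ^ n / fact n" for n
      by (simp add: e_def algebra_simps diff_divide_distrib)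
    ultimately show ?thesis by simp
  qed
  obtain D where D: "D \<ge> 0" "\<And>x. x \<ge> 1 \<Longrightarrow> x powr (1/2) * exp ((1 - \<epsilon>) * x) \<le> D * exp (1 * x)"
    using powr_exp_bound[of "1 - \<epsilon>" 1 "1/2"] \<epsilon> by auto
  define B where "B = exp 1 * 8 * C1 + exp 1 * 8 * C2 * D"
  have main: "\<bar>e m - e k\<bar> \<le> B * real m powr (a - 1 / 2)" if m: "m = Suc k" for m k
  proof -
    define x where "x = real m"
    have x: "x \<ge> 1" using m by (simp add: x_def)
    \<comment> \<open>\<open>W\<close> dominates exp (x (cos s - 1)) times norm (1 - cis s), one
      summand on each half of the circle.\<close>
    define W where "W = (\<lambda>s::real. s * exp (- (x / 8) * s\<^sup>2) + (2 * pi - s) * exp (- (x / 8) * (2 * pi - s)\<^sup>2))"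
    have I: "((\<lambda>s. A (of_nat m * cis s) * (1 - cis s) / cis s ^ m) has_integral
       (of_real (2 * pi) * (of_nat m ^ k / fact k) * (of_real (e m) - of_real (e k)))) {0..2 * pi}"
      by (rule coefficient_difference_integral[OF sums m])
    have W: "W integrable_on {0..2 * pi}" "integral {0..2 * pi} W \<le> 8 / x"
      using integral_gaussian_moment_le[of "x / 8"] x by (simp_all add: W_def)
    have bd: "norm (A (of_nat m * cis s) * (1 - cis s) / cis s ^ m) \<le> C1 * x powr a * exp x * W s + C2 * exp ((1 - \<epsilon>) * x) * 2"
      if s: "s \<in> {0..2 * pi}" for s
    proof -
      define z where "z = of_nat m * cis s"
      have nz: "norm z = x" by (simp add: z_def x_def norm_mult)
      have Rz: "Re z = x * cos s" by (simp add: z_def x_def)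
      have W0: "W s \<ge> 0" using s by (auto simp: W_def)
      have n2: "norm (1 - cis s) \<le> 2" using norm_triangle_ineq4[of 1 "cis s"] by simp
      have "norm (A (of_nat m * cis s) * (1 - cis s) / cis s ^ m) = norm (A z) * norm (1 - cis s)"
        by (simp add: z_def norm_mult norm_divide norm_power)
      also have "\<dots> \<le> C1 * x powr a * exp x * W s + C2 * exp ((1 - \<epsilon>) * x) * 2"
      proof (cases "\<bar>Arg z\<bar> \<le> \<phi>")
        case True
        have E1: "exp (x * cos s) * norm (1 - cis s) \<le> exp x * W s"
        proof (cases "s \<le> pi")
          case s': True
          have "x * cos s \<le> x * (1 - s\<^sup>2 / 8)" using x s s' by (intro mult_left_mono cos_le_one_minus_square) auto
          also have "\<dots> = x + - (x / 8) * s\<^sup>2" by (simp add: algebra_simps)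
          finally have "exp (x * cos s) \<le> exp x * exp (- (x / 8) * s\<^sup>2)" by (simp flip: exp_add)
          moreover have "norm (1 - cis s) \<le> s" using norm_cis_diff_le[of 0 s] s by simp
          ultimately have "exp (x * cos s) * norm (1 - cis s) \<le> exp x * exp (- (x / 8) * s\<^sup>2) * s" using s by (intro mult_mono) auto
          also have "\<dots> = exp x * (s * exp (- (x / 8) * s\<^sup>2))" by simp
          also have "\<dots> \<le> exp x * W s" using s by (intro mult_left_mono) (auto simp: W_def)
          finally show ?thesis .
        next
          case s': False
          have "cos s = cos (2 * pi - s)" by simp
          also have "\<dots> \<le> 1 - (2 * pi - s)\<^sup>2 / 8" using s s' by (intro cos_le_one_minus_square) auto
          finally have "x * cos s \<le> x * (1 - (2 * pi - s)\<^sup>2 / 8)" using x by (intro mult_left_mono) auto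
          also have "\<dots> = x + - (x / 8) * (2 * pi - s)\<^sup>2" by (simp add: right_diff_distrib)
          finally have "exp (x * cos s) \<le> exp x * exp (- (x / 8) * (2 * pi - s)\<^sup>2)" by (simp flip: exp_add)
          moreover have "norm (1 - cis s) \<le> 2 * pi - s" using norm_cis_diff_le[of "2 * pi" s] s by simp
          ultimately have "exp (x * cos s) * norm (1 - cis s) \<le> exp x * exp (- (x / 8) * (2 * pi - s)\<^sup>2) * (2 * pi - s)" using s by (intro mult_mono) auto
          also have "\<dots> = exp x * ((2 * pi - s) * exp (- (x / 8) * (2 * pi - s)\<^sup>2))" by simp
          also have "\<dots> \<le> exp x * W s" using s by (intro mult_left_mono) (auto simp: W_def)
          finally show ?thesis .
        qed
        have "norm (A z) \<le> exp (x * cos s) * (C1 * x powr a)"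
          using inside[of z] True x unfolding A_def norm_mult by (intro mult_mono) (auto simp: nz Rz)
        hence "norm (A z) * norm (1 - cis s) \<le> exp (x * cos s) * (C1 * x powr a) * norm (1 - cis s)"
          by (intro mult_right_mono) auto
        also have "\<dots> = C1 * x powr a * (exp (x * cos s) * norm (1 - cis s))" by simp
        also have "\<dots> \<le> C1 * x powr a * (exp x * W s)"
          using C by (intro mult_left_mono E1) auto
        finally have "norm (A z) * norm (1 - cis s) \<le> C1 * x powr a * (exp x * W s)" .
        moreover have "C2 * exp ((1 - \<epsilon>) * x) * 2 \<ge> 0" using C by simp
        ultimately show ?thesis by (simp add: mult.assoc)
      next
        case False
        have "norm (A z) \<le> C2 * exp ((1 - \<epsilon>) * x)" using outside[of z] False x by (simp add: A_def nz)
        hence "norm (A z) * norm (1 - cis s) \<le> C2 * exp ((1 - \<epsilon>) * x) * 2" using n2 C by (intro mult_mono) auto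
        moreover have "C1 * x powr a * exp x * W s \<ge> 0" using C W0 by simp
        ultimately show ?thesis by linarith
      qed
      finally show ?thesis .
    qed
    have rhs_int: "(\<lambda>s. C1 * x powr a * exp x * W s + C2 * exp ((1 - \<epsilon>) * x) * 2) integrable_on {0..2 * pi}"
      by (intro integrable_add integrable_on_mult_right W integrable_const_ivl)
    have "norm (of_real (2 * pi) * (of_nat m ^ k / fact k) * (of_real (e m) - of_real (e k)) :: complex)
        \<le> integral {0..2 * pi} (\<lambda>s. C1 * x powr a * exp x * W s + C2 * exp ((1 - \<epsilon>) * x) * 2)"
      using integral_norm_bound_integral[OF has_integral_integrable[OF I] rhs_int bd] integral_unique[OF I] by simp
    also have "\<dots> = C1 * x powr a * exp x * integral {0..2 * pi} W + C2 * exp ((1 - \<epsilon>) * x) * 2 * (2 * pi)"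
      by (subst integral_add) (auto intro!: integrable_on_mult_right W)
    also have "\<dots> \<le> C1 * x powr a * exp x * (8 / x) + C2 * exp ((1 - \<epsilon>) * x) * 2 * (2 * pi)"
      using C by (intro add_mono mult_left_mono W order_refl) auto
    also have "norm (of_real (2 * pi) * (of_nat m ^ k / fact k) * (of_real (e m) - of_real (e k)) :: complex) = 2 * pi * (x ^ k / fact k) * \<bar>e m - e k\<bar>"
      by (simp add: norm_mult norm_divide norm_power x_def flip: of_real_diff)
    finally have "2 * pi * (x ^ k / fact k) * \<bar>e m - e k\<bar> \<le> C1 * x powr a * exp x * (8 / x) + C2 * exp ((1 - \<epsilon>) * x) * 2 * (2 * pi)" .
    hence "(x ^ k / fact k) * \<bar>e m - e k\<bar> * (2 * pi) \<le> (C1 * x powr a * exp x * (8 / x) + 8 * C2 * exp ((1 - \<epsilon>) * x)) * (2 * pi)"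
    proof -
      have "C1 * x powr a * exp x * (8 / x) * 1 \<le> C1 * x powr a * exp x * (8 / x) * (2 * pi)"
        using C x pi_ge_two by (intro mult_left_mono) auto
      moreover have "C2 * exp ((1 - \<epsilon>) * x) * 2 * (2 * pi) \<le> 8 * C2 * exp ((1 - \<epsilon>) * x) * (2 * pi)"
        using C by (intro mult_right_mono) auto
      ultimately show ?thesis using \<open>2 * pi * (x ^ k / fact k) * \<bar>e m - e k\<bar> \<le> _\<close> by (simp add: algebra_simps)
    qed
    hence "(x ^ k / fact k) * \<bar>e m - e k\<bar> \<le> C1 * x powr a * exp x * (8 / x) + 8 * C2 * exp ((1 - \<epsilon>) * x)"
      by (rule mult_right_le_imp_le) simp
    hence "(fact k / x ^ k) * ((x ^ k / fact k) * \<bar>e m - e k\<bar>) \<le> (fact k / x ^ k) * (C1 * x powr a * exp x * (8 / x) + 8 * C2 * exp ((1 - \<epsilon>) * x))"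
      using x by (intro mult_left_mono) auto
    hence "\<bar>e m - e k\<bar> \<le> (fact k / x ^ k) * (C1 * x powr a * exp x * (8 / x) + 8 * C2 * exp ((1 - \<epsilon>) * x))"
      using x by simp
    \<comment> \<open>Since x = m = k + 1, passing to m makes Stirling's bound applicable for k = 0
      as well.\<close>
    also have "fact k / x ^ k = fact m / x ^ m" using x m by (simp add: x_def)
    also have "fact m / x ^ m \<le> exp 1 * sqrt x * exp (- x)"
      using fact_upper_bound[of m] x m by (simp add: x_def pos_divide_le_eq mult_ac)
    also have "exp 1 * sqrt x * exp (- x) * (C1 * x powr a * exp x * (8 / x) + 8 * C2 * exp ((1 - \<epsilon>) * x))
       = exp 1 * 8 * C1 * (x powr (1/2) * x powr a * x powr (-1)) + exp 1 * 8 * C2 * ((x powr (1/2) * exp ((1 - \<epsilon>) * x)) * exp (- x))"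
    proof -
      have "exp (- x) * exp x = 1" by (simp flip: exp_add)
      moreover have "x powr (-1) = 1 / x" "x powr (1/2) = sqrt x" using x by (simp_all add: powr_minus_divide powr_half_sqrt)
      ultimately show ?thesis by (simp add: algebra_simps)
    qed
    also have "x powr (1/2) * x powr a * x powr (-1) = x powr (a - 1/2)"
    proof -
      have "a - 1/2 = 1/2 + a + (-1)" by simp
      thus ?thesis by (simp only: powr_add)
    qed
    also have "(x powr (1/2) * exp ((1 - \<epsilon>) * x)) * exp (- x) \<le> D * x powr (a - 1/2)"
    proof -
      have "(x powr (1/2) * exp ((1 - \<epsilon>) * x)) * exp (- x) \<le> D * exp (1 * x) * exp (- x)"
        using D(2)[OF x] by (intro mult_right_mono) auto
      also have "\<dots> = D * 1" by (simp add: mult.assoc flip: exp_add)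
      also have "\<dots> \<le> D * x powr (a - 1/2)" using D(1) x a by (intro mult_left_mono ge_one_powr_ge_zero) auto
      finally show ?thesis .
    qed
    finally have "\<bar>e m - e k\<bar> \<le> exp 1 * 8 * C1 * x powr (a - 1/2) + exp 1 * 8 * C2 * (D * x powr (a - 1/2))"
      using C x by (simp add: mult_left_mono mult_right_mono)
    thus ?thesis by (simp add: B_def x_def algebra_simps)
  qed
  show ?thesis
  proof (intro exI[of _ "B + \<bar>c\<bar>"] allI)
    fix k
    have "t (Suc k) - t k = (e (Suc k) - e k) + c" by (simp add: e_def algebra_simps)
    hence "\<bar>t (Suc k) - t k\<bar> \<le> \<bar>e (Suc k) - e k\<bar> + \<bar>c\<bar> * 1" by simp
    \<comment> \<open>Because a \<ge> 1/2, the power is at least 1 and can absorb the constant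
      |c|.\<close>
    also have "\<dots> \<le> B * real (Suc k) powr (a - 1/2) + \<bar>c\<bar> * real (Suc k) powr (a - 1/2)"
      using a by (intro add_mono main mult_left_mono ge_one_powr_ge_zero) auto
    finally show "\<bar>t (Suc k) - t k\<bar> \<le> (B + \<bar>c\<bar>) * real (Suc k) powr (a - 1/2)" by (simp add: distrib_right)
  qed
qed

section \<open>The Mellin transform and its continuation\<close>

text \<open>Cauchy's inequality converts the bound on \<open>f\<close> into one on its derivative in
  s. The difference quotients are therefore dominated by B / r, and dominated convergence along
  sequences differentiates under the integral.\<close>

lemma holomorphic_on_integral_dominated:
  fixes f :: "complex \<Rightarrow> 'a \<Rightarrow> complex" and B :: "'a \<Rightarrow> real"
  assumes U: "open U"
    and meas: "\<And>s. s \<in> U \<Longrightarrow> f s \<in> borel_measurable M"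
    and hol: "\<And>x. (\<lambda>s. f s x) holomorphic_on U"
    and B: "integrable M B" and bd: "\<And>s x. s \<in> U \<Longrightarrow> norm (f s x) \<le> B x"
  shows "(\<lambda>s. integral\<^sup>L M (f s)) holomorphic_on U"
proof -
  have int: "integrable M (f s)" if "s \<in> U" for s
    by (rule Bochner_Integration.integrable_bound[OF B meas[OF that]]) (auto intro!: AE_I2 order_trans[OF bd[OF that]])
  have "(\<lambda>s. integral\<^sup>L M (f s)) field_differentiable at s0" if s0: "s0 \<in> U" for s0
  proof -
    obtain r' where r': "r' > 0" "ball s0 r' \<subseteq> U" using U s0 open_contains_ball by blast
    \<comment> \<open>Discs of radius r around points within r of s0 have to stay inside U; this
      needs 2 r < r'.\<close>
    define r where "r = r' / 3"
    have r: "r > 0" using r' by (simp add: r_def)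
    have sub: "w \<in> U" if "dist s0 w \<le> 2 * r" for w
      using r' that by (auto simp: r_def subset_iff)
    define D where "D = (\<lambda>x. deriv (\<lambda>s. f s x) s0)"
    have der: "norm (deriv (\<lambda>s. f s x) w) \<le> B x / r" if w: "dist s0 w \<le> r" for w x
    proof -
      have cb: "cball w r \<subseteq> U"
      proof
        fix y assume "y \<in> cball w r"
        hence "dist s0 y \<le> 2 * r" using w dist_triangle[of s0 y w] by simp
        thus "y \<in> U" by (rule sub)
      qed
      have "norm ((deriv ^^ 1) (\<lambda>s. f s x) w) \<le> fact 1 * B x / r ^ 1"
      proof (rule Cauchy_inequality[OF _ _ r])
        show "(\<lambda>s. f s x) holomorphic_on ball w r" using hol by (rule holomorphic_on_subset) (use cb in auto)
        show "continuous_on (cball w r) (\<lambda>s. f s x)"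
          using holomorphic_on_imp_continuous_on[OF hol] by (rule continuous_on_subset) (use cb in auto)
        fix y assume "norm (w - y) = r"
        thus "norm (f y x) \<le> B x" using cb by (intro bd) (auto simp: dist_norm)
      qed
      thus ?thesis by simp
    qed
    have "((\<lambda>h. (integral\<^sup>L M (f (s0 + h)) - integral\<^sup>L M (f s0)) / h) \<longlongrightarrow> integral\<^sup>L M D) (at 0)"
      unfolding tendsto_at_iff_sequentially comp_def
    proof (intro allI impI)
      fix X :: "nat \<Rightarrow> complex" assume X: "\<forall>i. X i \<in> UNIV - {0}" "X \<longlonglongrightarrow> 0"
      have "eventually (\<lambda>n. norm (X n) < r) sequentially"
        using X(2) r by (intro order_tendstoD(2)[OF tendsto_norm_zero])
      then obtain N where N: "\<And>n. n \<ge> N \<Longrightarrow> norm (X n) < r" by (auto simp: eventually_sequentially)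
      have X0: "X n \<noteq> 0" for n using X(1) by auto
      have inU: "s0 + X (n + N) \<in> U" for n
        using N[of "n + N"] r by (intro sub) (simp add: dist_norm)
      have lim: "(\<lambda>n. (f (s0 + X (n + N)) x - f s0 x) / X (n + N)) \<longlonglongrightarrow> D x" for x
      proof -
        have "((\<lambda>s. f s x) has_field_derivative D x) (at s0)"
          unfolding D_def by (rule holomorphic_derivI[OF hol U s0])
        hence "((\<lambda>h. (f (s0 + h) x - f s0 x) / h) \<longlongrightarrow> D x) (at 0)" by (simp add: DERIV_def)
        hence "(\<lambda>n. (f (s0 + X n) x - f s0 x) / X n) \<longlonglongrightarrow> D x"
          using X unfolding tendsto_at_iff_sequentially comp_def by blast
        thus ?thesis by (rule LIMSEQ_ignore_initial_segment)
      qed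
      have msr: "(\<lambda>x. (f (s0 + X (n + N)) x - f s0 x) / X (n + N)) \<in> borel_measurable M" for n
        using meas[OF inU[of n]] meas[OF s0] by simp
      have "(\<lambda>n. integral\<^sup>L M (\<lambda>x. (f (s0 + X (n + N)) x - f s0 x) / X (n + N))) \<longlonglongrightarrow> integral\<^sup>L M D"
      proof (rule integral_dominated_convergence[where w = "\<lambda>x. B x / r"])
        show "D \<in> borel_measurable M" by (rule borel_measurable_LIMSEQ_metric[OF msr lim])
        show "integrable M (\<lambda>x. B x / r)" using B by simp
        show "AE x in M. (\<lambda>n. (f (s0 + X (n + N)) x - f s0 x) / X (n + N)) \<longlonglongrightarrow> D x" using lim by simp
        fix n
        have "norm ((f (s0 + X (n + N)) x - f s0 x) / X (n + N)) \<le> B x / r" for x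
        proof -
          have "norm (f (s0 + X (n + N)) x - f s0 x) \<le> B x / r * norm (s0 + X (n + N) - s0)"
          proof (rule field_differentiable_bound[of "cball s0 r" _ "deriv (\<lambda>s. f s x)"])
            fix w assume w: "w \<in> cball s0 r"
            have "dist s0 w \<le> 2 * r" using w r by simp
            hence "w \<in> U" by (rule sub)
            show "((\<lambda>s. f s x) has_field_derivative deriv (\<lambda>s. f s x) w) (at w within cball s0 r)"
              by (rule has_field_derivative_at_within[OF holomorphic_derivI[OF hol U \<open>w \<in> U\<close>]])
            show "norm (deriv (\<lambda>s. f s x) w) \<le> B x / r" using w by (intro der) simp
          qed (use N[of "n + N"] r in \<open>auto simp: dist_norm\<close>)
          thus ?thesis using X0[of "n + N"] by (simp add: norm_divide divide_le_eq)
        qed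
        thus "AE x in M. norm ((f (s0 + X (n + N)) x - f s0 x) / X (n + N)) \<le> B x / r" by simp
      qed (rule msr)
      moreover have "integral\<^sup>L M (\<lambda>x. (f (s0 + X (n + N)) x - f s0 x) / X (n + N)) = (integral\<^sup>L M (f (s0 + X (n + N))) - integral\<^sup>L M (f s0)) / X (n + N)" for n
        using int[OF inU[of n]] int[OF s0] by simp
      ultimately have "(\<lambda>n. (integral\<^sup>L M (f (s0 + X (n + N))) - integral\<^sup>L M (f s0)) / X (n + N)) \<longlonglongrightarrow> integral\<^sup>L M D" by (simp only:)
      thus "(\<lambda>n. (integral\<^sup>L M (f (s0 + X n)) - integral\<^sup>L M (f s0)) / X n) \<longlonglongrightarrow> integral\<^sup>L M D"
        by (rule LIMSEQ_offset)
    qed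
    hence "((\<lambda>s. integral\<^sup>L M (f s)) has_field_derivative integral\<^sup>L M D) (at s0)" by (simp add: DERIV_def)
    thus ?thesis by (auto simp: field_differentiable_def)
  qed
  thus ?thesis by (simp add: holomorphic_on_def field_differentiable_at_within)
qed

lemma set_integrable_powr_near_0:
  fixes r :: real
  assumes "r > -1"
  shows "set_integrable lborel {0<..1} (\<lambda>x. x powr r)"
proof -
  have lim: "((\<lambda>x. x powr (r + 1) / (r + 1)) \<longlongrightarrow> 0) (at_right 0)"
    using assms by real_asymp
  \<comment> \<open>The fundamental theorem used here concerns open intervals; the endpoint 2 makes
    room for 1.\<close>
  have "set_integrable lborel (einterval 0 2) (\<lambda>x. x powr r)"
  proof (rule interval_integral_FTC_nonneg(1)[where F = "\<lambda>x. x powr (r + 1) / (r + 1)" and A = 0 and B = "2 powr (r + 1) / (r + 1)"])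
    show "DERIV (\<lambda>x. x powr (r + 1) / (r + 1)) x :> x powr r" if "0 < ereal x" "ereal x < 2" for x
      using that assms by (auto intro!: derivative_eq_intros)
    show "isCont (\<lambda>x. x powr r) x" if "0 < ereal x" "ereal x < 2" for x
      using that by (auto intro!: continuous_intros)
    show "(((\<lambda>x. x powr (r + 1) / (r + 1)) \<circ> real_of_ereal) \<longlongrightarrow> 0) (at_right 0)"
      using lim by (simp add: ereal_tendsto_simps1 zero_ereal_def)
    have "((\<lambda>x::real. x powr (r + 1) / (r + 1)) \<longlongrightarrow> 2 powr (r + 1) / (r + 1)) (at_left 2)"
      using assms by (intro tendsto_intros) auto
    thus "(((\<lambda>x. x powr (r + 1) / (r + 1)) \<circ> real_of_ereal) \<longlongrightarrow> 2 powr (r + 1) / (r + 1)) (at_left 2)"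
      using ereal_tendsto_simps1(1)[of "\<lambda>x. x powr (r + 1) / (r + 1)" 2] by (simp add: numeral_eq_ereal ereal_tendsto_simps1)
  qed auto
  thus ?thesis by (rule set_integrable_subset) (auto simp: einterval_def)
qed

lemma set_integrable_powr_at_top:
  fixes r :: real
  assumes "r < -1"
  shows "set_integrable lborel {1<..} (\<lambda>x. x powr r)"
proof -
  have lim: "((\<lambda>x. x powr (r + 1) / (r + 1)) \<longlongrightarrow> 0) at_top"
    using assms by real_asymp
  have "set_integrable lborel (einterval 1 \<infinity>) (\<lambda>x. x powr r)"
  proof (rule interval_integral_FTC_nonneg(1)[where F = "\<lambda>x. x powr (r + 1) / (r + 1)" and A = "1 powr (r + 1) / (r + 1)" and B = 0])
    show "DERIV (\<lambda>x. x powr (r + 1) / (r + 1)) x :> x powr r" if "1 < ereal x" "ereal x < \<infinity>" for x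
      using that assms by (auto intro!: derivative_eq_intros)
    show "isCont (\<lambda>x. x powr r) x" if "1 < ereal x" "ereal x < \<infinity>" for x
      using that by (auto intro!: continuous_intros)
    show "(((\<lambda>x. x powr (r + 1) / (r + 1)) \<circ> real_of_ereal) \<longlongrightarrow> 0) (at_left \<infinity>)"
      using lim by (simp add: ereal_tendsto_simps1)
    have "((\<lambda>x::real. x powr (r + 1) / (r + 1)) \<longlongrightarrow> 1 powr (r + 1) / (r + 1)) (at_right 1)"
      using assms by (intro tendsto_intros) auto
    thus "(((\<lambda>x. x powr (r + 1) / (r + 1)) \<circ> real_of_ereal) \<longlongrightarrow> 1 powr (r + 1) / (r + 1)) (at_right 1)"
      by (simp add: one_ereal_def ereal_tendsto_simps1)
  qed auto
  moreover have "einterval 1 \<infinity> = {1<..}" by (auto simp: einterval_def)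
  ultimately show ?thesis by simp
qed

lemma set_integral_powr_at_top:
  fixes s :: complex
  assumes "Re s < -1"
  shows "set_integrable lborel {1<..} (\<lambda>x. of_real x powr s)" "(LINT x:{1<..}|lborel. of_real x powr s) = - 1 / (s + 1)"
proof -
  have ei: "einterval 1 \<infinity> = {1<..}" by (auto simp: einterval_def)
  have s1: "s + 1 \<noteq> 0" using assms by (auto simp: complex_eq_iff)
  show int: "set_integrable lborel {1<..} (\<lambda>x. of_real x powr s)"
  proof (rule set_integrable_bound[OF set_integrable_powr_at_top[OF assms]])
    show "set_borel_measurable lborel {1<..} (\<lambda>x. complex_of_real x powr s)"
      unfolding set_borel_measurable_def
      using borel_measurable_continuous_on_indicator[of "{1<..}" "\<lambda>x. complex_of_real x powr s"]
      by (auto intro!: continuous_intros)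
  qed (auto simp: norm_powr_real_powr)
  have "((\<lambda>x. x powr (Re s + 1)) \<longlongrightarrow> 0) at_top" using assms by real_asymp
  hence "((\<lambda>x. norm (complex_of_real x powr (s + 1) / (s + 1))) \<longlongrightarrow> 0 / norm (s + 1)) at_top"
    unfolding norm_divide
    by (intro tendsto_divide tendsto_const)
       (auto elim!: Lim_transform_eventually intro!: eventually_mono[OF eventually_ge_at_top[of 0]] simp: norm_powr_real_powr s1)
  hence lim: "((\<lambda>x. complex_of_real x powr (s + 1) / (s + 1)) \<longlongrightarrow> 0) at_top"
    by (simp add: tendsto_norm_zero_iff)
  have "(LBINT x=1..\<infinity>. complex_of_real x powr s) = 0 - 1 / (s + 1)"
  proof (rule interval_integral_FTC_integrable[where F = "\<lambda>x. complex_of_real x powr (s + 1) / (s + 1)"])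
    show "((\<lambda>x. complex_of_real x powr (s + 1) / (s + 1)) has_vector_derivative complex_of_real x powr s) (at x)" if "1 < ereal x" "ereal x < \<infinity>" for x
    proof -
      have "((\<lambda>z. z powr (s + 1) / (s + 1)) has_field_derivative complex_of_real x powr s) (at (of_real x))"
        using that s1 by (auto intro!: derivative_eq_intros)
      from has_vector_derivative_real_field[OF this] show ?thesis .
    qed
    show "isCont (\<lambda>x. complex_of_real x powr s) x" if "1 < ereal x" "ereal x < \<infinity>" for x
      using that by (auto intro!: continuous_intros)
    show "set_integrable lborel (einterval 1 \<infinity>) (\<lambda>x. complex_of_real x powr s)" using int by (simp add: ei)
    have "((\<lambda>x::real. complex_of_real x powr (s + 1) / (s + 1)) \<longlongrightarrow> of_real 1 powr (s + 1) / (s + 1)) (at_right 1)"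
      using s1 by (intro tendsto_intros) auto
    thus "(((\<lambda>x. complex_of_real x powr (s + 1) / (s + 1)) \<circ> real_of_ereal) \<longlongrightarrow> 1 / (s + 1)) (at_right 1)"
      by (simp add: one_ereal_def ereal_tendsto_simps1)
    show "(((\<lambda>x. complex_of_real x powr (s + 1) / (s + 1)) \<circ> real_of_ereal) \<longlongrightarrow> 0) (at_left \<infinity>)"
      using lim by (simp add: ereal_tendsto_simps1)
  qed auto
  thus "(LINT x:{1<..}|lborel. of_real x powr s) = - 1 / (s + 1)"
    by (simp add: interval_lebesgue_integral_def ei)
qed

text \<open>For c \<noteq> 0 this keeps any strip of convergence to the left of Re s = -1. The
  reason is comparison with 1 / x, whose integral from 2 to 2 exp n is n.\<close>

lemma not_set_integrable_powr_at_top: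
  fixes s :: complex
  assumes "Re s \<ge> -1"
  shows "\<not> set_integrable lborel {1<..} (\<lambda>x. of_real x powr s)"
proof
  assume "set_integrable lborel {1<..} (\<lambda>x. of_real x powr s)"
  hence int: "set_integrable lborel {1<..} (\<lambda>x. inverse x :: real)"
  proof (rule set_integrable_bound)
    show "set_borel_measurable lborel {1<..} (\<lambda>x. inverse x :: real)"
      unfolding set_borel_measurable_def
      using borel_measurable_continuous_on_indicator[of "{1<..}" "\<lambda>x. inverse x :: real"]
      by (auto intro!: continuous_intros)
    show "AE x in lborel. x \<in> {1<..} \<longrightarrow> norm (inverse x :: real) \<le> norm (of_real x powr s)"
    proof (intro AE_I2 impI)
      fix x :: real assume x: "x \<in> {1<..}"
      hence "inverse x = x powr (-1)" by (simp add: powr_minus)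
      also have "\<dots> \<le> x powr Re s" using x assms by (intro powr_mono) auto
      finally show "norm (inverse x :: real) \<le> norm (of_real x powr s)" using x by (simp add: norm_powr_real_powr)
    qed
  qed
  define I where "I = (LINT x:{1<..}|lborel. inverse x :: real)"
  have "real n \<le> I" for n :: nat
  proof -
    have sub: "set_integrable lborel {2..2 * exp (real n)} (\<lambda>x. inverse x :: real)"
      by (rule set_integrable_subset[OF int]) auto
    have "((\<lambda>x. inverse x) has_integral ln (2 * exp (real n)) - ln 2) {2..2 * exp (real n)}"
      by (rule fundamental_theorem_of_calculus)
         (auto intro!: derivative_eq_intros has_vector_derivative_at_within simp: has_real_derivative_iff_has_vector_derivative[symmetric] inverse_eq_divide)
    hence "(LINT x:{2..2 * exp (real n)}|lborel. inverse x :: real) = real n"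
      using set_borel_integral_eq_integral(2)[OF sub] by (simp add: integral_unique ln_mult)
    moreover have "(LINT x:{2..2 * exp (real n)}|lborel. inverse x :: real) \<le> I"
      unfolding I_def set_lebesgue_integral_def
      using sub int unfolding set_integrable_def
      by (intro integral_mono) (auto simp: indicator_def)
    ultimately show ?thesis by simp
  qed
  thus False using reals_Archimedean2[of I] by (meson linorder_not_less)
qed

text \<open>With removable singularities filled in, the difference is constant on the connected set
  \<open>D\<close> and vanishes on \<open>U\<close>. Agreement is claimed on punctured
  neighbourhoods because \<open>H\<close> may have arbitrary values at isolated points.\<close>

lemma meromorphic_identity:
  assumes D: "open D" "connected D" and G: "G nicely_meromorphic_on D" and H: "H meromorphic_on D"
    and U: "open U" "U \<noteq> {}" "U \<subseteq> D" "\<And>s. s \<in> U \<Longrightarrow> G s = H s" and z: "z \<in> D"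
  shows "eventually (\<lambda>w. G w = H w) (at z)"
proof -
  define f where "f = (\<lambda>s. G s - H s)"
  have f: "f meromorphic_on D"
    unfolding f_def using G H by (intro meromorphic_intros) (auto simp: nicely_meromorphic_on_def)
  have "remove_sings f s = 0" if "s \<in> U" for s
  proof (rule remove_sings_eqI, rule tendsto_eventually)
    show "eventually (\<lambda>w. f w = 0) (at s)"
      using eventually_at_in_open'[OF U(1) that] by eventually_elim (use U(4) in \<open>auto simp: f_def\<close>)
  qed
  hence "remove_sings f constant_on U" by (auto simp: constant_on_def)
  from constant_on_extend_nicely_meromorphic_on[OF remove_sings_nicely_meromorphic[OF f] this U(1) D U(2,3)]
  obtain c where c: "\<And>s. s \<in> D \<Longrightarrow> remove_sings f s = c" by (auto simp: constant_on_def)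
  have "c = 0" using c \<open>\<And>s. s \<in> U \<Longrightarrow> remove_sings f s = 0\<close> U by (metis all_not_in_conv subsetD)
  have "isolated_singularity_at f z" 
    by (rule meromorphic_on_isolated_singularity, rule meromorphic_on_subset[OF f]) (use z in auto)
  from eventually_remove_sings_eq_at[OF this] eventually_at_in_open'[OF D(1) z]
  show ?thesis by eventually_elim (use c \<open>c = 0\<close> in \<open>auto simp: f_def\<close>)
qed

text \<open>The linear term is removed only beyond 1, where it obstructs convergence. Its own
  contribution there is - c / (s + 1), so this is the Mellin transform without its pole at
  -1.\<close>

definition mellin_finite_part :: "(complex \<Rightarrow> complex) \<Rightarrow> real \<Rightarrow> complex \<Rightarrow> complex" where
  "mellin_finite_part g c s = (LINT x:{0<..1}|lborel. mellin_integrand g s x) +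
     (LINT x:{1<..}|lborel. mellin_integrand (\<lambda>z. g z - of_real c * z) s x)"

lemma norm_mellin_integrand: "x > 0 \<Longrightarrow> norm (mellin_integrand k s x) = norm (k (of_real x)) * x powr (Re s - 1)"
  by (simp add: mellin_integrand_def norm_mult norm_powr_real_powr)

lemma mellin_integrand_measurable:
  assumes "continuous_on UNIV k" "S \<subseteq> {0<..}" "S \<in> sets borel"
  shows "(\<lambda>x. indicator S x *\<^sub>R mellin_integrand k s x) \<in> borel_measurable lborel"
proof -
  have "continuous_on S (mellin_integrand k s)"
    unfolding mellin_integrand_def using assms(2)
    by (intro continuous_intros continuous_on_compose2[OF assms(1)]) auto
  from borel_measurable_continuous_on_indicator[OF assms(3) this] show ?thesis by simp
qed

lemma open_vstrip: "open (vstrip a b)" and connected_vstrip: "connected (vstrip a b)"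
proof -
  have eq: "vstrip a b = {s. Re s > a} \<inter> {s. Re s < b}" by (auto simp: vstrip_def)
  show "open (vstrip a b)" unfolding eq by (intro open_Int open_halfspace_Re_gt open_halfspace_Re_lt)
  show "connected (vstrip a b)" unfolding eq
    by (intro convex_connected convex_Int convex_halfspace_Re_gt convex_halfspace_Re_lt)
qed

lemma holomorphic_mellin_part:
  assumes k: "continuous_on UNIV k" and S: "S \<subseteq> {0<..}" "S \<in> sets borel" and U: "open U"
    and B: "set_integrable lborel S B" and bd: "\<And>s x. s \<in> U \<Longrightarrow> x \<in> S \<Longrightarrow> norm (mellin_integrand k s x) \<le> B x"
  shows "(\<lambda>s. LINT x:S|lborel. mellin_integrand k s x) holomorphic_on U"
  unfolding set_lebesgue_integral_def
proof (rule holomorphic_on_integral_dominated[OF U])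
  show "(\<lambda>x. indicator S x *\<^sub>R mellin_integrand k s x) \<in> borel_measurable lborel" for s
    by (rule mellin_integrand_measurable[OF k S])
  show "(\<lambda>s. indicator S x *\<^sub>R mellin_integrand k s x) holomorphic_on U" for x
  proof (cases "x \<in> S")
    case True
    hence "x > 0" using S by auto
    thus ?thesis using True unfolding mellin_integrand_def by (auto intro!: holomorphic_intros)
  qed simp
  show "integrable lborel (\<lambda>x. indicator S x *\<^sub>R B x)" using B by (simp add: set_integrable_def)
  show "norm (indicator S x *\<^sub>R mellin_integrand k s x) \<le> indicator S x *\<^sub>R B x" if "s \<in> U" for s x
    using bd[OF that, of x] by (simp add: indicator_def)
qed

text \<open>Vanishing to second order at 0 opens the strip down to -2, growth of g - c z below every
  exponent a > \<alpha> opens it up to - \<alpha>, and \<alpha> < 1 places the line Re s = -1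
  inside.\<close>

context
  fixes g :: "complex \<Rightarrow> complex" and c \<alpha> C0 :: real
  assumes hol: "g holomorphic_on UNIV" and \<alpha>: "\<alpha> < 1"
    and near0: "\<And>x. 0 < x \<Longrightarrow> x \<le> 1 \<Longrightarrow> norm (g (of_real x)) \<le> C0 * x\<^sup>2"
    and at_top: "\<And>a. a > \<alpha> \<Longrightarrow> \<exists>C\<ge>0. \<forall>x\<ge>1. norm (g (of_real x) - of_real c * of_real x) \<le> C * x powr a"
begin

lemma cont_g: "continuous_on UNIV g" "continuous_on UNIV (\<lambda>z. g z - of_real c * z)"
  using holomorphic_on_imp_continuous_on[OF hol] by (auto intro!: continuous_intros)

lemma mellin_bound_near_0:
  assumes "\<sigma> \<le> Re s" "x \<in> {0<..1}"
  shows "norm (mellin_integrand g s x) \<le> C0 * x powr (\<sigma> + 1)"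
proof -
  have x: "0 < x" "x \<le> 1" using assms by auto
  have C0: "C0 \<ge> 0" using near0[of 1] norm_ge_zero[of "g (of_real 1)"] by (simp del: norm_ge_zero)
  have "norm (mellin_integrand g s x) \<le> C0 * x\<^sup>2 * x powr (Re s - 1)"
    unfolding norm_mellin_integrand[OF x(1)] using near0[OF x] by (intro mult_right_mono) auto
  also have "\<dots> = C0 * x powr (Re s + 1)"
  proof -
    have "Re s + 1 = 2 + (Re s - 1)" by simp
    hence "x powr (Re s + 1) = x powr 2 * x powr (Re s - 1)" by (simp only: powr_add)
    thus ?thesis using x by simp
  qed
  also have "\<dots> \<le> C0 * x powr (\<sigma> + 1)" using x assms C0 by (intro mult_left_mono powr_mono') auto
  finally show ?thesis .
qed

lemma mellin_near_0:
  assumes "Re s > -2" shows "set_integrable lborel {0<..1} (mellin_integrand g s)"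
  unfolding set_integrable_def
proof (rule Bochner_Integration.integrable_bound)
  show "integrable lborel (\<lambda>x. indicator {0<..1} x *\<^sub>R (C0 * x powr (Re s + 1)))"
    using set_integrable_mult_right[of C0, OF set_integrable_powr_near_0[of "Re s + 1"]] assms
    by (simp add: set_integrable_def)
  show "(\<lambda>x. indicator {0<..1} x *\<^sub>R mellin_integrand g s x) \<in> borel_measurable lborel"
    by (rule mellin_integrand_measurable[OF cont_g(1)]) auto
  show "AE x in lborel. norm (indicator {0<..1} x *\<^sub>R mellin_integrand g s x) \<le> norm (indicator {0<..1} x *\<^sub>R (C0 * x powr (Re s + 1)))"
    using mellin_bound_near_0[OF order_refl, of _ s] by (intro AE_I2) (auto simp: indicator_def intro: order_trans[OF _ abs_ge_self])
qed

lemma mellin_near_0_holomorphic: "(\<lambda>s. LINT x:{0<..1}|lborel. mellin_integrand g s x) holomorphic_on {s. Re s > -2}"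
proof -
  have "(\<lambda>s. LINT x:{0<..1}|lborel. mellin_integrand g s x) field_differentiable at s0" if "Re s0 > -2" for s0
  proof -
    \<comment> \<open>Halfway between the boundary -2 and Re s0: a single dominating function works
      only on a half-plane that keeps its distance from -2.\<close>
    define \<sigma> where "\<sigma> = (Re s0 - 2) / 2"
    have \<sigma>: "-2 < \<sigma>" "\<sigma> < Re s0" using that by (auto simp: \<sigma>_def)
    have "(\<lambda>s. LINT x:{0<..1}|lborel. mellin_integrand g s x) holomorphic_on {s. Re s > \<sigma>}"
    proof (rule holomorphic_mellin_part[OF cont_g(1)])
      show "set_integrable lborel {0<..1} (\<lambda>x. C0 * x powr (\<sigma> + 1))"
        by (intro set_integrable_mult_right set_integrable_powr_near_0) (use \<sigma> in auto)
    qed (auto intro!: mellin_bound_near_0 open_halfspace_Re_gt)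
    thus ?thesis by (rule holomorphic_on_imp_differentiable_at) (use \<sigma> in \<open>auto simp: open_halfspace_Re_gt\<close>)
  qed
  thus ?thesis by (auto simp: holomorphic_on_def intro: field_differentiable_at_within)
qed

lemma mellin_at_top_bound:
  assumes "\<sigma> < - \<alpha>"
  obtains B where "set_integrable lborel {1<..} B" "\<And>s x. Re s \<le> \<sigma> \<Longrightarrow> x \<in> {1<..} \<Longrightarrow> norm (mellin_integrand (\<lambda>z. g z - of_real c * z) s x) \<le> B x"
proof -
  define a where "a = (\<alpha> - \<sigma>) / 2"
  have a: "\<alpha> < a" "a < - \<sigma>" using assms by (auto simp: a_def)
  obtain C where C: "C \<ge> 0" "\<And>x. x \<ge> 1 \<Longrightarrow> norm (g (of_real x) - of_real c * of_real x) \<le> C * x powr a"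
    using at_top[OF a(1)] by blast
  show thesis
  proof (rule that)
    show "set_integrable lborel {1<..} (\<lambda>x. C * x powr (a + (\<sigma> - 1)))"
      by (intro set_integrable_mult_right set_integrable_powr_at_top) (use a in auto)
    fix s :: complex and x :: real assume s: "Re s \<le> \<sigma>" and "x \<in> {1<..}"
    hence x: "x > 1" by auto
    have "norm (mellin_integrand (\<lambda>z. g z - of_real c * z) s x) \<le> C * x powr a * x powr (\<sigma> - 1)"
      using x s C by (subst norm_mellin_integrand) (auto intro!: mult_mono C(2) powr_mono)
    thus "norm (mellin_integrand (\<lambda>z. g z - of_real c * z) s x) \<le> C * x powr (a + (\<sigma> - 1))"
      by (simp only: powr_add mult.assoc)
  qed
qed

lemma mellin_at_top:
  assumes "Re s < - \<alpha>" shows "set_integrable lborel {1<..} (mellin_integrand (\<lambda>z. g z - of_real c * z) s)"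
proof -
  obtain B where B: "set_integrable lborel {1<..} B" "\<And>x. x \<in> {1<..} \<Longrightarrow> norm (mellin_integrand (\<lambda>z. g z - of_real c * z) s x) \<le> B x"
    using mellin_at_top_bound[OF assms] by (metis order_refl)
  show ?thesis unfolding set_integrable_def
  proof (rule Bochner_Integration.integrable_bound)
    show "integrable lborel (\<lambda>x. indicator {1<..} x *\<^sub>R B x)" using B(1) by (simp add: set_integrable_def)
    show "(\<lambda>x. indicator {1<..} x *\<^sub>R mellin_integrand (\<lambda>z. g z - of_real c * z) s x) \<in> borel_measurable lborel"
      by (rule mellin_integrand_measurable[OF cont_g(2)]) auto
    show "AE x in lborel. norm (indicator {1<..} x *\<^sub>R mellin_integrand (\<lambda>z. g z - of_real c * z) s x) \<le> norm (indicator {1<..} x *\<^sub>R B x)"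
      using B(2) by (intro AE_I2) (auto simp: indicator_def intro: order_trans[OF _ abs_ge_self])
  qed
qed

lemma mellin_at_top_holomorphic: "(\<lambda>s. LINT x:{1<..}|lborel. mellin_integrand (\<lambda>z. g z - of_real c * z) s x) holomorphic_on {s. Re s < - \<alpha>}"
proof -
  have "(\<lambda>s. LINT x:{1<..}|lborel. mellin_integrand (\<lambda>z. g z - of_real c * z) s x) field_differentiable at s0" if "Re s0 < - \<alpha>" for s0
  proof -
    define \<sigma> where "\<sigma> = (Re s0 - \<alpha>) / 2"
    have \<sigma>: "\<sigma> < - \<alpha>" "Re s0 < \<sigma>" using that by (auto simp: \<sigma>_def)
    obtain B where B: "set_integrable lborel {1<..} B" "\<And>s x. Re s \<le> \<sigma> \<Longrightarrow> x \<in> {1<..} \<Longrightarrow> norm (mellin_integrand (\<lambda>z. g z - of_real c * z) s x) \<le> B x"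
      using mellin_at_top_bound[OF \<sigma>(1)] by blast
    have "(\<lambda>s. LINT x:{1<..}|lborel. mellin_integrand (\<lambda>z. g z - of_real c * z) s x) holomorphic_on {s. Re s < \<sigma>}"
      by (rule holomorphic_mellin_part[OF cont_g(2) _ _ _ B(1)]) (auto intro!: B(2) open_halfspace_Re_lt)
    thus ?thesis by (rule holomorphic_on_imp_differentiable_at) (use \<sigma> in \<open>auto simp: open_halfspace_Re_lt\<close>)
  qed
  thus ?thesis by (auto simp: holomorphic_on_def intro: field_differentiable_at_within)
qed

lemma mellin_finite_part_holomorphic: "mellin_finite_part g c holomorphic_on vstrip (- 2) (- \<alpha>)"
  unfolding mellin_finite_part_def[abs_def]
  by (intro holomorphic_on_add holomorphic_on_subset[OF mellin_near_0_holomorphic] holomorphic_on_subset[OF mellin_at_top_holomorphic])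
     (auto simp: vstrip_def)

lemma mellin_integrand_split:
  assumes "x > 0"
  shows "mellin_integrand g s x = mellin_integrand (\<lambda>z. g z - of_real c * z) s x + of_real c * of_real x powr s"
proof -
  have "complex_of_real x powr s = of_real x * of_real x powr (s - 1)"
    using assms powr_add[of "complex_of_real x" 1 "s - 1"] by simp
  thus ?thesis by (simp add: mellin_integrand_def algebra_simps)
qed

text \<open>The exact region of convergence is needed because \<open>is_mellin_continuation\<close>
  allows any strip. The forward direction shows that on each admissible strip the Mellin integral is
  given by the explicit formula.\<close>

lemma set_integrable_mellin_iff:
  assumes s: "s \<in> vstrip (- 2) (- \<alpha>)"
  shows "set_integrable lborel {0<..} (mellin_integrand g s) \<longleftrightarrow> c = 0 \<or> Re s < -1"
    and "c = 0 \<or> Re s < -1 \<Longrightarrow> mellin g s = mellin_finite_part g c s - of_real c / (s + 1)"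
proof -
  have s': "Re s > -2" "Re s < - \<alpha>" using s by (auto simp: vstrip_def)
  have un: "{0::real<..} = {0<..1} \<union> {1<..}" by auto
  have int_c: "set_integrable lborel {1<..} (\<lambda>x. of_real c * of_real x powr s)" if "c = 0 \<or> Re s < -1"
  proof (cases "c = 0")
    case True
    thus ?thesis by (simp add: set_integrable_def)
  next
    case False
    thus ?thesis using that by (intro set_integrable_mult_right set_integral_powr_at_top) auto
  qed
  have cong1: "set_integrable lborel {1<..} (mellin_integrand g s) \<longleftrightarrow>
     set_integrable lborel {1<..} (\<lambda>x. mellin_integrand (\<lambda>z. g z - of_real c * z) s x + of_real c * of_real x powr s)"
    by (rule set_integrable_cong) (auto simp: mellin_integrand_split)
  have int1: "set_integrable lborel {1<..} (mellin_integrand g s)" if "c = 0 \<or> Re s < -1"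
    unfolding cong1 using mellin_at_top[OF s'(2)] int_c[OF that] by (rule set_integral_add)
  show "set_integrable lborel {0<..} (mellin_integrand g s) \<longleftrightarrow> c = 0 \<or> Re s < -1"
  proof
    assume "c = 0 \<or> Re s < -1"
    thus "set_integrable lborel {0<..} (mellin_integrand g s)"
      unfolding un by (intro set_integrable_Un mellin_near_0 s' int1) auto
  next
    assume int: "set_integrable lborel {0<..} (mellin_integrand g s)"
    have "set_integrable lborel {1<..} (mellin_integrand g s)" by (rule set_integrable_subset[OF int]) auto
    from set_integral_diff(1)[OF this mellin_at_top[OF s'(2)]]
    have "set_integrable lborel {1<..} (\<lambda>x. of_real c * complex_of_real x powr s)"
      by (rule iffD1[OF set_integrable_cong, rotated -1]) (auto simp: mellin_integrand_split)
    hence int': "set_integrable lborel {1<..} (\<lambda>x. inverse (of_real c) * (of_real c * complex_of_real x powr s))"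
      by (rule set_integrable_mult_right)
    show "c = 0 \<or> Re s < -1"
    proof (rule ccontr)
      assume n: "\<not> (c = 0 \<or> Re s < -1)"
      hence "set_integrable lborel {1<..} (\<lambda>x. complex_of_real x powr s)" using int' by simp
      thus False using not_set_integrable_powr_at_top[of s] n by auto
    qed
  qed
  assume c: "c = 0 \<or> Re s < -1"
  have "mellin g s = (LINT x:{0<..1}|lborel. mellin_integrand g s x) + (LINT x:{1<..}|lborel. mellin_integrand g s x)"
    unfolding mellin_def un by (rule set_integral_Un) (auto intro!: mellin_near_0 s' int1 c)
  also have "(LINT x:{1<..}|lborel. mellin_integrand g s x) =
     (LINT x:{1<..}|lborel. mellin_integrand (\<lambda>z. g z - of_real c * z) s x + of_real c * of_real x powr s)"
    by (rule set_lebesgue_integral_cong) (auto simp: mellin_integrand_split)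
  also have "\<dots> = (LINT x:{1<..}|lborel. mellin_integrand (\<lambda>z. g z - of_real c * z) s x) + (LINT x:{1<..}|lborel. of_real c * of_real x powr s)"
    by (rule set_integral_add[OF mellin_at_top[OF s'(2)] int_c[OF c]])
  also have "(LINT x:{1<..}|lborel. of_real c * complex_of_real x powr s) = - of_real c / (s + 1)"
  proof (cases "c = 0")
    case False
    thus ?thesis using c set_integral_powr_at_top(2)[of s] by simp
  qed (simp add: set_lebesgue_integral_def)
  finally show "mellin g s = mellin_finite_part g c s - of_real c / (s + 1)"
    by (simp add: mellin_finite_part_def)
qed

text \<open>The explicit formula provides a witness for the choice operator, and the identity
  theorem shows that every other choice agrees with it near s. The value at s itself is then forced:
  a finite limit excludes a pole, and a nicely meromorphic function equals its limit. For c = 0 the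
  quotient is 0 even at s = -1.\<close>

lemma mellin_continuation_eq:
  assumes s: "s \<in> vstrip (- 2) (- \<alpha>)" and cs: "c = 0 \<or> s \<noteq> -1"
  shows "mellin_continuation g (vstrip (- 2) (- \<alpha>)) s = mellin_finite_part g c s - of_real c / (s + 1)"
proof -
  define D where "D = vstrip (- 2) (- \<alpha>)"
  define H where "H = (\<lambda>s. mellin_finite_part g c s - of_real c / (s + 1))"
  have D: "open D" "connected D" by (auto simp: D_def open_vstrip connected_vstrip)
  have P: "mellin_finite_part g c analytic_on D"
    using mellin_finite_part_holomorphic D by (simp add: D_def analytic_on_open)
  have H: "H meromorphic_on D"
    unfolding H_def by (intro meromorphic_intros analytic_on_imp_meromorphic_on P) (auto intro!: analytic_intros)
  have H_an: "H analytic_on {s}" if "s \<in> D" "c = 0 \<or> s \<noteq> -1" for s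
  proof (cases "c = 0")
    case True
    thus ?thesis using analytic_on_subset[OF P, of "{s}"] that by (simp add: H_def)
  next
    case False
    hence "s + 1 \<noteq> 0" using that by (auto simp: add_eq_0_iff2)
    thus ?thesis unfolding H_def using that by (intro analytic_intros analytic_on_subset[OF P]) auto
  qed
  \<comment> \<open>A nicely meromorphic function must take the value 0 at its poles, hence the
    correction at -1 when c \<noteq> 0.\<close>
  have ex: "is_mellin_continuation g D (\<lambda>s. if c \<noteq> 0 \<and> s = -1 then 0 else H s)" (is "is_mellin_continuation g D ?H")
    unfolding is_mellin_continuation_def
  proof (rule conjI[rotated], rule exI[of _ "-2"], rule exI[of _ "-1"], intro conjI ballI)
    show "?H nicely_meromorphic_on D"
    proof (cases "c = 0")
      case True
      have "H analytic_on D" using H_an True by (subst analytic_on_analytic_at) auto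
      thus ?thesis using True by (simp add: analytic_on_imp_nicely_meromorphic_on)
    next
      case False
      have ev: "eventually (\<lambda>w. ?H w = H w) (at z)" for z
        by (rule eventually_mono[OF eventually_neq_at_within[of "-1"]]) auto
      show ?thesis unfolding nicely_meromorphic_on_def
      proof (intro conjI ballI)
        show "?H meromorphic_on D"
          by (rule iffD2[OF meromorphic_on_cong H]) (use ev in auto)
        fix z assume z: "z \<in> D"
        show "is_pole ?H z \<and> ?H z = 0 \<or> ?H \<midarrow>z\<rightarrow> ?H z"
        proof (cases "z = -1")
          case True
          have l1: "mellin_finite_part g c \<midarrow>-1\<rightarrow> mellin_finite_part g c (-1)"
            using analytic_at_imp_isCont[OF analytic_on_subset[OF P, of "{-1}"]] z True by (simp add: isCont_def)
          have "is_pole (\<lambda>s. - complex_of_real c / (s + 1)) (-1)"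
            using False is_pole_basic[of "\<lambda>_. - complex_of_real c" UNIV "-1" 1] by simp
          hence "filterlim (\<lambda>s. - complex_of_real c / (s + 1)) at_infinity (at (-1))" by (simp only: is_pole_def)
          from tendsto_add_filterlim_at_infinity[OF l1 this] have "is_pole H (-1)"
            by (simp add: is_pole_def H_def)
          hence "is_pole ?H z" using True is_pole_cong[OF ev refl, of "-1"] by simp
          thus ?thesis using True False by simp
        next
          case zn: False
          have "H \<midarrow>z\<rightarrow> H z" using analytic_at_imp_isCont[OF H_an[OF z]] zn by (simp add: isCont_def)
          hence "?H \<midarrow>z\<rightarrow> H z" by (rule iffD2[OF tendsto_cong[OF ev]])
          thus ?thesis using zn by simp
        qed
      qed
    qed
    show "(-2::real) < -1" "vstrip (- 2) (- 1) \<subseteq> D" using \<alpha> by (auto simp: D_def vstrip_def)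
    fix s assume "s \<in> vstrip (- 2) (- 1)"
    hence s: "s \<in> vstrip (- 2) (- \<alpha>)" "Re s < -1" using \<alpha> by (auto simp: vstrip_def)
    show "set_integrable lborel {0<..} (mellin_integrand g s)" using set_integrable_mellin_iff(1)[OF s(1)] s(2) by simp
    show "?H s = mellin g s" using set_integrable_mellin_iff(2)[OF s(1)] s(2) by (auto simp: H_def)
  qed
  define G where "G = mellin_continuation g D"
  have "is_mellin_continuation g D G"
    unfolding G_def mellin_continuation_def using ex by (rule someI[of "is_mellin_continuation g D"])
  then obtain a b where G: "G nicely_meromorphic_on D" and ab: "a < b" "vstrip a b \<subseteq> D"
    and Gab: "\<And>s. s \<in> vstrip a b \<Longrightarrow> set_integrable lborel {0<..} (mellin_integrand g s)" "\<And>s. s \<in> vstrip a b \<Longrightarrow> G s = mellin g s"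
    unfolding is_mellin_continuation_def by blast
  have "complex_of_real ((a + b) / 2) \<in> vstrip a b" using ab(1) by (auto simp: vstrip_def field_simps)
  hence ne: "vstrip a b \<noteq> {}" by blast
  have GH: "G s = H s" if "s \<in> vstrip a b" for s
  proof -
    have s: "s \<in> vstrip (- 2) (- \<alpha>)" using that ab(2) by (auto simp: D_def)
    show ?thesis using set_integrable_mellin_iff[OF s] Gab[OF that] by (simp add: H_def)
  qed
  have sD: "s \<in> D" using s by (simp add: D_def)
  have ev: "eventually (\<lambda>w. G w = H w) (at s)"
    by (rule meromorphic_identity[OF D G H open_vstrip ne ab(2) GH sD])
  have "H \<midarrow>s\<rightarrow> H s" using analytic_at_imp_isCont[OF H_an[OF sD cs]] by (simp add: isCont_def)
  hence lim: "G \<midarrow>s\<rightarrow> H s" by (rule iffD2[OF tendsto_cong[OF ev]])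
  have "G s = H s"
  proof -
    have "(is_pole G s \<and> G s = 0) \<or> G \<midarrow>s\<rightarrow> G s" using G sD by (auto simp: nicely_meromorphic_on_def)
    thus ?thesis
    proof
      assume "is_pole G s \<and> G s = 0"
      hence "\<not> G \<midarrow>s\<rightarrow> H s" using not_tendsto_and_filterlim_at_infinity[of "at s" G] by (auto simp: is_pole_def)
      thus ?thesis using lim by blast
    next
      assume "G \<midarrow>s\<rightarrow> G s"
      thus ?thesis using lim LIM_unique by blast
    qed
  qed
  thus ?thesis by (simp add: G_def H_def D_def)
qed

end

section \<open>From Mellin integrals to the logarithmic variable\<close>

lemma tendsto_set_integral_exhaust_0:
  fixes f :: "real \<Rightarrow> complex"
  assumes f: "set_integrable lborel {0<..1} f"
  shows "((\<lambda>t. LINT x:{exp (- t)..1}|lborel. f x) \<longlongrightarrow> (LINT x:{0<..1}|lborel. f x)) at_top"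
  unfolding set_lebesgue_integral_def
proof (rule integral_dominated_convergence_at_top[where w = "\<lambda>x. norm (indicator {0<..1} x *\<^sub>R f x)"])
  have int: "integrable lborel (\<lambda>x. indicator {0<..1} x *\<^sub>R f x)" using f by (simp add: set_integrable_def)
  show "(\<lambda>x. indicator {0<..1} x *\<^sub>R f x) \<in> borel_measurable lborel"
    using borel_measurable_integrable[OF int] .
  show "(\<lambda>x. indicator {exp (- t)..1} x *\<^sub>R f x) \<in> borel_measurable lborel" for t
  proof -
    have "set_integrable lborel {exp (- t)..1} f"
      by (rule set_integrable_subset[OF f]) (auto intro: less_le_trans[OF exp_gt_zero])
    thus ?thesis unfolding set_integrable_def by (rule borel_measurable_integrable)
  qed
  show "integrable lborel (\<lambda>x. norm (indicator {0<..1} x *\<^sub>R f x))" using int by (rule integrable_norm)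
  show "AE x in lborel. ((\<lambda>t. indicator {exp (- t)..1} x *\<^sub>R f x) \<longlongrightarrow> indicator {0<..1} x *\<^sub>R f x) at_top"
  proof (rule AE_I2, rule tendsto_eventually)
    fix x :: real
    show "eventually (\<lambda>t. indicator {exp (- t)..1} x *\<^sub>R f x = indicator {0<..1} x *\<^sub>R f x) at_top"
    proof (cases "x > 0")
      case True
      show ?thesis using eventually_ge_at_top[of "- ln x"]
      proof eventually_elim
        case (elim t)
        hence "exp (- t) \<le> exp (ln x)" by (subst exp_le_cancel_iff) simp
        hence "exp (- t) \<le> x" using True by simp
        thus ?case using True by (simp add: indicator_def)
      qed
    next
      case False
      have "\<not> exp (- t) \<le> x" for t using False exp_gt_zero[of "- t"] by linarith
      thus ?thesis using False by (simp add: indicator_def)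
    qed
  qed
  show "eventually (\<lambda>t. AE x in lborel. norm (indicator {exp (- t)..1} x *\<^sub>R f x) \<le> norm (indicator {0<..1} x *\<^sub>R f x)) at_top"
    by (intro always_eventually allI AE_I2) (auto simp: indicator_def intro: less_le_trans[OF exp_gt_zero])
qed

lemma tendsto_set_integral_exhaust_top:
  fixes f :: "real \<Rightarrow> complex"
  assumes f: "set_integrable lborel {1<..} f" and cont: "continuous_on {1..} f"
  shows "((\<lambda>t. LINT x:{1..exp t}|lborel. f x) \<longlongrightarrow> (LINT x:{1<..}|lborel. f x)) at_top"
  unfolding set_lebesgue_integral_def
proof (rule integral_dominated_convergence_at_top[where w = "\<lambda>x. norm (indicator {1<..} x *\<^sub>R f x)"])
  have int: "integrable lborel (\<lambda>x. indicator {1<..} x *\<^sub>R f x)" using f by (simp add: set_integrable_def)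
  show "(\<lambda>x. indicator {1<..} x *\<^sub>R f x) \<in> borel_measurable lborel"
    using borel_measurable_integrable[OF int] .
  show "(\<lambda>x. indicator {1..exp t} x *\<^sub>R f x) \<in> borel_measurable lborel" for t
    using borel_measurable_continuous_on_indicator[of "{1..exp t}" f] continuous_on_subset[OF cont, of "{1..exp t}"] by auto
  show "integrable lborel (\<lambda>x. norm (indicator {1<..} x *\<^sub>R f x))" using int by (rule integrable_norm)
  \<comment> \<open>The two indicators never agree at the endpoint 1, which is a null set.\<close>
  have ne: "AE x in lborel. x \<noteq> (1::real)" by (rule AE_lborel_singleton)
  show "AE x in lborel. ((\<lambda>t. indicator {1..exp t} x *\<^sub>R f x) \<longlongrightarrow> indicator {1<..} x *\<^sub>R f x) at_top"
    using ne
  proof eventually_elim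
    case (elim x)
    show ?case
    proof (rule tendsto_eventually)
      show "eventually (\<lambda>t. indicator {1..exp t} x *\<^sub>R f x = indicator {1<..} x *\<^sub>R f x) at_top"
        using eventually_ge_at_top[of "ln x"]
      proof eventually_elim
        case t: (elim t)
        have "x \<le> exp t" if "x > 1" using t that by (metis exp_le_cancel_iff exp_ln less_trans zero_less_one)
        thus ?case using elim by (auto simp: indicator_def)
      qed
    qed
  qed
  show "eventually (\<lambda>t. AE x in lborel. norm (indicator {1..exp t} x *\<^sub>R f x) \<le> norm (indicator {1<..} x *\<^sub>R f x)) at_top"
  proof (rule always_eventually, rule allI)
    fix t
    show "AE x in lborel. norm (indicator {1..exp t} x *\<^sub>R f x) \<le> norm (indicator {1<..} x *\<^sub>R f x)"
      using ne by eventually_elim (auto simp: indicator_def)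
  qed
qed

lemma integral_mellin_substitution:
  assumes k: "continuous_on UNIV k" and "a \<le> b"
  shows "integral {exp a..exp b} (mellin_integrand k (- 1 + \<kappa>)) = integral {a..b} (\<lambda>u. k (exp (of_real u)) * exp (- of_real u) * exp (\<kappa> * of_real u))"
proof -
  have pos: "x > 0" if "x \<in> {exp a..exp b}" for x
    using that less_le_trans[OF exp_gt_zero[of a]] by auto
  have cont: "continuous_on {exp a..exp b} (mellin_integrand k (- 1 + \<kappa>))"
    unfolding mellin_integrand_def
    by (intro continuous_intros continuous_on_compose2[OF k]) (use pos in force)+
  have "((\<lambda>u. exp u *\<^sub>R mellin_integrand k (- 1 + \<kappa>) (exp u)) has_integral integral {exp a..exp b} (mellin_integrand k (- 1 + \<kappa>))) {a..b}"
    by (rule has_integral_substitution[OF \<open>a \<le> b\<close> _ _ cont]) (use \<open>a \<le> b\<close> in \<open>auto intro!: derivative_eq_intros\<close>)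
  moreover have "exp u *\<^sub>R mellin_integrand k (- 1 + \<kappa>) (exp u) = k (exp (of_real u)) * exp (- of_real u) * exp (\<kappa> * of_real u)" for u
  proof -
    have "complex_of_real (exp u) powr (- 1 + \<kappa> - 1) = exp ((\<kappa> - 2) * of_real u)"
      by (simp add: powr_def Ln_of_real flip: exp_of_real)
    moreover have "complex_of_real (exp u) * exp ((\<kappa> - 2) * of_real u) = exp (- of_real u) * exp (\<kappa> * of_real u)"
      by (simp add: exp_of_real[symmetric] algebra_simps flip: exp_add)
    ultimately show ?thesis by (simp add: mellin_integrand_def scaleR_conv_of_real exp_of_real mult.left_commute mult.assoc)
  qed
  ultimately show ?thesis by (simp add: integral_unique)
qed

lemma poisson_gf_holomorphic:
  assumes "\<And>z::complex. summable (\<lambda>n. of_real (a n) * z ^ n / fact n)"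
  shows "poisson_gf a holomorphic_on UNIV"
proof -
  have "(\<lambda>z. \<Sum>n. of_real (a n) * z ^ n / fact n) holomorphic_on UNIV"
    by (rule exponential_gf_coefficient(2)[of "\<lambda>n. of_real (a n)"]) (use assms in \<open>simp add: summable_sums\<close>)
  thus ?thesis unfolding poisson_gf_def[abs_def] by (intro holomorphic_intros)
qed

text \<open>Up to the factor exp (- z) the quotient is the difference quotient at 0 of the
  exponential series, whose value and derivative there are a 0 and a 1. This yields the
  normalisation \<open>F_at_bot\<close>.\<close>

lemma poisson_gf_quotient_tendsto_0:
  assumes conv: "\<And>z::complex. summable (\<lambda>n. of_real (a n) * z ^ n / fact n)" and a01: "a 0 = 0" "a 1 = 0"
  shows "((\<lambda>u. poisson_gf a (exp (of_real u)) * exp (- of_real u)) \<longlongrightarrow> 0) at_bot"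
proof -
  define A where "A = (\<lambda>z::complex. \<Sum>n. of_real (a n) * z ^ n / fact n)"
  have sums: "(\<lambda>n. of_real (a n) * z ^ n / fact n) sums A z" for z :: complex
    using conv by (simp add: A_def summable_sums)
  note A = exponential_gf_coefficient[of "\<lambda>n. of_real (a n)", OF sums]
  have "A 0 = 0" "deriv A 0 = 0" using A(1)[of 0] A(1)[of 1] a01 by simp_all
  moreover have "(A has_field_derivative deriv A 0) (at 0)" by (rule holomorphic_derivI[OF A(2)]) auto
  ultimately have "((\<lambda>z. A z / z) \<longlongrightarrow> 0) (at 0)" by (simp add: DERIV_def)
  hence "((\<lambda>z. exp (- z) * (A z / z)) \<longlongrightarrow> exp (- 0) * 0) (at 0)" by (intro tendsto_intros)
  hence lim: "((\<lambda>z. exp (- z) * (A z / z)) \<longlongrightarrow> 0) (at 0)" by simp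
  have "((\<lambda>u::real. complex_of_real (exp u)) \<longlongrightarrow> of_real 0) at_bot"
    by (intro tendsto_of_real exp_at_bot)
  hence "filterlim (\<lambda>u::real. complex_of_real (exp u)) (at 0) at_bot"
    by (simp add: filterlim_at)
  from filterlim_compose[OF lim this]
  show ?thesis by (simp add: poisson_gf_def A_def exp_of_real exp_minus divide_inverse mult.assoc)
qed

lemma poisson_gf_quadratic_bound:
  assumes conv: "\<And>z::complex. summable (\<lambda>n. of_real (a n) * z ^ n / fact n)" and a01: "\<And>n. n < 2 \<Longrightarrow> a n = 0"
  obtains C where "\<And>x. 0 < x \<Longrightarrow> x \<le> 1 \<Longrightarrow> norm (poisson_gf a (of_real x)) \<le> C * x\<^sup>2"
proof -
  have "summable (\<lambda>n. complex_of_real (a n / fact n) * 2 ^ n)" using conv[of 2] by (simp add: field_simps)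
  from powser_insidea[OF this, of 1] have s: "summable (\<lambda>n. \<bar>a n\<bar> / fact n)" by (simp add: norm_divide)
  define C where "C = (\<Sum>n. \<bar>a n\<bar> / fact n)"
  show thesis
  proof (rule that)
    fix x :: real assume x: "0 < x" "x \<le> 1"
    have le: "norm (complex_of_real (a n) * of_real x ^ n / fact n) \<le> x\<^sup>2 * (\<bar>a n\<bar> / fact n)" for n
    proof (cases "n < 2")
      case False
      hence "x ^ n \<le> x\<^sup>2" using x by (intro power_decreasing) auto
      hence "\<bar>a n\<bar> / fact n * x ^ n \<le> \<bar>a n\<bar> / fact n * x\<^sup>2" by (intro mult_left_mono) auto
      thus ?thesis using x by (simp add: norm_mult norm_divide norm_power mult_ac)
    qed (simp add: a01)
    have "norm (\<Sum>n. complex_of_real (a n) * of_real x ^ n / fact n) \<le> (\<Sum>n. x\<^sup>2 * (\<bar>a n\<bar> / fact n))"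
      using le summable_mult[OF s] by (rule norm_suminf_le)
    also have "\<dots> = x\<^sup>2 * C" unfolding C_def by (rule suminf_mult[OF s])
    also have "\<dots> = C * x\<^sup>2" by (rule mult.commute)
    finally have 1: "norm (\<Sum>n. complex_of_real (a n) * of_real x ^ n / fact n) \<le> C * x\<^sup>2" .
    have "norm (exp (- complex_of_real x)) \<le> 1" using x by simp
    hence "norm (poisson_gf a (of_real x)) \<le> 1 * norm (\<Sum>n. complex_of_real (a n) * of_real x ^ n / fact n)"
      unfolding poisson_gf_def norm_mult by (intro mult_right_mono) auto
    thus "norm (poisson_gf a (of_real x)) \<le> C * x\<^sup>2" using 1 by simp
  qed
qed

lemma summable_of_quadratic_growth:
  fixes a :: "nat \<Rightarrow> real" and z :: complex
  assumes "\<And>n. \<bar>a n\<bar> \<le> K * (real n + 1)\<^sup>2"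
  shows "summable (\<lambda>n. norm (of_real (a n) * z ^ n / fact n))"
proof (rule summable_comparison_test)
  show "summable (\<lambda>n. \<bar>K\<bar> * ((4 * norm z) ^ n / fact n))"
    using summable_exp[of "4 * norm z"] by (intro summable_mult) (simp add: divide_inverse mult.commute)
  show "\<exists>N. \<forall>n\<ge>N. norm (norm (of_real (a n) * z ^ n / fact n)) \<le> \<bar>K\<bar> * ((4 * norm z) ^ n / fact n)"
  proof (intro exI allI impI)
    fix n :: nat
    have "real n + 1 \<le> 2 ^ n" using less_exp[of n] by (metis Suc_leI of_nat_Suc of_nat_le_iff of_nat_numeral of_nat_power add.commute)
    hence "(real n + 1)\<^sup>2 \<le> (2 ^ n)\<^sup>2" by (intro power_mono) auto
    also have "(2 ^ n)\<^sup>2 = (4::real) ^ n" by (simp add: power2_eq_square flip: power_mult_distrib)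
    finally have n4: "(real n + 1)\<^sup>2 \<le> 4 ^ n" .
    have "\<bar>a n\<bar> \<le> \<bar>K\<bar> * (real n + 1)\<^sup>2"
      by (rule order_trans[OF assms]) (intro mult_right_mono; simp)
    also have "\<dots> \<le> \<bar>K\<bar> * 4 ^ n" by (intro mult_left_mono n4) auto
    finally have "\<bar>a n\<bar> * (norm z ^ n / fact n) \<le> \<bar>K\<bar> * 4 ^ n * (norm z ^ n / fact n)" by (intro mult_right_mono) auto
    thus "norm (norm (of_real (a n) * z ^ n / fact n)) \<le> \<bar>K\<bar> * ((4 * norm z) ^ n / fact n)"
      by (simp add: norm_mult norm_divide norm_power power_mult_distrib)
  qed
qed

lemma log_ratio_num_eq:
  assumes "0 < p" "p < 1" and rat: "ln p / ln (1 - p) \<in> \<rat>"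
  obtains r s where "r = log_ratio_num p" "0 < r" "0 < s" "coprime r s" "ln p / ln (1 - p) = real r / real s"
proof -
  have pos: "ln p / ln (1 - p) > 0" using assms by (simp add: divide_neg_neg)
  obtain r s :: nat where rs: "s \<noteq> 0" "\<bar>ln p / ln (1 - p)\<bar> = real r / real s" "coprime r s"
    using Rats_abs_nat_div_natE[OF rat] by blast
  have eq: "ln p / ln (1 - p) = real r / real s" using rs(2) pos by (simp only: abs_of_pos)
  hence r: "r > 0" using pos by (cases r) auto
  have "log_ratio_num p = r"
    unfolding log_ratio_num_def
  proof (rule the_equality)
    show "\<exists>l::nat. 0 < r \<and> 0 < l \<and> coprime r l \<and> ln p / ln (1 - p) = real r / real l" using rs r eq by blast
    fix r' assume "\<exists>l::nat. 0 < r' \<and> 0 < l \<and> coprime r' l \<and> ln p / ln (1 - p) = real r' / real l"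
    then obtain l' :: nat where l': "0 < r'" "0 < l'" "coprime r' l'" "real r' / real l' = real r / real s" using eq by metis
    hence "real (r' * s) = real (r * l')" using rs(1) by (simp add: field_simps)
    hence e: "r' * s = r * l'" by (simp only: of_nat_eq_iff)
    have "r' dvd r" using l'(3) e by (metis coprime_dvd_mult_left_iff dvd_triv_left)
    moreover have "r dvd r'" using rs(3) e by (metis coprime_dvd_mult_left_iff dvd_triv_left)
    ultimately show "r' = r" by (rule dvd_antisym)
  qed
  thus thesis using that rs r eq by blast
qed

section \<open>Asymptotics\<close>

text \<open>The substitution x = exp u sends the break at x = 1 in the finite part to the break at u
  = 0 in \<open>windows_limit\<close>, so the limits required there are the two halves of
  \<open>mellin_finite_part\<close>.\<close>

lemma mellin_window_limits:
  fixes g :: "complex \<Rightarrow> complex" and c :: real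
  assumes hol: "g holomorphic_on UNIV"
    and int0: "set_integrable lborel {0<..1} (mellin_integrand g (- 1 + \<kappa>))"
    and int1: "set_integrable lborel {1<..} (mellin_integrand (\<lambda>z. g z - of_real c * z) (- 1 + \<kappa>))"
  shows "((\<lambda>t. integral {-t..0} (\<lambda>u. g (exp (of_real u)) * exp (- of_real u) * exp (\<kappa> * of_real u))) \<longlongrightarrow>
            (LINT x:{0<..1}|lborel. mellin_integrand g (- 1 + \<kappa>) x)) at_top"
    and "((\<lambda>t. integral {0..t} (\<lambda>u. (g (exp (of_real u)) * exp (- of_real u) - of_real c) * exp (\<kappa> * of_real u))) \<longlongrightarrow>
            (LINT x:{1<..}|lborel. mellin_integrand (\<lambda>z. g z - of_real c * z) (- 1 + \<kappa>) x)) at_top"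
proof -
  have k: "continuous_on UNIV g" "continuous_on UNIV (\<lambda>z. g z - of_real c * z)"
    using holomorphic_on_imp_continuous_on[OF hol] by (auto intro!: continuous_intros)
  have "(LINT x:{exp (- t)..1}|lborel. mellin_integrand g (- 1 + \<kappa>) x) =
      integral {-t..0} (\<lambda>u. g (exp (of_real u)) * exp (- of_real u) * exp (\<kappa> * of_real u))" if "t \<ge> 0" for t
  proof -
    have "set_integrable lborel {exp (- t)..1} (mellin_integrand g (- 1 + \<kappa>))"
      by (rule set_integrable_subset[OF int0]) (auto intro: less_le_trans[OF exp_gt_zero])
    from set_borel_integral_eq_integral(2)[OF this] integral_mellin_substitution[OF k(1), of "- t" 0 \<kappa>] that
    show ?thesis by simp
  qed
  thus "((\<lambda>t. integral {-t..0} (\<lambda>u. g (exp (of_real u)) * exp (- of_real u) * exp (\<kappa> * of_real u))) \<longlongrightarrow>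
            (LINT x:{0<..1}|lborel. mellin_integrand g (- 1 + \<kappa>) x)) at_top"
    by (intro Lim_transform_eventually[OF tendsto_set_integral_exhaust_0[OF int0]] eventually_mono[OF eventually_ge_at_top[of 0]])
  have cont1: "continuous_on {1..} (mellin_integrand (\<lambda>z. g z - of_real c * z) (- 1 + \<kappa>))"
    unfolding mellin_integrand_def
    by (intro continuous_intros continuous_on_compose2[OF k(1)]) auto
  have "(LINT x:{1..exp t}|lborel. mellin_integrand (\<lambda>z. g z - of_real c * z) (- 1 + \<kappa>) x) =
      integral {0..t} (\<lambda>u. (g (exp (of_real u)) * exp (- of_real u) - of_real c) * exp (\<kappa> * of_real u))" if "t \<ge> 0" for t
  proof -
    have "set_integrable lborel {1..exp t} (mellin_integrand (\<lambda>z. g z - of_real c * z) (- 1 + \<kappa>))"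
      by (intro borel_integrable_compact[unfolded set_integrable_def[symmetric]] compact_Icc continuous_on_subset[OF cont1]) auto
    from set_borel_integral_eq_integral(2)[OF this]
    have "(LINT x:{1..exp t}|lborel. mellin_integrand (\<lambda>z. g z - of_real c * z) (- 1 + \<kappa>) x) =
       integral {0..t} (\<lambda>u. (g (exp (of_real u)) - of_real c * exp (of_real u)) * exp (- of_real u) * exp (\<kappa> * of_real u))"
      using integral_mellin_substitution[OF k(2), of 0 t \<kappa>] that by simp
    also have "(\<lambda>u. (g (exp (of_real u)) - of_real c * exp (of_real u)) * exp (- of_real u) * exp (\<kappa> * of_real u)) =
        (\<lambda>u. (g (exp (of_real u)) * exp (- of_real u) - of_real c) * exp (\<kappa> * complex_of_real u))"
    proof
      fix u :: real
      have "of_real c * exp (of_real u) * exp (- of_real u) = (of_real c :: complex)" by (simp add: mult.assoc flip: exp_add)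
      thus "(g (exp (of_real u)) - of_real c * exp (of_real u)) * exp (- of_real u) * exp (\<kappa> * of_real u) =
        (g (exp (of_real u)) * exp (- of_real u) - of_real c) * exp (\<kappa> * complex_of_real u)" by (simp only: left_diff_distrib)
    qed
    finally show ?thesis .
  qed
  thus "((\<lambda>t. integral {0..t} (\<lambda>u. (g (exp (of_real u)) * exp (- of_real u) - of_real c) * exp (\<kappa> * of_real u))) \<longlongrightarrow>
            (LINT x:{1<..}|lborel. mellin_integrand (\<lambda>z. g z - of_real c * z) (- 1 + \<kappa>) x)) at_top"
    by (intro Lim_transform_eventually[OF tendsto_set_integral_exhaust_top[OF int1 cont1]] eventually_mono[OF eventually_ge_at_top[of 0]])
qed

text \<open>The deterministic core: probability enters only through the recurrence for the means.
  The Poisson generating function is evaluated by the renewal equation, and de-Poissonization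
  transfers the result to \<open>a\<close>.\<close>

theorem splitting_recurrence_asymptotics:
  fixes a t :: "nat \<Rightarrow> real" and p \<theta> \<alpha> \<beta> c :: real
  defines "h \<equiv> entropy_pq p"
    and "g \<equiv> poisson_gf t"
    and "G \<equiv> mellin_continuation (poisson_gf t) (vstrip (- 2) (- \<alpha>))"
  assumes p: "0 < p" "p < 1"
    and a01: "a 0 = 0" "a 1 = 0" and t01: "\<And>n. n < 2 \<Longrightarrow> t n = 0"
    and rec: "\<And>n. a n = (\<Sum>k\<le>n. Bernstein n k p * (a k + a (n - k))) + t n"
    and conv_t: "\<And>z::complex. summable (\<lambda>n. of_real (t n) * z ^ n / fact n)"
    and \<theta>: "0 < \<theta>" "\<theta> < pi / 2" and \<alpha>: "\<alpha> < 1"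
    and cases: "(g \<in> JS \<alpha> \<beta> \<and> c = 0) \<or>
          (g \<in> JS_all \<and>
           (\<lambda>z. norm (g z - of_real c * z))
             \<in> O[inf at_infinity (principal {z. \<bar>Arg z\<bar> \<le> \<theta>})](\<lambda>z.
                  norm z powr \<alpha> * log_plus (norm z) powr \<beta>))"
  shows "(\<lambda>n. of_real (a n / real n) -
            (of_real (c / h * ln (real n)) +
             (if c = 0 then G (- 1) / of_real h
              else Lim (at (- 1)) (\<lambda>s. G s + of_real c / (s + 1)) / of_real h +
                   of_real (c * (p * (ln p)\<^sup>2 + (1 - p) * (ln (1 - p))\<^sup>2) / (2 * h\<^sup>2))) +
             fluctuation p G (real (log_ratio_num p) * log (1 / p) (real n))))
         \<longlonglongrightarrow> 0"
proof -
  define q where "q = 1 - p"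
  define l where "l = - ln p"
  define m where "m = - ln q"
  have q: "0 < q" "q < 1" "p + q = 1" using p by (auto simp: q_def)
  have l: "0 < l" and m: "0 < m" using p q by (auto simp: l_def m_def)
  obtain \<phi> where \<phi>: "0 < \<phi>" "\<phi> < pi / 2" and hol_g: "g holomorphic_on UNIV"
    and inside: "\<And>a. a > \<alpha> \<Longrightarrow> \<exists>C\<ge>0. \<forall>z. 1 \<le> norm z \<longrightarrow> \<bar>Arg z\<bar> \<le> \<phi> \<longrightarrow> norm (g z - of_real c * z) \<le> C * norm z powr a"
    and outside: "\<exists>\<epsilon>>0. \<exists>C\<ge>0. \<forall>z. 1 \<le> norm z \<longrightarrow> \<phi> \<le> \<bar>Arg z\<bar> \<longrightarrow> norm (exp z * (g z - of_real c * z)) \<le> C * exp ((1 - \<epsilon>) * norm z)"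
    by (rule sector_bounds[OF \<theta> cases]) blast
  \<comment> \<open>Any exponent in the open interval from max \<alpha> (1/2) to 1 would do. Then
    \<gamma> = a' - 1/2 is positive, as the contraction factor \<rho>^\<gamma> < 1 requires, and
    below 1/2, as de-Poissonization requires.\<close>
  define a' where "a' = max ((\<alpha> + 1) / 2) (3 / 4)"
  have a': "\<alpha> < a'" "3 / 4 \<le> a'" "a' < 1" using \<alpha> by (auto simp: a'_def max_def)
  obtain C1 where C1: "C1 \<ge> 0" "\<And>z. 1 \<le> norm z \<Longrightarrow> \<bar>Arg z\<bar> \<le> \<phi> \<Longrightarrow> norm (g z - of_real c * z) \<le> C1 * norm z powr a'"
    using inside[OF a'(1)] by blast
  obtain \<epsilon> C2 where C2: "\<epsilon> > 0" "C2 \<ge> 0" "\<And>z. 1 \<le> norm z \<Longrightarrow> \<phi> \<le> \<bar>Arg z\<bar> \<Longrightarrow> norm (exp z * (g z - of_real c * z)) \<le> C2 * exp ((1 - \<epsilon>) * norm z)"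
    using outside by blast
  define \<gamma> where "\<gamma> = a' - 1 / 2"
  have \<gamma>: "0 < \<gamma>" "\<gamma> < 1 / 2" "\<gamma> \<le> 1" using a' by (auto simp: \<gamma>_def)
  have "1 / 2 \<le> a'" using a' by simp
  from coefficient_difference_bound[OF conv_t C2(1) this C1(1) C2(2) C1(2)[unfolded g_def] C2(3)[unfolded g_def]]
  obtain B where B: "\<And>k. \<bar>t (Suc k) - t k\<bar> \<le> B * real (Suc k) powr \<gamma>" unfolding \<gamma>_def by blast
  obtain K where K: "K \<ge> 0" "\<And>n. \<bar>a (Suc n) - a n\<bar> \<le> K * real (Suc n) powr \<gamma>"
    using splitting_recurrence_difference_bound[OF p \<gamma>(1,3) a01 rec B] by blast
  \<comment> \<open>A crude polynomial bound, enough for convergence of the exponential series of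
    \<open>a\<close> everywhere.\<close>
  have growth: "\<bar>a n\<bar> \<le> K * (real n + 1)\<^sup>2" for n
  proof -
    have "\<bar>a n\<bar> \<le> K * real n * (real n + 1) powr \<gamma>"
      using increment_powr_bound[of \<gamma> K a n 0, OF _ K] \<gamma> a01 by (simp add: add_ac)
    also have "\<dots> \<le> K * (real n + 1) * (real n + 1) powr 1"
      using K(1) \<gamma> by (intro mult_mono powr_mono) auto
    finally show ?thesis by (simp add: power2_eq_square mult.assoc)
  qed
  have conv_norm: "summable (\<lambda>n. norm (of_real (a n) * z ^ n / fact n))" for z :: complex
    by (rule summable_of_quadratic_growth[OF growth])
  have conv: "summable (\<lambda>n. of_real (a n) * z ^ n / fact n)" for z :: complex
    by (rule summable_norm_cancel[OF conv_norm])
  have depo: "(\<lambda>n. (of_real (a n) - poisson_gf a (of_nat n)) / of_nat n) \<longlonglongrightarrow> 0"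
    by (rule depoissonization[OF _ \<gamma>(2) K conv]) (use \<gamma> in auto)
  define F where "F = (\<lambda>w. poisson_gf a (exp w) * exp (- w))"
  define E where "E = (\<lambda>w. g (exp w) * exp (- w))"
  have ep: "exp (w - of_real l) = of_real p * exp w" "exp (w - of_real m) = of_real q * exp w" for w :: complex
    using p q by (simp_all add: l_def m_def exp_add exp_of_real)
  have ep': "of_real p * exp (- (w - of_real l)) = exp (- w)" "of_real q * exp (- (w - of_real m)) = exp (- w)" for w :: complex
  proof -
    have "complex_of_real p * exp (of_real l) = 1" "complex_of_real q * exp (of_real m) = 1"
      using p q by (simp_all add: l_def m_def exp_of_real exp_minus flip: of_real_mult)
    moreover have "exp (- (w - of_real x)) = exp (- w) * exp (complex_of_real x)" for x by (simp flip: exp_add)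
    ultimately show "of_real p * exp (- (w - of_real l)) = exp (- w)" "of_real q * exp (- (w - of_real m)) = exp (- w)"
      by (simp_all add: mult.left_commute)
  qed
  interpret R: renewal_equation p q l m c \<phi> "1 - a'" C1 F E
  proof
    show "0 < p" "0 < q" "p + q = 1" "0 < l" "0 < m" "0 < 1 - a'" "0 < \<phi>" using p q l m a' \<phi> by auto
    show "F holomorphic_on UNIV" unfolding F_def
      by (intro holomorphic_intros holomorphic_on_compose_gen[OF _ poisson_gf_holomorphic[OF conv], unfolded o_def]) auto
    show "E holomorphic_on UNIV" unfolding E_def
      by (intro holomorphic_intros holomorphic_on_compose_gen[OF _ hol_g, unfolded o_def]) auto
    fix w :: complex
    have "F w = (poisson_gf a (of_real p * exp w) + poisson_gf a (of_real q * exp w) + g (exp w)) * exp (- w)"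
      unfolding F_def g_def q_def using poisson_gf_functional_equation[OF conv_norm conv_t rec, of "exp w"] by simp
    also have "\<dots> = of_real p * F (w - of_real l) + of_real q * F (w - of_real m) + E w"
    proof -
      have "of_real p * F (w - of_real l) = poisson_gf a (of_real p * exp w) * exp (- w)"
        unfolding F_def ep ep'(1)[of w, symmetric] by simp
      moreover have "of_real q * F (w - of_real m) = poisson_gf a (of_real q * exp w) * exp (- w)"
        unfolding F_def ep ep'(2)[of w, symmetric] by simp
      ultimately show ?thesis unfolding E_def by (simp only: distrib_right)
    qed
    finally show "F w = of_real p * F (w - of_real l) + of_real q * F (w - of_real m) + E w" .
    assume w: "0 \<le> Re w" "\<bar>Im w\<bar> \<le> \<phi>"
    \<comment> \<open>The strip of half-width \<phi> is mapped into the sector of the same angle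
      because \<phi> < pi.\<close>
    have "Arg (exp w) = Im w" using w \<phi> pi_gt_zero by (intro Arg_exp) linarith+
    hence "norm (g (exp w) - of_real c * exp w) \<le> C1 * norm (exp w) powr a'" using w by (intro C1(2)) auto
    hence "norm (g (exp w) - of_real c * exp w) * norm (exp (- w)) \<le> C1 * norm (exp w) powr a' * norm (exp (- w))"
      by (intro mult_right_mono) auto
    also have "norm (g (exp w) - of_real c * exp w) * norm (exp (- w)) = norm (E w - of_real c)"
    proof -
      have "of_real c * exp w * exp (- w) = of_real c" by (simp add: mult.assoc flip: exp_add)
      thus ?thesis unfolding E_def norm_mult[symmetric] left_diff_distrib by (simp only:)
    qed
    also have "C1 * norm (exp w) powr a' * norm (exp (- w)) = C1 * exp (- (1 - a') * Re w)"
      by (simp add: powr_def algebra_simps flip: exp_add)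
    finally show "norm (E w - of_real c) \<le> C1 * exp (- (1 - a') * Re w)" .
  next
    show "((\<lambda>u. F (of_real u)) \<longlongrightarrow> 0) at_bot"
      unfolding F_def by (rule poisson_gf_quotient_tendsto_0[OF conv a01])
  qed
  have hR: "R.h = h" unfolding R.h_def h_def entropy_pq_def by (simp add: l_def m_def q_def)
  have h: "h > 0" using R.h_pos hR by simp
  obtain C0 where C0: "\<And>x. 0 < x \<Longrightarrow> x \<le> 1 \<Longrightarrow> norm (g (of_real x)) \<le> C0 * x\<^sup>2"
    unfolding g_def using poisson_gf_quadratic_bound[OF conv_t t01] by blast
  have at_top: "\<exists>C\<ge>0. \<forall>x\<ge>1. norm (g (of_real x) - of_real c * of_real x) \<le> C * x powr a" if a: "a > \<alpha>" for a
  proof -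
    obtain C where C: "C \<ge> 0" "\<And>z. 1 \<le> norm z \<Longrightarrow> \<bar>Arg z\<bar> \<le> \<phi> \<Longrightarrow> norm (g z - of_real c * z) \<le> C * norm z powr a"
      using inside[OF a] by blast
    have "norm (g (of_real x) - of_real c * of_real x) \<le> C * x powr a" if "x \<ge> 1" for x
      using C(2)[of "of_real x"] \<phi>(1) that by simp
    thus ?thesis using C(1) by blast
  qed
  note mellin = hol_g \<alpha> C0 at_top
  define P where "P = mellin_finite_part g c"
  have G: "G s = P s - of_real c / (s + 1)" if "s \<in> vstrip (- 2) (- \<alpha>)" "c = 0 \<or> s \<noteq> -1" for s
    unfolding G_def P_def g_def[symmetric] by (rule mellin_continuation_eq[OF mellin that])
  have strip: "- 1 + \<kappa> \<in> vstrip (- 2) (- \<alpha>)" if "Re \<kappa> = 0" for \<kappa>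
    using that \<alpha> by (simp add: vstrip_def)
  \<comment> \<open>For \<kappa> \<noteq> 0 this is the continued Mellin transform at - 1 +
    \<kappa>, since s + 1 = \<kappa>. At \<kappa> = 0 the polar term is replaced by the
    second-moment constant.\<close>
  define V where "V = (\<lambda>\<kappa>. P (- 1 + \<kappa>) + (if \<kappa> = 0 then of_real (c * (p * l\<^sup>2 + q * m\<^sup>2) / (2 * h)) else - of_real c / \<kappa>))"
  have windows: "(R.windows N \<longlongrightarrow> V \<kappa>) at_top"
    if N: "\<And>w. (N has_field_derivative R.H w * exp (\<kappa> * w)) (at w)"
      and \<kappa>: "exp (\<kappa> * of_real l) = 1" "exp (\<kappa> * of_real m) = 1" "Re \<kappa> = 0" for N \<kappa>
  proof -
    have s: "Re (- 1 + \<kappa>) > -2" "Re (- 1 + \<kappa>) < - \<alpha>" using \<kappa>(3) \<alpha> by auto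
    have int0: "set_integrable lborel {0<..1} (mellin_integrand g (- 1 + \<kappa>))"
      by (rule mellin_near_0[OF mellin s(1)])
    have int1: "set_integrable lborel {1<..} (mellin_integrand (\<lambda>z. g z - of_real c * z) (- 1 + \<kappa>))"
      by (rule mellin_at_top[OF mellin s(2)])
    have E: "g (exp w) * exp (- w) = E w" for w by (simp add: E_def)
    note lims = mellin_window_limits[OF hol_g int0 int1, unfolded E]
    show ?thesis
      using R.windows_limit[OF \<kappa> lims N] by (simp only: V_def P_def mellin_finite_part_def hR)
  qed
  define d where "d = (if c = 0 then G (- 1) / of_real h
              else Lim (at (- 1)) (\<lambda>s. G s + of_real c / (s + 1)) / of_real h +
                   of_real (c * (p * (ln p)\<^sup>2 + (1 - p) * (ln (1 - p))\<^sup>2) / (2 * h\<^sup>2)))"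
  have d: "d = V 0 / of_real h"
  proof (cases "c = 0")
    case True
    thus ?thesis using G[of "-1"] strip[of 0] by (simp add: d_def V_def)
  next
    case False
    have m1: "- 1 \<in> vstrip (- 2) (- \<alpha>)" using strip[of 0] by simp
    \<comment> \<open>The finite part is continuous at the pole and equals the regularised transform
      around it, so the limit in the statement is P (- 1).\<close>
    have "isCont P (- 1)"
      unfolding P_def using mellin_finite_part_holomorphic[OF mellin] m1 open_vstrip
      by (metis continuous_on_eq_continuous_at holomorphic_on_imp_continuous_on)
    hence "P \<midarrow>- 1\<rightarrow> P (- 1)" by (simp add: isCont_def)
    moreover have "eventually (\<lambda>s. P s = G s + of_real c / (s + 1)) (at (- 1))"
      using eventually_at_in_open[OF open_vstrip m1] by eventually_elim (use G in auto)
    ultimately have "(\<lambda>s. G s + of_real c / (s + 1)) \<midarrow>- 1\<rightarrow> P (- 1)" by (rule Lim_transform_eventually)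
    hence "Lim (at (- 1)) (\<lambda>s. G s + of_real c / (s + 1)) = P (- 1)" by (intro tendsto_Lim) auto
    moreover have "of_real (c * (p * l\<^sup>2 + q * m\<^sup>2) / (2 * h)) / of_real h = complex_of_real (c * (p * (ln p)\<^sup>2 + (1 - p) * (ln (1 - p))\<^sup>2) / (2 * h\<^sup>2))"
      by (simp add: l_def m_def q_def power2_eq_square flip: of_real_divide)
    ultimately show ?thesis using False by (simp add: d_def V_def add_divide_distrib)
  qed
  have main: "(\<lambda>n. R.H (of_real (ln (real n))) - (d + fluctuation p G (real (log_ratio_num p) * log (1 / p) (real n)))) \<longlonglongrightarrow> 0"
  proof (cases "ln p / ln (1 - p) \<in> \<rat>")
    case False
    hence irr: "l / m \<notin> \<rat>" by (simp add: l_def m_def q_def)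
    obtain N where N: "\<And>w. (N has_field_derivative R.H w * exp (0 * w)) (at w)" using R.primitive_exists by blast
    have "((\<lambda>u. R.H (of_real u)) \<longlongrightarrow> V 0 / of_real R.h) at_top"
      by (rule R.irrational_limit[OF irr _ windows[OF N]]) (use N in auto)
    hence "(\<lambda>n. R.H (of_real (ln (real n)))) \<longlonglongrightarrow> d"
      unfolding hR d[symmetric]
      by (rule filterlim_compose[OF _ filterlim_compose[OF ln_at_top filterlim_real_sequentially]])
    thus ?thesis using False by (simp add: fluctuation_def LIM_zero)
  next
    case True
    obtain r s where r: "r = log_ratio_num p" and rs: "0 < r" "0 < s" "coprime r s" "ln p / ln (1 - p) = real r / real s"
      using log_ratio_num_eq[OF p True] by blast
    define L where "L = l / real r"
    have L: "L > 0" using l rs by (simp add: L_def)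
    have lr: "l = real r * L" using rs by (simp add: L_def)
    have "l / m = real r / real s" using rs(4) by (simp add: l_def m_def q_def)
    hence ms: "m = real s * L" using rs m by (simp add: L_def field_simps)
    define \<kappa> where "\<kappa> = (\<lambda>k::int. \<i> * complex_of_real (2 * pi * of_int k / L))"
    have \<kappa>0: "\<kappa> k = 0 \<longleftrightarrow> k = 0" for k using L by (simp add: \<kappa>_def)
    have e1: "exp (\<kappa> k * of_real (real j * L)) = 1" for k j
    proof -
      have e: "\<kappa> k * of_real (real j * L) = \<i> * of_real (2 * pi * of_int (k * int j))" using L by (simp add: \<kappa>_def)
      show ?thesis unfolding e cis_conv_exp[symmetric] by (rule cis_multiple_2pi) simp
    qed
    have win: "(R.windows N \<longlongrightarrow> V (\<kappa> k)) at_top"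
      if "\<And>w. (N has_field_derivative R.H w * exp (\<i> * of_real (2 * pi * of_int k / L) * w)) (at w)" for k N
      by (rule windows) (use that e1[of k r] e1[of k s] lr ms in \<open>simp_all add: \<kappa>_def\<close>)
    note lattice = L lr ms rs(3) win
    have sumV: "(\<lambda>k. norm (V (\<kappa> k))) summable_on UNIV" by (rule R.lattice_summable[OF lattice])
    have lim: "((\<lambda>u. R.H (of_real u) - (\<Sum>\<^sub>\<infinity>k. V (\<kappa> k) * cis (- 2 * pi * of_int k * u / L)) / of_real R.h) \<longlongrightarrow> 0) at_top"
      by (rule R.lattice_limit[OF lattice])
    \<comment> \<open>The sign is reversed because \<open>chi\<close> divides by ln p, which is
      negative; the reflection k to - k below compensates for it.\<close>
    have chi: "chi p k = \<kappa> (- k)" for k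
    proof -
      have "ln p = - (real r * L)" using lr by (simp add: l_def)
      thus ?thesis using rs(1) L unfolding chi_def r[symmetric] \<kappa>_def by (simp add: field_simps)
    qed
    have fl: "(\<Sum>\<^sub>\<infinity>k. V (\<kappa> k) * cis (- 2 * pi * of_int k * u / L)) / of_real h = d + fluctuation p G (u / L)" for u
    proof -
      define f where "f = (\<lambda>k. V (\<kappa> k) * cis (- 2 * pi * of_int k * u / L))"
      have fs: "f summable_on S" for S
      proof -
        have "(\<lambda>k. norm (f k)) summable_on UNIV" using sumV by (simp add: f_def norm_mult)
        hence "f summable_on UNIV" by (rule abs_summable_summable)
        thus ?thesis by (rule summable_on_subset_banach) auto
      qed
      have "insert (0::int) {k. k \<noteq> 0} = UNIV" by auto
      hence "infsum f UNIV = f 0 + infsum f {k. k \<noteq> 0}" using infsum_insert[OF fs, of 0 "{k. k \<noteq> 0}"] by simp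
      also have "f 0 = V 0" using \<kappa>0[of 0] by (simp add: f_def)
      also have "infsum f {k. k \<noteq> 0} = infsum (\<lambda>k. f (- k)) {k. k \<noteq> 0}"
        by (rule infsum_reindex_bij_witness[of _ uminus uminus]) auto
      also have "\<dots> = (\<Sum>\<^sub>\<infinity>k\<in>{k. k \<noteq> 0}. G (- 1 + chi p k) * exp (2 * of_int k * of_real pi * \<i> * of_real (u / L)))"
      proof (rule infsum_cong)
        fix k :: int assume "k \<in> {k. k \<noteq> 0}"
        hence k: "\<kappa> (- k) \<noteq> 0" using \<kappa>0[of "- k"] by simp
        have "Re (\<kappa> (- k)) = 0" by (simp add: \<kappa>_def)
        hence "G (- 1 + \<kappa> (- k)) = V (\<kappa> (- k))" using G[OF strip] k by (simp add: V_def)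
        moreover have "cis (- 2 * pi * of_int (- k) * u / L) = exp (2 * of_int k * of_real pi * \<i> * of_real (u / L))"
          by (simp add: cis_conv_exp mult_ac)
        ultimately show "f (- k) = G (- 1 + chi p k) * exp (2 * of_int k * of_real pi * \<i> * of_real (u / L))"
          by (simp add: f_def chi)
      qed
      finally show ?thesis using True by (simp add: f_def fluctuation_def h_def d[unfolded h_def] add_divide_distrib)
    qed
    have x: "real (log_ratio_num p) * log (1 / p) (real n) = ln (real n) / L" for n
      using p rs(1) lr by (simp add: log_def ln_div l_def L_def r)
    show ?thesis
      using filterlim_compose[OF lim filterlim_compose[OF ln_at_top filterlim_real_sequentially]]
      unfolding hR fl x .
  qed
  \<comment> \<open>At n = 0 both \<open>ln 0\<close> and the division by n take default values, so
    the identity is claimed from n = 1 on.\<close>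
  have eq: "of_real (a n / real n) - (of_real (c / h * ln (real n)) + d + fluctuation p G (real (log_ratio_num p) * log (1 / p) (real n)))
     = (of_real (a n) - poisson_gf a (of_nat n)) / of_nat n
       + (R.H (of_real (ln (real n))) - (d + fluctuation p G (real (log_ratio_num p) * log (1 / p) (real n))))" if "n \<ge> 1" for n
  proof -
    have e: "exp (complex_of_real (ln (real n))) = of_nat n" using that by (simp add: exp_of_real)
    hence "F (of_real (ln (real n))) = poisson_gf a (of_nat n) / of_nat n"
      by (simp add: F_def exp_minus divide_inverse)
    hence "R.H (of_real (ln (real n))) = poisson_gf a (of_nat n) / of_nat n - of_real (c / h * ln (real n))"
      unfolding R.H_def hR by simp
    thus ?thesis by (simp add: diff_divide_distrib)
  qed
  have "(\<lambda>n. (of_real (a n) - poisson_gf a (of_nat n)) / of_nat n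
       + (R.H (of_real (ln (real n))) - (d + fluctuation p G (real (log_ratio_num p) * log (1 / p) (real n))))) \<longlonglongrightarrow> 0 + 0"
    by (intro tendsto_add depo main)
  hence "(\<lambda>n. of_real (a n / real n) - (of_real (c / h * ln (real n)) + d + fluctuation p G (real (log_ratio_num p) * log (1 / p) (real n)))) \<longlonglongrightarrow> 0"
    by (intro Lim_transform_eventually[OF _ eventually_mono[OF eventually_ge_at_top[of 1] eq[symmetric]]]) simp_all
  thus ?thesis by (simp only: d_def)
qed

theorem theorem4p1:
  fixes M :: "'a measure"
    and X X' T :: "nat \<Rightarrow> 'a \<Rightarrow> real" and J :: "nat \<Rightarrow> 'a \<Rightarrow> nat"
    and p q h \<theta> \<alpha> \<beta> c :: real
    and ET :: "nat \<Rightarrow> real" and g1 G1 :: "complex \<Rightarrow> complex" and d :: complex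
  defines "q \<equiv> 1 - p"
    and "h \<equiv> entropy_pq p"
    and "ET \<equiv> (\<lambda>n. if n < 2 then 0 else integral\<^sup>L M (T n))"
    and "g1 \<equiv> poisson_gf ET"
    and "G1 \<equiv> mellin_continuation g1 (vstrip (- 2) (- \<alpha>))"
    and "d \<equiv> (if c = 0 then G1 (- 1) / of_real h
              else Lim (at (- 1)) (\<lambda>s. G1 s + of_real c / (s + 1)) / of_real h +
                   of_real (c * (p * (ln p)\<^sup>2 + q * (ln q)\<^sup>2) / (2 * h\<^sup>2)))"
  assumes p: "0 < p" "p < 1"
    and prob: "prob_space M"
    and X_rv: "\<And>n. X n \<in> borel_measurable M"
    and X'_rv: "\<And>n. X' n \<in> borel_measurable M"
    and J_rv: "\<And>n. n \<ge> 2 \<Longrightarrow> J n \<in> measurable M (count_space UNIV)"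
    and T_int: "\<And>n. n \<ge> 2 \<Longrightarrow> integrable M (T n)"
    and X0: "AE \<omega> in M. X 0 \<omega> = 0" and X1: "AE \<omega> in M. X 1 \<omega> = 0"
    and copy: "distr M seq_algebra (\<lambda>\<omega> k. X' k \<omega>) = distr M seq_algebra (\<lambda>\<omega> k. X k \<omega>)"
    and J_binom: "\<And>n. n \<ge> 2 \<Longrightarrow>
          distr M (count_space UNIV) (J n) = measure_pmf (binomial_pmf n p)"
    and indep: "\<And>n. n \<ge> 2 \<Longrightarrow> indep_quadruple M X X' (J n) (T n)"
    and recurrence: "\<And>n. n \<ge> 2 \<Longrightarrow>
          distr M borel (X n) =
          distr M borel (\<lambda>\<omega>. X (J n \<omega>) \<omega> + X' (n - J n \<omega>) \<omega> + T n \<omega>)"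
    and g1_conv: "\<And>z::complex. summable (\<lambda>n. of_real (ET n) * z ^ n / fact n)"
    and \<theta>: "0 < \<theta>" "\<theta> < pi / 2" and \<alpha>: "\<alpha> < 1"
    and cases: "(g1 \<in> JS \<alpha> \<beta> \<and> c = 0) \<or>
          (g1 \<in> JS_all \<and>
           (\<lambda>z. norm (g1 z - of_real c * z))
             \<in> O[inf at_infinity (principal {z. \<bar>Arg z\<bar> \<le> \<theta>})](\<lambda>z.
                  norm z powr \<alpha> * log_plus (norm z) powr \<beta>))"
  shows "(\<lambda>n. of_real (integral\<^sup>L M (X n) / real n) -
            (of_real (c / h * ln (real n)) + d +
             fluctuation p G1 (real (log_ratio_num p) * log (1 / p) (real n))))
         \<in> o(\<lambda>_. 1)"
proof -
  define a where "a = (\<lambda>n. integral\<^sup>L M (X n))"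
  note rec = prob_space.splitting_recurrence_expectation[OF prob p X_rv X'_rv J_rv T_int X0 X1 copy J_binom indep recurrence]
  have a0: "a 0 = 0" unfolding a_def by (rule rec(1))
  have a1: "a 1 = 0" unfolding a_def by (rule rec(2))
  have a: "a n = (\<Sum>k\<le>n. Bernstein n k p * (a k + a (n - k))) + ET n" for n
    unfolding a_def ET_def by (rule rec(3))
  have ET01: "ET n = 0" if "n < 2" for n using that by (simp add: ET_def)
  have "(\<lambda>n. of_real (a n / real n) - (of_real (c / h * ln (real n)) + d +
      fluctuation p G1 (real (log_ratio_num p) * log (1 / p) (real n)))) \<longlonglongrightarrow> 0"
    unfolding d_def h_def q_def G1_def g1_def
    by (rule splitting_recurrence_asymptotics[OF p a0 a1 ET01 a g1_conv \<theta> \<alpha> cases[unfolded g1_def]])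
  thus ?thesis by (intro smalloI_tendsto) (simp_all add: a_def)
qed


end
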